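(* Consider the general first-fit model (sizes $\alpha_1<\alpha_2<\cdots$, probabilities $p_1,p_2,\dots$, scaling parameter $r$), and let $i$ be an item type. Assume that, as $r\to\infty$, $\frac1rF_j(r\beta_j;\infty)\xrightarrow{P}p_j$ for all $j<i$. Suppose furthermore that for some $y\in[\beta_{i-1},\beta_i)$, as $r\to\infty$, $$\frac1rF_i(ry;\infty)\xrightarrow{P}\frac{y-\beta_{i-1}}{\alpha_i}.$$ Then there exists $\epsilon>0$ (which may depend on $y$ and $i$) such that, as $r\to\infty$, $$\frac1rF_i(r(y+\epsilon);\infty)\xrightarrow{P}\frac{y+\epsilon-\beta_{i-1}}{\alpha_i}.$$
   Context: General first-fit model with scaling parameter $r>0$. Item types are indexed by $i=1,2,\dots$ (finitely or countably many types). Type-$i$ items ("$i$-items") have size $\alpha_i$, where $0<\alpha_1<\alpha_2<\cdots$ is a strictly increasing sequence of real numbers which is either finite or converges to infinity. Type $i$ has probability $p_i>0$, $\sum_i p_i=1$, and the mean item size $M=\sum_i\alpha_ip_i$ is finite. Items of type $i$ arrive as independent Poisson processes of rates $p_ir$. Items are stored on the half-axis $[0,\infty)$. First-fit discipline: an arriving $i$-item is immediately placed into the left-most interval $[x,x+\alpha_i)$, $x\ge0$, that does not intersect the intervals occupied by items currently present. Each item departs (freeing its interval) after an independent exponentially distributed service time of mean $1$. The state is the packing configuration (positions and types of all items present); restricting to the (countable) set of states reachable from the empty state, the process is an irreducible positive recurrent continuous-time Markov chain, with a unique stationary distribution for each $r$. For a state, $F_i(x)$ is the number of $i$-items located completely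 within $[0,x)$. $F_i(x;\infty)$ denotes the random variable $F_i(x)$ when the state has the stationary distribution of the system with parameter $r$. Notation: $\beta_i=\sum_{j=1}^i\alpha_jp_j$, $\beta_0=0$. $\xrightarrow{P}$ denotes convergence in probability. *)

theory Defs
  imports "HOL-Probability.Probability"
begin

text \<open>
  The set of item types \<open>I\<close> is \<open>{1..n}\<close> (finitely many types) or \<open>{1..}\<close>
  (countably many types); \<open>\<alpha> i\<close> and \<open>p i\<close> are the size and the probability of type \<open>i\<close>,
  and are unconstrained for \<open>i\<close> outside \<open>I\<close>.
\<close>

locale first_fit_model =
  fixes I :: "nat set" and \<alpha> p :: "nat \<Rightarrow> real"
  assumes types: "I = {1..} \<or> (\<exists>n\<ge>1. I = {1..n})"
    and size_pos: "i \<in> I \<Longrightarrow> 0 < \<alpha> i"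
    and size_strict_mono: "strict_mono_on I \<alpha>"
    and size_to_infinity: "infinite I \<Longrightarrow> filterlim \<alpha> at_top sequentially"
    and prob_pos: "i \<in> I \<Longrightarrow> 0 < p i"
    and prob_sum: "(p has_sum 1) I"
    and mean_size_finite: "(\<lambda>i. \<alpha> i * p i) summable_on I"

text \<open>
  A packing configuration is the set of the items present, each given by its left endpoint and
  its type. Distinct items occupy disjoint nonempty intervals, so this determines the state.
\<close>

type_synonym config = "(real \<times> nat) set"

definition item_interval :: "(nat \<Rightarrow> real) \<Rightarrow> real \<times> nat \<Rightarrow> real set" where
  "item_interval \<alpha> a = {fst a ..< fst a + \<alpha> (snd a)}"

text \<open>
  The minimum is attained for finite \<open>S\<close>: as the intervals are half-open, the set of admissible
  left endpoints is closed.
\<close>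

definition first_fit_position :: "(nat \<Rightarrow> real) \<Rightarrow> config \<Rightarrow> nat \<Rightarrow> real" where
  "first_fit_position \<alpha> S i =
     (LEAST x. 0 \<le> x \<and> (\<forall>a\<in>S. item_interval \<alpha> (x, i) \<inter> item_interval \<alpha> a = {}))"

definition arrive :: "(nat \<Rightarrow> real) \<Rightarrow> config \<Rightarrow> nat \<Rightarrow> config" where
  "arrive \<alpha> S i = insert (first_fit_position \<alpha> S i, i) S"

inductive_set reachable :: "nat set \<Rightarrow> (nat \<Rightarrow> real) \<Rightarrow> config set"
  for I :: "nat set" and \<alpha> :: "nat \<Rightarrow> real" where
  empty: "{} \<in> reachable I \<alpha>"
| arrival: "S \<in> reachable I \<alpha> \<Longrightarrow> i \<in> I \<Longrightarrow> arrive \<alpha> S i \<in> reachable I \<alpha>"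
| departure: "S \<in> reachable I \<alpha> \<Longrightarrow> a \<in> S \<Longrightarrow> S - {a} \<in> reachable I \<alpha>"

text \<open>
  Off-diagonal entries of the generator (Q-matrix) of the Markov chain: each \<open>i\<close>-arrival occurs
  at rate \<open>p i * r\<close>, and each item present departs at rate \<open>1\<close>.
\<close>

definition transition_rate ::
    "nat set \<Rightarrow> (nat \<Rightarrow> real) \<Rightarrow> (nat \<Rightarrow> real) \<Rightarrow> real \<Rightarrow> config \<Rightarrow> config \<Rightarrow> real" where
  "transition_rate I \<alpha> p r S T =
     (\<Sum>\<^sub>\<infinity>i\<in>{i\<in>I. T = arrive \<alpha> S i}. p i * r) + real (card {a\<in>S. T = S - {a}})"

definition exit_rate :: "nat set \<Rightarrow> (nat \<Rightarrow> real) \<Rightarrow> (nat \<Rightarrow> real) \<Rightarrow> real \<Rightarrow> config \<Rightarrow> real" where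
  "exit_rate I \<alpha> p r S = (\<Sum>\<^sub>\<infinity>T\<in>reachable I \<alpha> - {S}. transition_rate I \<alpha> p r S T)"

text \<open>
  \<open>\<pi>\<close> is an invariant probability distribution \<open>\<pi> Q = 0\<close> of the chain on the reachable states,
  with the diagonal term (minus the exit rate) moved to the other side.
\<close>

definition stationary_distribution ::
    "nat set \<Rightarrow> (nat \<Rightarrow> real) \<Rightarrow> (nat \<Rightarrow> real) \<Rightarrow> real \<Rightarrow> config pmf \<Rightarrow> bool" where
  "stationary_distribution I \<alpha> p r \<pi> \<longleftrightarrow>
     set_pmf \<pi> \<subseteq> reachable I \<alpha> \<and>
     (\<forall>T\<in>reachable I \<alpha>.
        ((\<lambda>S. pmf \<pi> S * transition_rate I \<alpha> p r S T) has_sum (pmf \<pi> T * exit_rate I \<alpha> p r T))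
          (reachable I \<alpha> - {T}))"

definition F :: "(nat \<Rightarrow> real) \<Rightarrow> nat \<Rightarrow> real \<Rightarrow> config \<Rightarrow> nat" where
  "F \<alpha> i x S = card {a\<in>S. snd a = i \<and> item_interval \<alpha> a \<subseteq> {0..<x}}"

definition \<beta> :: "(nat \<Rightarrow> real) \<Rightarrow> (nat \<Rightarrow> real) \<Rightarrow> nat \<Rightarrow> real" where
  "\<beta> \<alpha> p i = (\<Sum>j=1..i. \<alpha> j * p j)"

text \<open>
  Convergence in probability to a constant, as \<open>r \<rightarrow> \<infinity>\<close>, of \<open>X r\<close>, where
  each \<open>X r\<close> is a random variable on its own probability space \<open>\<pi> r\<close>.
\<close>

definition converges_in_prob ::
    "(real \<Rightarrow> 'a pmf) \<Rightarrow> (real \<Rightarrow> 'a \<Rightarrow> real) \<Rightarrow> real \<Rightarrow> bool" where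
  "converges_in_prob \<pi> X c \<longleftrightarrow>
     (\<forall>\<delta>>0. ((\<lambda>r. measure_pmf.prob (\<pi> r) {s. \<bar>X r s - c\<bar> > \<delta>}) \<longlongrightarrow> 0) at_top)"

end

theory Submission
  imports Defs
begin

text \<open>
  Call a free interval of length \<open>\<alpha> i\<close> starting at the origin or at the end of an item a slot. Up to
  \<open>r y\<close> the line is filled by the types \<open>j < i\<close> and part of type \<open>i\<close>, so for small \<open>\<epsilon>\<close> the departures
  from \<open>[0, r (y + \<epsilon>))\<close> open slots at a rate that is smaller than the arrival rate \<open>p i * r\<close> of
  \<open>i\<close>-items. Hence the length of the available space is \<open>o(r)\<close>, and a positive fraction of the time
  there is no slot at all.

  An item is loose at level \<open>m\<close> if the window of length \<open>(m + 1) \<alpha> i\<close> behind it contains at most \<open>m\<close>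
  starts of items or slots, that is, if it wastes room for a further \<open>i\<close>-item. There is no loose item
  at level \<open>0\<close>. The number of items plus slots beyond \<open>r y\<close> practically never decreases, so in
  stationarity it practically never increases. If the item behind an item that is loose at level
  \<open>m + 1\<close> departs and is replaced by an \<open>i\<close>-item, then either this number increases or the new item is
  loose at level \<open>m\<close>. By induction on \<open>m\<close> the number of loose items is \<open>o(r)\<close> at each level, so the
  waste in \<open>[r y, r (y + \<epsilon>))\<close> is \<open>o(r)\<close>, and this region is filled by \<open>i\<close>-items.

  All of this is carried out by integrating generator inequalities against the stationary
  distribution, without constructing the process.
\<close>

section \<open>Packing configurations\<close>

text \<open>The comparison of rates rests on a size effect: the gap left by a type below
  \<open>i\<close> is too short for an \<open>i\<close>-item unless free space adjoins it. So below
  \<open>r y\<close> practically only the \<open>i\<close>-items open room,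
  \<open>\<alpha> i\<close> each, and there are fewer than \<open>p i * r\<close> of them because
  \<open>y < \<beta> \<alpha> p i\<close>. Room is measured by length and not by the number of
  slots: a long gap is a single slot, and remains one while \<open>i\<close>-items fill it, whereas
  its length drops by \<open>\<alpha> i\<close> with each of them.

  That slot-free states have positive probability does not suffice by itself, since the loose items
  might be present only while there are slots. Their number is therefore multiplied by the available
  length, whose negative drift carries over to the product.

  Sizes have only a finite mean, so squares of opened lengths are truncated at a size
  \<open>M\<close> that is fixed before \<open>r\<close> grows. A window of length
  \<open>(m + 1) \<alpha> i\<close> is only guaranteed about \<open>m - 1\<close> points, and this
  loss vanishes as \<open>m\<close> grows, which is why all levels are treated. Volume bounds the
  number of \<open>i\<close>-items from above, so a lower bound for its mean completes the
  proof.\<close>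

lemma card_separated_le:
  fixes X :: "real set"
  assumes "finite X" "X \<subseteq> {x..x + h}" "0 < \<delta>" "0 \<le> h"
    and sep: "\<And>a b. a \<in> X \<Longrightarrow> b \<in> X \<Longrightarrow> a < b \<Longrightarrow> a + \<delta> \<le> b"
  shows "real (card X) \<le> h / \<delta> + 1"
proof -
  define g where "g a = nat \<lfloor>(a - x) / \<delta>\<rfloor>" for a
  have lt: "g a < g b" if "a \<in> X" "b \<in> X" "a < b" for a b
  proof -
    have "0 \<le> (a - x) / \<delta>" using that assms by auto
    moreover have "(a - x) / \<delta> + 1 \<le> (b - x) / \<delta>"
    proof -
      have "(a - x + \<delta>) / \<delta> \<le> (b - x) / \<delta>"
        using sep[OF that] \<open>0 < \<delta>\<close> by (intro divide_right_mono) auto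
      then show "(a - x) / \<delta> + 1 \<le> (b - x) / \<delta>" using \<open>0 < \<delta>\<close> by (simp add: add_divide_distrib)
    qed
    then have "\<lfloor>(a - x) / \<delta>\<rfloor> + 1 \<le> \<lfloor>(b - x) / \<delta>\<rfloor>"
      by linarith
    ultimately show ?thesis unfolding g_def by linarith
  qed
  have "inj_on g X"
    by (rule linorder_inj_onI) (use lt in force)+
  moreover have "g ` X \<subseteq> {..nat \<lfloor>h / \<delta>\<rfloor>}"
  proof (rule image_subsetI)
    fix a assume "a \<in> X"
    then have "(a - x) / \<delta> \<le> h / \<delta>" using assms by (auto intro!: divide_right_mono)
    then show "g a \<in> {..nat \<lfloor>h / \<delta>\<rfloor>}" unfolding g_def by (auto intro!: nat_mono floor_mono)
  qed
  ultimately have "card X \<le> card {..nat \<lfloor>h / \<delta>\<rfloor>}"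
    using card_mono[OF finite_atMost, of "g ` X"] by (simp add: card_image)
  moreover have "0 \<le> h / \<delta>" using assms by simp
  ultimately show ?thesis
    using of_nat_floor[of "h / \<delta>"] by (simp add: order_trans[OF of_nat_mono])
qed

context first_fit_model
begin

lemma one_type: "1 \<in> I"
  using types by auto

lemma type_ge_1: "k \<in> I \<Longrightarrow> 1 \<le> k"
  using types by auto

lemma type_down: "k \<in> I \<Longrightarrow> 1 \<le> j \<Longrightarrow> j \<le> k \<Longrightarrow> j \<in> I"
  using types by auto

lemma size_less: "j \<in> I \<Longrightarrow> k \<in> I \<Longrightarrow> j < k \<Longrightarrow> \<alpha> j < \<alpha> k"
  using size_strict_mono by (auto simp: strict_mono_on_def)

lemma size_le: "j \<in> I \<Longrightarrow> k \<in> I \<Longrightarrow> j \<le> k \<Longrightarrow> \<alpha> j \<le> \<alpha> k"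
  using size_less[of j k] by (cases "j = k") auto

lemma size_1_le: "k \<in> I \<Longrightarrow> \<alpha> 1 \<le> \<alpha> k"
  using one_type type_ge_1 by (intro size_le) auto

lemma size_1_pos: "0 < \<alpha> 1"
  using size_pos one_type by auto

definition right_end :: "real \<times> nat \<Rightarrow> real" where
  "right_end a = fst a + \<alpha> (snd a)"

definition valid :: "config \<Rightarrow> bool" where
  "valid S \<longleftrightarrow> finite S \<and> (\<forall>a\<in>S. 0 \<le> fst a \<and> snd a \<in> I) \<and>
     (\<forall>a\<in>S. \<forall>b\<in>S. a \<noteq> b \<longrightarrow> right_end a \<le> fst b \<or> right_end b \<le> fst a)"

definition vacant :: "config \<Rightarrow> real \<Rightarrow> real \<Rightarrow> bool" where
  "vacant S x y \<longleftrightarrow> (\<forall>a\<in>S. right_end a \<le> x \<or> y \<le> fst a)"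

definition anchors :: "config \<Rightarrow> real set" where
  "anchors S = insert 0 (right_end ` S)"

lemma validD:
  assumes "valid S"
  shows "finite S" "a \<in> S \<Longrightarrow> 0 \<le> fst a" "a \<in> S \<Longrightarrow> snd a \<in> I"
    "a \<in> S \<Longrightarrow> b \<in> S \<Longrightarrow> a \<noteq> b \<Longrightarrow> right_end a \<le> fst b \<or> right_end b \<le> fst a"
    "a \<in> S \<Longrightarrow> fst a < right_end a" "a \<in> S \<Longrightarrow> fst a + \<alpha> 1 \<le> right_end a"
    "finite (anchors S)"
proof -
  show *: "finite S" "a \<in> S \<Longrightarrow> 0 \<le> fst a" "a \<in> S \<Longrightarrow> snd a \<in> I"
    "a \<in> S \<Longrightarrow> b \<in> S \<Longrightarrow> a \<noteq> b \<Longrightarrow> right_end a \<le> fst b \<or> right_end b \<le> fst a"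
    using assms unfolding valid_def by blast+
  show "a \<in> S \<Longrightarrow> fst a < right_end a" using size_pos[OF *(3)] by (simp add: right_end_def)
  show "a \<in> S \<Longrightarrow> fst a + \<alpha> 1 \<le> right_end a" using size_1_le[OF *(3)] by (simp add: right_end_def)
  show "finite (anchors S)" using *(1) by (simp add: anchors_def)
qed

lemma valid_empty: "valid {}"
  by (auto simp: valid_def)

lemma valid_diff: "valid S \<Longrightarrow> valid (S - T)"
  unfolding valid_def by simp

lemma vacant_diff: "vacant S x y \<Longrightarrow> vacant (S - T) x y"
  unfolding vacant_def by blast

lemma vacant_insert: "vacant (insert a S) x y \<longleftrightarrow> (right_end a \<le> x \<or> y \<le> fst a) \<and> vacant S x y"
  unfolding vacant_def by auto

lemma vacant_subset: "vacant S x y \<Longrightarrow> x \<le> x' \<Longrightarrow> y' \<le> y \<Longrightarrow> vacant S x' y'"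
proof -
  assume v: "vacant S x y" and le: "x \<le> x'" "y' \<le> y"
  show ?thesis
    unfolding vacant_def
  proof
    fix a assume "a \<in> S"
    then have "right_end a \<le> x \<or> y \<le> fst a" using v by (simp add: vacant_def)
    then show "right_end a \<le> x' \<or> y' \<le> fst a" using le by linarith
  qed
qed

lemma vacant_iff_disjoint:
  assumes "valid S" "k \<in> I"
  shows "(\<forall>a\<in>S. item_interval \<alpha> (x, k) \<inter> item_interval \<alpha> a = {}) \<longleftrightarrow> vacant S x (x + \<alpha> k)"
proof -
  have "item_interval \<alpha> (x, k) \<inter> item_interval \<alpha> a = {} \<longleftrightarrow> right_end a \<le> x \<or> x + \<alpha> k \<le> fst a"
    if "a \<in> S" for a
    using validD(5)[OF assms(1) that] size_pos[OF assms(2)]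
    unfolding item_interval_def right_end_def Int_atLeastLessThan
    by (simp add: max_def min_def not_less not_le)
  then show ?thesis unfolding vacant_def by blast
qed

text \<open>A free interval can be extended to the left until it meets the origin or the end of an
  item. This reduces all positions to the finitely many anchors.\<close>

lemma anchor_below:
  assumes "valid S" "0 \<le> z" "vacant S z (z + l)" "0 < l"
  obtains e where "e \<in> anchors S" "e \<le> z" "vacant S e (z + l)"
proof
  let ?E = "{e \<in> anchors S. e \<le> z}"
  have fin: "finite ?E" "?E \<noteq> {}"
    using validD(7)[OF assms(1)] assms(2) by (auto simp: anchors_def)
  define e where "e = Max ?E"
  have e: "e \<in> ?E" unfolding e_def using fin by (rule Max_in)
  then show "e \<in> anchors S" "e \<le> z" by auto
  show "vacant S e (z + l)"
    unfolding vacant_def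
  proof
    fix a assume a: "a \<in> S"
    then have "right_end a \<le> z \<or> z + l \<le> fst a" using assms(3) by (auto simp: vacant_def)
    moreover have "right_end a \<le> e" if "right_end a \<le> z"
      unfolding e_def using that a fin by (intro Max_ge) (auto simp: anchors_def)
    ultimately show "right_end a \<le> e \<or> z + l \<le> fst a" by blast
  qed
qed

text \<open>An item that ends beyond \<open>e\<close> cannot meet the free interval, so it begins
  behind it and, having positive length, ends strictly later. In particular, free intervals at two
  different anchors never overlap.\<close>

lemma anchor_after_vacant:
  assumes "valid S" "e' \<in> anchors S" "0 \<le> e" "e < e'" "vacant S e (e + l)" "0 < l"
  shows "e + l < e'"
proof -
  obtain a where a: "a \<in> S" "e' = right_end a" using assms by (auto simp: anchors_def)
  then have "right_end a \<le> e \<or> e + l \<le> fst a" using assms(5) by (auto simp: vacant_def)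
  then show ?thesis using a assms(4) validD(5)[OF assms(1) a(1)] by auto
qed

lemma anchor_nonneg: "valid S \<Longrightarrow> e \<in> anchors S \<Longrightarrow> 0 \<le> e"
  unfolding anchors_def by (auto intro: order_trans[OF validD(2) less_imp_le[OF validD(5)]])

lemma vacant_exists:
  assumes "valid S"
  shows "\<exists>z\<ge>0. vacant S z (z + l)"
proof -
  have fin: "finite (anchors S)" by (rule validD[OF assms])
  have "vacant S (Max (anchors S)) y" for y
    unfolding vacant_def using fin by (auto simp: anchors_def)
  moreover have "0 \<le> Max (anchors S)" using fin by (intro Max_ge) (auto simp: anchors_def)
  ultimately show ?thesis by blast
qed

text \<open>A \<open>LEAST\<close> over the reals need not be attained. Here it is the minimum of a
  finite set, because every admissible position has an admissible anchor at or to the left of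
  it.\<close>

lemma first_fit:
  assumes "valid S" "k \<in> I"
  shows "first_fit_position \<alpha> S k \<in> anchors S"
    and "vacant S (first_fit_position \<alpha> S k) (first_fit_position \<alpha> S k + \<alpha> k)"
    and "0 \<le> z \<Longrightarrow> vacant S z (z + \<alpha> k) \<Longrightarrow> first_fit_position \<alpha> S k \<le> z"
proof -
  have pos: "0 < \<alpha> k" using size_pos assms by auto
  let ?C = "{e \<in> anchors S. vacant S e (e + \<alpha> k)}"
  have fin: "finite ?C" using validD(7)[OF assms(1)] by auto
  have shift: "\<exists>e\<in>?C. e \<le> z" if z: "0 \<le> z" "vacant S z (z + \<alpha> k)" for z
  proof -
    obtain e where e: "e \<in> anchors S" "e \<le> z" "vacant S e (z + \<alpha> k)"
      using anchor_below[OF assms(1) z pos] by metis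
    then have "vacant S e (e + \<alpha> k)" by (auto elim: vacant_subset)
    then show ?thesis using e by auto
  qed
  have ne: "?C \<noteq> {}" using shift vacant_exists[OF assms(1), of "\<alpha> k"] by blast
  have eq: "first_fit_position \<alpha> S k = Min ?C"
    unfolding first_fit_position_def vacant_iff_disjoint[OF assms]
  proof (rule Least_equality)
    have "Min ?C \<in> ?C" using fin ne by (rule Min_in)
    then show "0 \<le> Min ?C \<and> vacant S (Min ?C) (Min ?C + \<alpha> k)"
      using anchor_nonneg[OF assms(1)] by auto
  next
    fix z assume "0 \<le> z \<and> vacant S z (z + \<alpha> k)"
    then show "Min ?C \<le> z" using shift[of z] fin by (meson Min_le order_trans)
  qed
  have "Min ?C \<in> ?C" using fin ne by (rule Min_in)
  then show "first_fit_position \<alpha> S k \<in> anchors S"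
    "vacant S (first_fit_position \<alpha> S k) (first_fit_position \<alpha> S k + \<alpha> k)"
    unfolding eq by auto
  show "first_fit_position \<alpha> S k \<le> z" if "0 \<le> z" "vacant S z (z + \<alpha> k)"
    unfolding eq using shift[OF that] fin by (meson Min_le order_trans)
qed

lemma valid_insert:
  assumes "valid S" "k \<in> I" "0 \<le> s" "vacant S s (s + \<alpha> k)"
  shows "valid (insert (s, k) S)" "(s, k) \<notin> S"
proof -
  have "right_end a \<le> s \<or> s + \<alpha> k \<le> fst a" if "a \<in> S" for a
    using assms(4) that by (auto simp: vacant_def)
  then show "valid (insert (s, k) S)"
    using assms(1-3) unfolding valid_def by (auto simp: right_end_def[of "(s, k)"])
  show "(s, k) \<notin> S"
    using assms(4) size_pos[OF assms(2)] unfolding vacant_def right_end_def by fastforce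
qed

lemma valid_arrive:
  assumes "valid S" "k \<in> I"
  shows "valid (arrive \<alpha> S k)" "(first_fit_position \<alpha> S k, k) \<notin> S"
  using valid_insert[OF assms] first_fit[OF assms] anchor_nonneg[OF assms(1)]
  unfolding arrive_def by auto

lemma reachable_valid: "S \<in> reachable I \<alpha> \<Longrightarrow> valid S"
  by (induction rule: reachable.induct) (auto intro: valid_empty valid_arrive valid_diff)

section \<open>Separation of the items, and the gap in front of an item\<close>

lemma right_end_inj:
  assumes "valid S" "a \<in> S" "b \<in> S" "right_end a = right_end b"
  shows "a = b"
  using assms(4) validD(4)[OF assms(1-3)] validD(5)[OF assms(1) assms(2)] validD(5)[OF assms(1) assms(3)]
  by (cases "a = b") auto

lemma fst_inj:
  assumes "valid S" "a \<in> S" "b \<in> S" "fst a = fst b"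
  shows "a = b"
  using assms(4) validD(4)[OF assms(1-3)] validD(5)[OF assms(1) assms(2)] validD(5)[OF assms(1) assms(3)]
  by (cases "a = b") auto

lemma fst_less_sep:
  assumes "valid S" "a \<in> S" "b \<in> S" "fst a < fst b"
  shows "right_end a \<le> fst b"
  using assms(4) validD(4)[OF assms(1-3)] validD(5)[OF assms(1) assms(2)] validD(5)[OF assms(1) assms(3)]
  by (cases "a = b") auto

lemma right_end_less_sep:
  assumes "valid S" "a \<in> S" "b \<in> S" "right_end a < right_end b"
  shows "right_end a \<le> fst b"
  using assms(4) validD(4)[OF assms(1-3)] validD(5)[OF assms(1) assms(2)] validD(5)[OF assms(1) assms(3)]
  by (cases "a = b") auto

lemma card_starts_le:
  assumes "valid S" "0 \<le> h"
  shows "real (card {a \<in> S. x \<le> fst a \<and> fst a \<le> x + h}) \<le> h / \<alpha> 1 + 1"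
proof -
  let ?T = "{a \<in> S. x \<le> fst a \<and> fst a \<le> x + h}"
  have fin: "finite ?T" using validD(1)[OF assms(1)] by simp
  have "inj_on fst ?T" by (rule inj_onI) (auto dest: fst_inj[OF assms(1)] simp: prod_eq_iff)
  then have "card ?T = card (fst ` ?T)" by (simp add: card_image)
  also have "real \<dots> \<le> h / \<alpha> 1 + 1"
  proof (rule card_separated_le[of _ x])
    fix a b assume "a \<in> fst ` ?T" "b \<in> fst ` ?T" "a < b"
    then show "a + \<alpha> 1 \<le> b"
      using fst_less_sep[OF assms(1)] validD(6)[OF assms(1)] by fastforce
  qed (use fin assms size_1_pos in auto)
  finally show ?thesis .
qed

lemma card_inside_le:
  assumes "valid S" "0 \<le> L"
  shows "real (card {b \<in> S. fst b < L}) \<le> L / \<alpha> 1 + 1"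
proof -
  have "card {b \<in> S. fst b < L} \<le> card {b \<in> S. 0 \<le> fst b \<and> fst b \<le> 0 + L}"
    using validD(1,2)[OF assms(1)] by (intro card_mono) auto
  then show ?thesis using card_starts_le[OF assms, of 0] by linarith
qed

lemma card_right_ends_le:
  assumes "valid S" "0 \<le> h"
  shows "real (card {a \<in> S. x \<le> right_end a \<and> right_end a \<le> x + h}) \<le> h / \<alpha> 1 + 1"
proof -
  let ?T = "{a \<in> S. x \<le> right_end a \<and> right_end a \<le> x + h}"
  have fin: "finite ?T" using validD(1)[OF assms(1)] by simp
  have "inj_on right_end ?T" by (rule inj_onI) (use right_end_inj[OF assms(1)] in blast)
  then have "card ?T = card (right_end ` ?T)" by (simp add: card_image)
  also have "real \<dots> \<le> h / \<alpha> 1 + 1"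
  proof (rule card_separated_le[of _ x])
    fix a b assume "a \<in> right_end ` ?T" "b \<in> right_end ` ?T" "a < b"
    then show "a + \<alpha> 1 \<le> b"
      using right_end_less_sep[OF assms(1)] validD(6)[OF assms(1)] by fastforce
  qed (use fin assms size_1_pos in auto)
  finally show ?thesis .
qed

text \<open>The anchor preceding \<open>b\<close>: the left endpoint of the gap that the departure of \<open>b\<close> opens.\<close>

definition pred_anchor :: "config \<Rightarrow> real \<times> nat \<Rightarrow> real" where
  "pred_anchor S b = Max {e \<in> anchors (S - {b}). e \<le> fst b}"

lemma pred_anchor:
  assumes "valid S" "b \<in> S"
  shows "pred_anchor S b \<in> anchors (S - {b})" "pred_anchor S b \<le> fst b" "0 \<le> pred_anchor S b"
    "e \<in> anchors (S - {b}) \<Longrightarrow> e \<le> fst b \<Longrightarrow> e \<le> pred_anchor S b"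
    "vacant (S - {b}) (pred_anchor S b) (right_end b)"
proof -
  let ?E = "{e \<in> anchors (S - {b}). e \<le> fst b}"
  have v: "valid (S - {b})" using assms valid_diff by auto
  have fin: "finite ?E" "?E \<noteq> {}"
    using validD(7)[OF v] validD(2)[OF assms] by (auto simp: anchors_def)
  have "pred_anchor S b \<in> ?E" unfolding pred_anchor_def using fin by (rule Max_in)
  then show *: "pred_anchor S b \<in> anchors (S - {b})" "pred_anchor S b \<le> fst b" by auto
  show "0 \<le> pred_anchor S b" using anchor_nonneg[OF v *(1)] .
  show ge: "e \<le> pred_anchor S b" if "e \<in> anchors (S - {b})" "e \<le> fst b" for e
    unfolding pred_anchor_def using fin that by (intro Max_ge) auto
  show "vacant (S - {b}) (pred_anchor S b) (right_end b)"
    unfolding vacant_def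
  proof
    fix a assume a: "a \<in> S - {b}"
    then have "right_end a \<le> fst b \<or> right_end b \<le> fst a" using validD(4)[OF assms(1)] assms(2) by auto
    then show "right_end a \<le> pred_anchor S b \<or> right_end b \<le> fst a"
      using ge[of "right_end a"] a by (auto simp: anchors_def)
  qed
qed

lemma pred_anchor_less:
  assumes "valid S" "b \<in> S" "b' \<in> S" "fst b < fst b'"
  shows "right_end b \<le> pred_anchor S b'"
  using assms fst_less_sep[OF assms] by (intro pred_anchor(4)) (auto simp: anchors_def)

lemma pred_anchor_inj:
  assumes "valid S" "b \<in> S" "b' \<in> S" "pred_anchor S b = pred_anchor S b'"
  shows "b = b'"
proof (rule ccontr)
  have *: False if "x \<in> S" "x' \<in> S" "pred_anchor S x = pred_anchor S x'" "fst x < fst x'" for x x'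
    using pred_anchor_less[OF assms(1) that(1,2,4)] pred_anchor(2)[OF assms(1) that(1)] that
      validD(5)[OF assms(1) that(1)] by auto
  assume "b \<noteq> b'"
  then have "fst b < fst b' \<or> fst b' < fst b" using fst_inj[OF assms(1-3)] by (meson linorder_neq_iff)
  then show False using *[OF assms(2-4)] *[OF assms(3,2) assms(4)[symmetric]] by auto
qed

text \<open>The gaps in front of different items are disjoint. Hence a fixed level, such as the
  border of a region or the end of a window, cuts the gap of at most one item.\<close>

lemma pred_anchor_cross:
  assumes "valid S" "b \<in> S" "b' \<in> S"
    and "pred_anchor S b < t" "t \<le> fst b" "pred_anchor S b' < t" "t \<le> fst b'"
  shows "b = b'"
proof (rule ccontr)
  have *: False if x: "x \<in> S" "x' \<in> S" "t \<le> fst x" "pred_anchor S x' < t" "fst x < fst x'" for x x'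
  proof -
    have "right_end x \<le> pred_anchor S x'" using pred_anchor_less[OF assms(1) x(1,2,5)] .
    moreover have "fst x < right_end x" using validD(5)[OF assms(1) x(1)] .
    ultimately show False using x(3,4) by simp
  qed
  assume "b \<noteq> b'"
  then have "fst b < fst b' \<or> fst b' < fst b" using fst_inj[OF assms(1-3)] by (meson linorder_neq_iff)
  then show False
  proof
    assume "fst b < fst b'"
    then show False using *[OF assms(2,3,5,6)] by simp
  next
    assume "fst b' < fst b"
    then show False using *[OF assms(3,2,7,4)] by simp
  qed
qed

end

section \<open>Slots, points and loose items\<close>

locale first_fit_type = first_fit_model +
  fixes i :: nat
  assumes type_i: "i \<in> I"
begin

lemma size_i_pos: "0 < \<alpha> i"
  using size_pos type_i by auto

definition slots :: "real \<Rightarrow> config \<Rightarrow> real set" where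
  "slots L S = {e \<in> anchors S. e + \<alpha> i \<le> L \<and> vacant S e (e + \<alpha> i)}"

text \<open>An \<open>i\<close>-arrival turns a slot into the start of an item at the same place,
  and the departure of an item of type at least \<open>i\<close> usually replaces its start by the
  slot that it opens. So the size of this set is almost monotone.\<close>

definition points :: "real \<Rightarrow> config \<Rightarrow> real set" where
  "points L S = fst ` S \<union> slots L S"

definition width :: "nat \<Rightarrow> real" where
  "width m = (real m + 1) * \<alpha> i"

definition loose :: "nat \<Rightarrow> real \<Rightarrow> real \<Rightarrow> config \<Rightarrow> config" where
  "loose m x L S = {a \<in> S. x \<le> right_end a \<and> right_end a + width m \<le> L \<and>
     card (points L S \<inter> {right_end a..<right_end a + width m}) \<le> m}"

text \<open>Bounds the number of items whose right ends lie in an interval of length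
  \<open>width m\<close>, hence the number of items whose windows contain a given point.\<close>

definition window_bound :: "nat \<Rightarrow> real" where
  "window_bound m = width m / \<alpha> 1 + 1"

text \<open>A new point can destroy up to \<open>window_bound m\<close> loose items. The weight
  exceeds this by one, so that each new point still yields a net gain of one.\<close>

definition potential :: "nat \<Rightarrow> real \<Rightarrow> real \<Rightarrow> config \<Rightarrow> real" where
  "potential m x L S =
     real (card (loose m x L S)) + (window_bound m + 1) * real (card (points L S \<inter> {x..<L}))"

lemma width_pos: "0 < width m"
  using size_i_pos by (simp add: width_def)

lemma width_Suc: "width (Suc m) = \<alpha> i + width m"
  by (simp add: width_def algebra_simps)

lemma width_ge: "\<alpha> i \<le> width m"
  using size_i_pos by (simp add: width_def algebra_simps)

lemma window_bound_ge: "1 \<le> window_bound m"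
  using width_pos[of m] size_1_pos by (simp add: window_bound_def)

lemma finite_slots: "valid S \<Longrightarrow> finite (slots L S)"
  using validD(7) by (simp add: slots_def)

lemma finite_points: "valid S \<Longrightarrow> finite (points L S)"
  using finite_slots validD(1) by (simp add: points_def)

lemma finite_loose: "valid S \<Longrightarrow> finite (loose m x L S)"
  using validD(1) by (simp add: loose_def)

lemma card_right_ends_window:
  assumes "valid S"
  shows "real (card {a \<in> S. q - width m \<le> right_end a \<and> right_end a \<le> q}) \<le> window_bound m"
  using card_right_ends_le[OF assms less_imp_le[OF width_pos], of "q - width m" m]
  by (simp add: window_bound_def)

lemma slots_nonneg: "valid S \<Longrightarrow> e \<in> slots L S \<Longrightarrow> 0 \<le> e"
  using anchor_nonneg by (simp add: slots_def)

lemma first_fit_slot: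
  assumes "valid S" "slots L S \<noteq> {}"
  shows "first_fit_position \<alpha> S i = Min (slots L S)"
proof -
  note ff = first_fit[OF assms(1) type_i]
  let ?s = "first_fit_position \<alpha> S i"
  have le: "?s \<le> e" if "e \<in> slots L S" for e
    using ff(3)[OF slots_nonneg[OF assms(1) that]] that by (simp add: slots_def)
  obtain e where "e \<in> slots L S" using assms(2) by blast
  then have "?s \<in> slots L S" using ff(1,2) le[of e] by (auto simp: slots_def)
  then show ?thesis using le finite_slots[OF assms(1)] by (intro Min_eqI[symmetric]) auto
qed

section \<open>Placing an item at an anchor\<close>

context
  fixes S :: config and s :: real and k :: nat
  assumes S: "valid S" and k: "k \<in> I" and s: "s \<in> anchors S" "vacant S s (s + \<alpha> k)"
begin

private lemma size_k: "0 < \<alpha> k"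
  using size_pos k .

private lemma s_nonneg: "0 \<le> s"
  using anchor_nonneg[OF S s(1)] .

lemma valid_place: "valid (insert (s, k) S)" "(s, k) \<notin> S"
  using valid_insert[OF S k s_nonneg s(2)] .

lemma anchors_place: "anchors (insert (s, k) S) = insert (s + \<alpha> k) (anchors S)"
  by (auto simp: anchors_def right_end_def)

text \<open>Free intervals at different anchors do not overlap, so the new item at \<open>s\<close>
  blocks no slot except \<open>s\<close> itself.\<close>

lemma slots_place_lower: "slots L S - {s} \<subseteq> slots L (insert (s, k) S)"
proof
  fix e assume e: "e \<in> slots L S - {s}"
  then have a: "e \<in> anchors S" "vacant S e (e + \<alpha> i)" "e \<noteq> s" by (auto simp: slots_def)
  have "s + \<alpha> k \<le> e \<or> e + \<alpha> i \<le> s"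
  proof (cases "e < s")
    case True
    then show ?thesis
      using anchor_after_vacant[OF S s(1) anchor_nonneg[OF S a(1)] True a(2) size_i_pos] by simp
  next
    case False
    then have "s < e" using a by simp
    then show ?thesis
      using anchor_after_vacant[OF S a(1) s_nonneg _ s(2) size_k] by simp
  qed
  then show "e \<in> slots L (insert (s, k) S)"
    using e by (simp add: slots_def anchors_place vacant_insert right_end_def)
qed

lemma slots_place_upper: "slots L (insert (s, k) S) \<subseteq> insert (s + \<alpha> k) (slots L S - {s})"
proof
  fix e assume "e \<in> slots L (insert (s, k) S)"
  then have "e = s + \<alpha> k \<or> e \<in> anchors S" "e + \<alpha> i \<le> L" "vacant S e (e + \<alpha> i)"
    "s + \<alpha> k \<le> e \<or> e + \<alpha> i \<le> s"
    by (auto simp: slots_def anchors_place vacant_insert right_end_def)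
  then show "e \<in> insert (s + \<alpha> k) (slots L S - {s})"
    using size_k size_i_pos by (auto simp: slots_def)
qed

text \<open>If \<open>s\<close> was a slot, it turns into the start of the new item, so no point is
  lost. Consequently an arrival cannot make an old item loose.\<close>

lemma points_place_lower: "points L S \<subseteq> points L (insert (s, k) S)"
  using slots_place_lower[of L] by (auto simp: points_def)

lemma loose_place_upper: "loose m x L (insert (s, k) S) \<subseteq> insert (s, k) (loose m x L S)"
proof
  fix a assume a: "a \<in> loose m x L (insert (s, k) S)"
  let ?w = "{right_end a..<right_end a + width m}"
  have "card (points L S \<inter> ?w) \<le> card (points L (insert (s, k) S) \<inter> ?w)"
    using points_place_lower[of L] finite_points[OF valid_place(1), of L]
    by (intro card_mono) auto
  then show "a \<in> insert (s, k) (loose m x L S)" using a by (auto simp: loose_def)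
qed

text \<open>Each item that ceases to be loose has a new point in its window, and a given point lies
  in the windows of at most \<open>window_bound m\<close> items.\<close>

lemma loose_place_lost:
  "real (card (loose m x L S - loose m x L (insert (s, k) S)))
     \<le> window_bound m * real (card (points L (insert (s, k) S) \<inter> {x..<L} - points L S))"
proof -
  let ?S' = "insert (s, k) S"
  let ?N = "points L ?S' \<inter> {x..<L} - points L S"
  let ?V = "\<lambda>q. {a \<in> S. q - width m \<le> right_end a \<and> right_end a \<le> q}"
  have finN: "finite ?N" using finite_points[OF valid_place(1)] by blast
  have finV: "finite (?V q)" for q using validD(1)[OF S] by simp
  have "loose m x L S - loose m x L ?S' \<subseteq> (\<Union>q\<in>?N. ?V q)"
  proof
    fix a assume a: "a \<in> loose m x L S - loose m x L ?S'"
    let ?w = "{right_end a..<right_end a + width m}"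
    have aS: "a \<in> S" "x \<le> right_end a" "right_end a + width m \<le> L"
      using a by (auto simp: loose_def)
    have "card (points L S \<inter> ?w) \<le> m" "\<not> card (points L ?S' \<inter> ?w) \<le> m"
      using a by (auto simp: loose_def)
    then have "points L ?S' \<inter> ?w \<noteq> points L S \<inter> ?w" by metis
    then obtain q where q: "q \<in> points L ?S'" "q \<notin> points L S" "q \<in> ?w"
      using points_place_lower[of L] by blast
    then have "q \<in> ?N" "a \<in> ?V q" using aS by auto
    then show "a \<in> (\<Union>q\<in>?N. ?V q)" by blast
  qed
  then have "card (loose m x L S - loose m x L ?S') \<le> card (\<Union>q\<in>?N. ?V q)"
    using finN finV by (intro card_mono) auto
  also have "\<dots> \<le> (\<Sum>q\<in>?N. card (?V q))" by (rule card_UN_le[OF finN])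
  finally have "real (card (loose m x L S - loose m x L ?S')) \<le> (\<Sum>q\<in>?N. real (card (?V q)))"
    by (simp flip: of_nat_sum)
  also have "\<dots> \<le> (\<Sum>q\<in>?N. window_bound m)" by (intro sum_mono card_right_ends_window[OF S])
  finally show ?thesis by (simp add: mult.commute)
qed

text \<open>Every new point pays for the loose items that it destroys and leaves a surplus of one.
  The gain in the second claim comes from such a point or from the new item, if it is loose
  itself.\<close>

lemma potential_place:
  "potential m x L S \<le> potential m x L (insert (s, k) S)" (is ?mono)
  "(s, k) \<in> loose m x L (insert (s, k) S) \<or>
     (x \<le> s + \<alpha> k \<and> s + \<alpha> k \<in> slots L (insert (s, k) S)) \<Longrightarrow>
   potential m x L S + 1 \<le> potential m x L (insert (s, k) S)"
proof -
  let ?S' = "insert (s, k) S"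
  let ?N = "points L ?S' \<inter> {x..<L} - points L S"
  let ?l = "loose m x L S" and ?l' = "loose m x L ?S'"
  have fin: "finite ?l" "finite ?l'" "finite (points L ?S')" "finite (points L S)"
    using finite_loose[OF S] finite_loose[OF valid_place(1)] finite_points[OF S]
      finite_points[OF valid_place(1)] by auto
  have "points L S \<inter> {x..<L} \<union> ?N = points L ?S' \<inter> {x..<L}"
    using points_place_lower[of L] by blast
  moreover have "card (points L S \<inter> {x..<L} \<union> ?N) = card (points L S \<inter> {x..<L}) + card ?N"
    using fin by (intro card_Un_disjoint) auto
  ultimately have count: "(window_bound m + 1) * real (card (points L ?S' \<inter> {x..<L}))
      = (window_bound m + 1) * real (card (points L S \<inter> {x..<L}))
        + window_bound m * real (card ?N) + real (card ?N)"
    by (simp add: algebra_simps)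
  have new: "(s, k) \<notin> ?l" using valid_place(2) by (simp add: loose_def)
  have "card (?l \<inter> ?l' \<union> (?l - ?l')) = card (?l \<inter> ?l') + card (?l - ?l')"
    using fin by (intro card_Un_disjoint) auto
  then have split: "card ?l = card (?l \<inter> ?l') + card (?l - ?l')" by (simp add: Int_Diff_Un)
  have keep: "card (?l \<inter> ?l') + (if (s, k) \<in> ?l' then 1 else 0) \<le> card ?l'"
  proof (cases "(s, k) \<in> ?l'")
    case True
    then have "card (insert (s, k) (?l \<inter> ?l')) \<le> card ?l'" using fin by (intro card_mono) auto
    then show ?thesis using True new fin by simp
  next
    case False
    have "card (?l \<inter> ?l') \<le> card ?l'" using fin by (intro card_mono) auto
    then show ?thesis using False by simp
  qed
  have lost: "real (card (?l - ?l')) \<le> window_bound m * real (card ?N)"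
    by (rule loose_place_lost)
  have gain: "potential m x L S + real (card ?N) + (if (s, k) \<in> ?l' then 1 else 0)
      \<le> potential m x L ?S'"
    unfolding potential_def using count split keep lost by (cases "(s, k) \<in> ?l'") auto
  then show ?mono by (auto split: if_splits)
  assume "(s, k) \<in> ?l' \<or> (x \<le> s + \<alpha> k \<and> s + \<alpha> k \<in> slots L ?S')"
  then show "potential m x L S + 1 \<le> potential m x L ?S'"
  proof
    assume "(s, k) \<in> ?l'"
    then show ?thesis using gain by auto
  next
    assume a: "x \<le> s + \<alpha> k \<and> s + \<alpha> k \<in> slots L ?S'"
    let ?e = "s + \<alpha> k"
    have vac: "vacant S ?e (?e + \<alpha> i)" "?e + \<alpha> i \<le> L"
      using a by (auto simp: slots_def vacant_insert)
    \<comment> \<open>The interval in front of \<open>?e\<close> was free, so no item ended at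
      \<open>?e\<close>; the slot at \<open>?e\<close> is free, so no item starts there. Thus
      \<open>?e\<close> is a new point.\<close>
    have "?e \<notin> anchors S"
      using anchor_after_vacant[OF S _ s_nonneg _ s(2) size_k, of ?e] size_k by auto
    moreover have "?e \<notin> fst ` S"
      using vac(1) validD(5)[OF S] size_i_pos by (force simp: vacant_def)
    ultimately have "?e \<in> ?N" using a vac(2) size_i_pos by (auto simp: points_def slots_def)
    moreover have "finite ?N" using fin by auto
    ultimately have "0 < card ?N" by (auto simp: card_gt_0_iff)
    then show ?thesis using gain by (auto split: if_splits)
  qed
qed

end

section \<open>Departure of an item\<close>

context
  fixes S :: config and b :: "real \<times> nat"
  assumes S: "valid S" and b: "b \<in> S"
begin

private lemma S': "valid (S - {b})"
  using S by (rule valid_diff)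

private lemma bD: "fst b < right_end b" "0 \<le> fst b"
  using validD(2,5)[OF S b] by auto

private lemma cD:
  "pred_anchor S b \<in> anchors (S - {b})" "pred_anchor S b \<le> fst b" "0 \<le> pred_anchor S b"
  "vacant (S - {b}) (pred_anchor S b) (right_end b)"
  using pred_anchor(1-3,5)[OF S b] by auto

lemma anchors_depart: "anchors S = insert (right_end b) (anchors (S - {b}))"
  using b by (auto simp: anchors_def)

text \<open>A newly free interval must meet the room of \<open>b\<close>, so its anchor is at most
  \<open>fst b\<close> and hence at most \<open>pred_anchor S b\<close>. From a smaller anchor it
  would end before \<open>pred_anchor S b\<close> and not reach \<open>b\<close>.\<close>

lemma slots_depart_upper: "slots L (S - {b}) \<subseteq> insert (pred_anchor S b) (slots L S)"
proof
  fix e assume "e \<in> slots L (S - {b})"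
  then have e: "e \<in> anchors (S - {b})" "e + \<alpha> i \<le> L" "vacant (S - {b}) e (e + \<alpha> i)"
    by (auto simp: slots_def)
  show "e \<in> insert (pred_anchor S b) (slots L S)"
  proof (cases "right_end b \<le> e \<or> e + \<alpha> i \<le> fst b")
    case True
    then have "vacant S e (e + \<alpha> i)" using e(3) by (auto simp: vacant_def)
    then show ?thesis using e anchors_depart by (auto simp: slots_def)
  next
    case False
    have "e \<le> fst b"
    proof (cases "e = 0")
      case False
      then obtain a where a: "a \<in> S" "a \<noteq> b" "e = right_end a" using e(1) by (auto simp: anchors_def)
      then show ?thesis
        using validD(4)[OF S a(1) b a(2)] validD(5)[OF S a(1)] \<open>\<not> (_ \<or> _)\<close> by auto
    qed (use bD in simp)
    then have le: "e \<le> pred_anchor S b" using pred_anchor(4)[OF S b e(1)] by simp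
    moreover have "\<not> e < pred_anchor S b"
      using anchor_after_vacant[OF S' cD(1) anchor_nonneg[OF S' e(1)] _ e(3) size_i_pos] False cD(2)
      by auto
    ultimately show ?thesis by simp
  qed
qed

lemma slots_depart_lower: "slots L S - {right_end b} \<subseteq> slots L (S - {b})"
  using vacant_diff[of S] by (auto simp: slots_def anchors_depart)

lemma points_depart_upper: "points L (S - {b}) \<subseteq> insert (pred_anchor S b) (points L S)"
  using slots_depart_upper[of L] by (auto simp: points_def)

lemma points_depart_lower: "points L S - {fst b, right_end b} \<subseteq> points L (S - {b})"
  using slots_depart_lower[of L] by (auto simp: points_def)

lemma slot_opened:
  assumes "i \<le> snd b" "pred_anchor S b + \<alpha> i \<le> L"
  shows "pred_anchor S b \<in> slots L (S - {b})"
proof -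
  have "\<alpha> i \<le> \<alpha> (snd b)" using size_le[OF type_i validD(3)[OF S b] assms(1)] .
  then have "pred_anchor S b + \<alpha> i \<le> right_end b" using cD(2) by (simp add: right_end_def)
  then show ?thesis
    using assms cD vacant_subset[OF cD(4) order_refl] by (simp add: slots_def)
qed

lemma start_not_in_points_depart:
  assumes "pred_anchor S b \<noteq> fst b"
  shows "fst b \<notin> points L (S - {b})"
proof
  assume "fst b \<in> points L (S - {b})"
  then consider "fst b \<in> fst ` (S - {b})" | "fst b \<in> anchors (S - {b})"
    by (auto simp: points_def slots_def)
  then show False
  proof cases
    case 1
    then obtain a where "a \<in> S" "a \<noteq> b" "fst b = fst a" by auto
    then show False using fst_inj[OF S] b by metis
  next
    case 2
    then show False using pred_anchor(4)[OF S b 2] cD(2) assms by auto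
  qed
qed

lemma pred_anchor_in_points:
  assumes "pred_anchor S b \<in> points L S"
  shows "pred_anchor S b = fst b \<or> pred_anchor S b \<in> slots L S"
proof (rule ccontr)
  assume neg: "\<not> ?thesis"
  then obtain a where a: "a \<in> S" "fst a = pred_anchor S b" using assms by (auto simp: points_def)
  then have "a \<in> S - {b}" using neg by auto
  then have "right_end a \<le> pred_anchor S b \<or> right_end b \<le> fst a" using cD(4) by (auto simp: vacant_def)
  then show False using a validD(5)[OF S a(1)] cD(2) bD by auto
qed

text \<open>The only possible new point is \<open>pred_anchor S b\<close>, and when it is new,
  \<open>fst b\<close> disappears. So the count in a window can grow only if the end of the window
  separates these two.\<close>

lemma loose_depart_kept:
  assumes "a \<in> loose m x L S" "a \<noteq> b"
    and "\<not> (pred_anchor S b < right_end a + width m \<and> right_end a + width m \<le> fst b)"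
  shows "a \<in> loose m x L (S - {b})"
proof -
  let ?w = "{right_end a..<right_end a + width m}"
  let ?c = "pred_anchor S b"
  let ?P = "points L S \<inter> ?w" and ?P' = "points L (S - {b}) \<inter> ?w"
  have fin: "finite ?P" using finite_points[OF S] by simp
  have "card ?P' \<le> card ?P"
  proof (cases "?c \<in> ?w \<and> ?c \<notin> points L S")
    case False
    then have "?P' \<subseteq> ?P" using points_depart_upper[of L] by blast
    then show ?thesis by (rule card_mono[OF fin])
  next
    case True
    then have "?c \<noteq> fst b" using b by (auto simp: points_def)
    then have *: "fst b \<notin> points L (S - {b})" by (rule start_not_in_points_depart)
    have bw: "fst b \<in> ?P" using True assms(3) cD(2) b by (auto simp: points_def)
    have "?P' \<subseteq> insert ?c (?P - {fst b})" using points_depart_upper[of L] * by blast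
    then have "card ?P' \<le> card (insert ?c (?P - {fst b}))" using fin by (intro card_mono) auto
    also have "\<dots> = Suc (card (?P - {fst b}))" using True fin by (intro card_insert_disjoint) auto
    also have "\<dots> = card ?P" by (rule card_Suc_Diff1[OF fin bw])
    finally show ?thesis .
  qed
  then show ?thesis using assms by (auto simp: loose_def)
qed

text \<open>Only the points \<open>fst b\<close> and \<open>right_end b\<close> can vanish, and each
  of them lies in the windows of at most \<open>window_bound m\<close> items.\<close>

lemma loose_depart_upper:
  "real (card (loose m x L (S - {b}))) \<le> real (card (loose m x L S)) + 2 * window_bound m"
proof -
  let ?V = "\<lambda>q. {a \<in> S. q - width m \<le> right_end a \<and> right_end a \<le> q}"
  have "loose m x L (S - {b}) \<subseteq> loose m x L S \<union> (?V (fst b) \<union> ?V (right_end b))"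
  proof
    fix a assume a: "a \<in> loose m x L (S - {b})"
    let ?w = "{right_end a..<right_end a + width m}"
    show "a \<in> loose m x L S \<union> (?V (fst b) \<union> ?V (right_end b))"
    proof (rule ccontr)
      assume neg: "\<not> ?thesis"
      then have "fst b \<notin> ?w" "right_end b \<notin> ?w" using a by (auto simp: loose_def)
      then have "points L S \<inter> ?w \<subseteq> points L (S - {b}) \<inter> ?w" using points_depart_lower[of L] by auto
      then have "card (points L S \<inter> ?w) \<le> card (points L (S - {b}) \<inter> ?w)"
        using finite_points[OF S'] by (intro card_mono) auto
      then show False using neg a by (auto simp: loose_def)
    qed
  qed
  then have "card (loose m x L (S - {b})) \<le> card (loose m x L S \<union> (?V (fst b) \<union> ?V (right_end b)))"
    using finite_loose[OF S] validD(1)[OF S] by (intro card_mono) auto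
  also have "\<dots> \<le> card (loose m x L S) + (card (?V (fst b)) + card (?V (right_end b)))"
    by (meson add_left_mono card_Un_le order_trans)
  finally show ?thesis
    using card_right_ends_window[OF S, of "fst b" m] card_right_ends_window[OF S, of "right_end b" m]
    by linarith
qed

text \<open>Normally the start \<open>fst b\<close> is exchanged for the slot
  \<open>pred_anchor S b\<close>, which leaves the count unchanged. The five terms are the
  exceptions: a slot directly behind \<open>b\<close> merges into the gap, \<open>b\<close> is too
  small to open a slot, the gap is cut by \<open>x\<close>, the gap is too close to
  \<open>L\<close>, or the slot in front of \<open>b\<close> existed before.\<close>

lemma points_depart_lost:
  "real (card (points L S \<inter> {x..<L})) - real (card (points L (S - {b}) \<inter> {x..<L}))
    \<le> of_bool (right_end b \<in> slots L S) + of_bool (x \<le> fst b \<and> fst b < L \<and> snd b < i)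
      + of_bool (pred_anchor S b < x \<and> x \<le> fst b)
      + of_bool (L < pred_anchor S b + \<alpha> i \<and> fst b < L)
      + of_bool (pred_anchor S b \<in> slots L S)"
proof -
  let ?P = "points L S \<inter> {x..<L}" and ?P' = "points L (S - {b}) \<inter> {x..<L}"
  let ?c = "pred_anchor S b"
  let ?T = "{right_end b} \<inter> slots L S"
  have fin: "finite ?P" "finite ?P'" using finite_points S S' by auto
  have T: "card ?T = of_bool (right_end b \<in> slots L S)" by simp
  have lost: "?P \<subseteq> insert (fst b) (?P' \<union> ?T)"
    using slots_depart_lower[of L] by (auto simp: points_def)
  show ?thesis
  proof (cases "x \<le> fst b \<and> fst b < L")
    case False
    then have "fst b \<notin> ?P" by auto
    then have "?P \<subseteq> ?P' \<union> ?T" using lost by blast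
    then have "card ?P \<le> card (?P' \<union> ?T)" using fin by (intro card_mono) auto
    also have "\<dots> \<le> card ?P' + card ?T" by (rule card_Un_le)
    finally show ?thesis unfolding T by (auto simp: of_bool_def)
  next
    case inside: True
    show ?thesis
    proof (cases "snd b < i \<or> pred_anchor S b < x \<or> L < pred_anchor S b + \<alpha> i \<or> pred_anchor S b \<in> slots L S")
      case True
      have "card ?P \<le> card (insert (fst b) (?P' \<union> ?T))" using fin lost by (intro card_mono) auto
      also have "\<dots> \<le> Suc (card (?P' \<union> ?T))" using card_Un_le[of "{fst b}"] by simp
      also have "\<dots> \<le> Suc (card ?P' + card ?T)" using card_Un_le by simp
      finally show ?thesis unfolding T using True inside by (auto simp: of_bool_def split: if_splits)
    next
      case False
      then have "?c \<in> slots L (S - {b})" by (intro slot_opened) auto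
      then have c: "?c \<in> ?P'" using False size_i_pos by (auto simp: points_def)
      show ?thesis
      proof (cases "?c = fst b")
        case True
        then have "?P \<subseteq> ?P' \<union> ?T" using lost c by force
        then have "card ?P \<le> card (?P' \<union> ?T)" using fin by (intro card_mono) auto
        also have "\<dots> \<le> card ?P' + card ?T" by (rule card_Un_le)
        finally show ?thesis unfolding T by (auto simp: of_bool_def)
      next
        case neq: False
        then have cnew: "?c \<notin> ?P" using pred_anchor_in_points[of L] False by auto
        have "insert ?c ?P - {fst b} \<subseteq> ?P' \<union> ?T" using lost c by blast
        then have "card (insert ?c ?P - {fst b}) \<le> card (?P' \<union> ?T)" using fin by (intro card_mono) auto
        also have "\<dots> \<le> card ?P' + card ?T" by (rule card_Un_le)
        finally have "card (insert ?c ?P) - 1 \<le> card ?P' + card ?T"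
          using diff_card_le_card_Diff[of "{fst b}" "insert ?c ?P"] by simp
        then have "card ?P \<le> card ?P' + card ?T" unfolding card_insert_disjoint[OF fin(1) cnew] by simp
        then show ?thesis unfolding T by (auto simp: of_bool_def)
      qed
    qed
  qed
qed

end

text \<open>Double counting: a loose item can be lost only by its own departure or by the departure
  of an item whose gap is cut by the end of its window, and there is at most one such gap.\<close>

lemma loose_depart_sum:
  assumes S: "valid S"
  shows "(\<Sum>b\<in>S. real (card (loose m x L S)) - real (card (loose m x L (S - {b}))))
    \<le> 2 * real (card (loose m x L S))"
proof -
  let ?l = "loose m x L S"
  define K where "K a b \<longleftrightarrow> a = b \<or> (pred_anchor S b < right_end a + width m \<and> right_end a + width m \<le> fst b)"
    for a b
  have fin: "finite S" "finite ?l" using validD(1)[OF S] finite_loose[OF S] by auto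
  have one: "real (card ?l) - real (card (loose m x L (S - {b}))) \<le> (\<Sum>a\<in>?l. of_bool (K a b))"
    if b: "b \<in> S" for b
  proof -
    have fin': "finite (loose m x L (S - {b}))" using finite_loose[OF valid_diff[OF S]] .
    have "?l \<subseteq> loose m x L (S - {b}) \<union> (?l \<inter> {a. K a b})"
      using loose_depart_kept[OF S b] unfolding K_def by blast
    then have "card ?l \<le> card (loose m x L (S - {b}) \<union> (?l \<inter> {a. K a b}))"
      using fin fin' by (intro card_mono) auto
    also have "\<dots> \<le> card (loose m x L (S - {b})) + card (?l \<inter> {a. K a b})" by (rule card_Un_le)
    finally show ?thesis using fin by (simp add: sum_of_bool_eq)
  qed
  have two: "(\<Sum>b\<in>S. of_bool (K a b)) \<le> (2::real)" for a
  proof -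
    let ?B = "{b \<in> S. pred_anchor S b < right_end a + width m \<and> right_end a + width m \<le> fst b}"
    have "card ?B \<le> Suc 0"
      using fin pred_anchor_cross[OF S] by (subst card_le_Suc0_iff_eq) auto
    moreover have "card (S \<inter> {b. K a b}) \<le> card (insert a ?B)"
      using fin by (intro card_mono) (auto simp: K_def)
    moreover have "card (insert a ?B) \<le> Suc (card ?B)"
      using card_Un_le[of "{a}" ?B] by simp
    ultimately show ?thesis using fin by (simp add: sum_of_bool_eq)
  qed
  have "(\<Sum>b\<in>S. real (card ?l) - real (card (loose m x L (S - {b}))))
      \<le> (\<Sum>b\<in>S. \<Sum>a\<in>?l. of_bool (K a b))" by (intro sum_mono one)
  also have "\<dots> = (\<Sum>a\<in>?l. \<Sum>b\<in>S. of_bool (K a b))" by (rule sum.swap)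
  also have "\<dots> \<le> (\<Sum>a\<in>?l. 2)" by (intro sum_mono two)
  finally show ?thesis by simp
qed

definition small_inside :: "real \<Rightarrow> real \<Rightarrow> config \<Rightarrow> config" where
  "small_inside x L S = {b \<in> S. x \<le> fst b \<and> fst b < L \<and> snd b < i}"

text \<open>Since \<open>right_end\<close> and \<open>pred_anchor S\<close> are injective, either
  slot term sums to at most the number of slots. At most one gap is cut by \<open>x\<close>, and at
  most \<open>\<alpha> i / \<alpha> 1 + 1\<close> items start within distance
  \<open>\<alpha> i\<close> of \<open>L\<close>.\<close>

lemma points_depart_sum:
  assumes S: "valid S"
  shows "(\<Sum>b\<in>S. real (card (points L S \<inter> {x..<L})) - real (card (points L (S - {b}) \<inter> {x..<L})))
    \<le> 2 * real (card (slots L S)) + real (card (small_inside x L S)) + 2 + \<alpha> i / \<alpha> 1"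
proof -
  have fin: "finite S" using validD(1)[OF S] .
  have "card (S \<inter> {b. right_end b \<in> slots L S}) \<le> card (slots L S)"
    using finite_slots[OF S] right_end_inj[OF S]
    by (intro card_inj_on_le[of right_end]) (auto intro!: inj_onI)
  moreover have "card (S \<inter> {b. pred_anchor S b \<in> slots L S}) \<le> card (slots L S)"
    using finite_slots[OF S] pred_anchor_inj[OF S]
    by (intro card_inj_on_le[of "pred_anchor S"]) (auto intro!: inj_onI)
  moreover have "S \<inter> {b. x \<le> fst b \<and> fst b < L \<and> snd b < i} = small_inside x L S"
    by (auto simp: small_inside_def)
  moreover have "card (S \<inter> {b. pred_anchor S b < x \<and> x \<le> fst b}) \<le> Suc 0"
    using fin pred_anchor_cross[OF S] by (subst card_le_Suc0_iff_eq) auto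
  moreover have "real (card (S \<inter> {b. L < pred_anchor S b + \<alpha> i \<and> fst b < L})) \<le> \<alpha> i / \<alpha> 1 + 1"
  proof -
    have "S \<inter> {b. L < pred_anchor S b + \<alpha> i \<and> fst b < L}
        \<subseteq> {a \<in> S. L - \<alpha> i \<le> fst a \<and> fst a \<le> L - \<alpha> i + \<alpha> i}"
      using pred_anchor(2)[OF S] by fastforce
    then have "card (S \<inter> {b. L < pred_anchor S b + \<alpha> i \<and> fst b < L})
        \<le> card {a \<in> S. L - \<alpha> i \<le> fst a \<and> fst a \<le> L - \<alpha> i + \<alpha> i}"
      using fin by (intro card_mono) auto
    then show ?thesis
      using card_starts_le[OF S less_imp_le[OF size_i_pos], of "L - \<alpha> i"] by linarith
  qed
  moreover have "(\<Sum>b\<in>S. real (card (points L S \<inter> {x..<L})) - real (card (points L (S - {b}) \<inter> {x..<L})))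
    \<le> (\<Sum>b\<in>S. of_bool (right_end b \<in> slots L S) + of_bool (x \<le> fst b \<and> fst b < L \<and> snd b < i)
      + of_bool (pred_anchor S b < x \<and> x \<le> fst b)
      + of_bool (L < pred_anchor S b + \<alpha> i \<and> fst b < L)
      + of_bool (pred_anchor S b \<in> slots L S))"
    by (intro sum_mono points_depart_lost[OF S])
  ultimately show ?thesis using fin by (simp add: sum.distrib)
qed

lemma potential_depart_sum:
  assumes S: "valid S"
  shows "(\<Sum>b\<in>S. potential m x L S - potential m x L (S - {b}))
    \<le> 2 * real (card (loose m x L S)) + (window_bound m + 1) *
       (2 * real (card (slots L S)) + real (card (small_inside x L S)) + 2 + \<alpha> i / \<alpha> 1)"
proof -
  have "(\<Sum>b\<in>S. potential m x L S - potential m x L (S - {b}))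
    = (\<Sum>b\<in>S. real (card (loose m x L S)) - real (card (loose m x L (S - {b}))))
      + (window_bound m + 1) * (\<Sum>b\<in>S. real (card (points L S \<inter> {x..<L}))
          - real (card (points L (S - {b}) \<inter> {x..<L})))"
    unfolding potential_def sum_distrib_left sum.distrib[symmetric]
    by (intro sum.cong) (auto simp: algebra_simps)
  then show ?thesis
    using loose_depart_sum[OF S, of m x L] points_depart_sum[OF S, of L x] window_bound_ge[of m]
    by (simp add: add_mono mult_left_mono)
qed

text \<open>The number of items present is unbounded. Sums over departures stay under control
  because items that start beyond \<open>L\<close> do not affect the functionals.\<close>

lemma depart_local:
  assumes S: "valid S" and b: "b \<in> S" "L \<le> fst b"
  shows "slots L (S - {b}) = slots L S"
    and "points L (S - {b}) \<inter> {..<L} = points L S \<inter> {..<L}"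
    and "loose m x L (S - {b}) = loose m x L S"
    and "potential m x L (S - {b}) = potential m x L S"
proof -
  have b': "L < right_end b" using b validD(5)[OF S b(1)] by auto
  show sl: "slots L (S - {b}) = slots L S"
  proof
    show "slots L S \<subseteq> slots L (S - {b})"
      using slots_depart_lower[OF S b(1), of L] b' size_i_pos by (auto simp: slots_def)
    show "slots L (S - {b}) \<subseteq> slots L S"
      using b by (fastforce simp: slots_def vacant_def anchors_def)
  qed
  show pt: "points L (S - {b}) \<inter> {..<L} = points L S \<inter> {..<L}"
    using sl b by (auto simp: points_def)
  have win: "points L (S - {b}) \<inter> {u..<v} = points L S \<inter> {u..<v}" if "v \<le> L" for u v
  proof -
    have "{u..<v} = {..<L} \<inter> {u..<v}" using that by auto
    then show ?thesis using pt by (metis Int_assoc)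
  qed
  show lo: "loose m x L (S - {b}) = loose m x L S"
    using b' width_pos[of m] by (auto simp: loose_def win)
  show "potential m x L (S - {b}) = potential m x L S"
    by (simp add: potential_def lo win)
qed

text \<open>The states in which the next \<open>i\<close>-arrival is certain to raise
  \<open>potential m x L\<close> by at least one.\<close>

definition refill :: "nat \<Rightarrow> real \<Rightarrow> real \<Rightarrow> config \<Rightarrow> bool" where
  "refill m x L S \<longleftrightarrow> slots L S \<noteq> {} \<and>
     (let s = Min (slots L S); S' = insert (s, i) S in
        (s, i) \<in> loose m x L S' \<or> (x \<le> s + \<alpha> i \<and> s + \<alpha> i \<in> slots L S'))"

lemma Min_slots:
  assumes "valid S" "slots L S \<noteq> {}"
  shows "Min (slots L S) \<in> anchors S" "vacant S (Min (slots L S)) (Min (slots L S) + \<alpha> i)"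
    "Min (slots L S) + \<alpha> i \<le> L"
  using Min_in[OF finite_slots[OF assms(1)] assms(2)] by (auto simp: slots_def)

lemma refill_local:
  assumes S: "valid S" and b: "b \<in> S" "L \<le> fst b"
  shows "refill m x L (S - {b}) \<longleftrightarrow> refill m x L S"
proof (cases "slots L S = {}")
  case True
  then show ?thesis using depart_local(1)[OF assms] by (simp add: refill_def)
next
  case False
  let ?s = "Min (slots L S)"
  note s = Min_slots[OF S False]
  have v: "valid (insert (?s, i) S)" by (rule valid_place(1)[OF S type_i s(1,2)])
  have neq: "b \<noteq> (?s, i)" using valid_place(2)[OF S type_i s(1,2)] b by auto
  have ins: "insert (?s, i) (S - {b}) = insert (?s, i) S - {b}" using neq by auto
  have bin: "b \<in> insert (?s, i) S" using b by simp
  show ?thesis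
    unfolding refill_def Let_def depart_local(1)[OF assms] ins depart_local[OF v bin b(2)] ..
qed

lemma refill_gain:
  assumes S: "valid S" and "refill m x L S"
  shows "potential m x L S + 1 \<le> potential m x L (arrive \<alpha> S i)"
proof -
  have ne: "slots L S \<noteq> {}" using assms(2) by (simp add: refill_def)
  note s = Min_slots[OF S ne]
  show ?thesis
    unfolding arrive_def first_fit_slot[OF S ne]
    by (rule potential_place(2)[OF S type_i s(1,2)])
      (use assms(2) in \<open>simp add: refill_def Let_def\<close>)
qed

text \<open>A window of length \<open>\<alpha> i\<close> behind an item that contains no start of an
  item is free, so the end of that item is a slot and lies in the window as a point.\<close>

lemma loose_0_empty:
  assumes S: "valid S"
  shows "loose 0 x L S = {}"
proof (rule ccontr)
  assume "loose 0 x L S \<noteq> {}"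
  then obtain a where a: "a \<in> S" "right_end a + \<alpha> i \<le> L"
    "points L S \<inter> {right_end a..<right_end a + \<alpha> i} = {}"
    using finite_points[OF S] by (auto simp: loose_def width_def)
  have "right_end b \<le> right_end a \<or> right_end a + \<alpha> i \<le> fst b" if b: "b \<in> S" for b
  proof (cases "a = b")
    case False
    have "fst b \<notin> {right_end a..<right_end a + \<alpha> i}" using a(3) b by (auto simp: points_def)
    then show ?thesis
      using validD(4)[OF S a(1) b False] validD(5)[OF S a(1)] by auto
  qed simp
  then have "right_end a \<in> slots L S" using a by (auto simp: slots_def vacant_def anchors_def)
  then show False using a(3) size_i_pos by (auto simp: points_def)
qed

text \<open>With no slot present, a loose item has a successor \<open>b\<close> whose departure
  opens exactly one slot, at the end of the loose item. Unless \<open>b\<close> is small, the state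
  left behind is a refill state. The successor determines the loose item, because
  \<open>pred_anchor S b\<close> is the end of the latter.\<close>

lemma loose_Suc_refill:
  assumes S: "valid S" and full: "slots L S = {}"
  shows "card (loose (Suc m) x L S)
    \<le> card {b \<in> S. fst b < L \<and> refill m x L (S - {b})} + card (small_inside x L S)"
proof -
  let ?B = "{b \<in> S. fst b < L \<and> refill m x L (S - {b})} \<union> small_inside x L S"
  have fin: "finite S" using validD(1)[OF S] .
  have ex: "\<exists>b\<in>?B. pred_anchor S b = right_end a" if a: "a \<in> loose (Suc m) x L S" for a
  proof -
    let ?e = "right_end a"
    have aS: "a \<in> S" "x \<le> ?e" "?e + width (Suc m) \<le> L"
      "card (points L S \<inter> {?e..<?e + width (Suc m)}) \<le> Suc m"
      using a by (auto simp: loose_def)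
    have eL: "?e + \<alpha> i + width m \<le> L" using aS(3) by (simp add: width_Suc)
    have "?e \<notin> slots L S" using full by simp
    then have "\<not> vacant S ?e (?e + \<alpha> i)"
      using aS(1) eL width_pos[of m] unfolding slots_def anchors_def by force
    then obtain b0 where b0: "b0 \<in> S" "\<not> right_end b0 \<le> ?e" "fst b0 < ?e + \<alpha> i"
      by (auto simp: vacant_def not_le)
    have "?e \<le> fst b0"
      using right_end_less_sep[OF S aS(1) b0(1)] b0(2) by simp
    let ?R = "{b \<in> S. ?e \<le> fst b}"
    have R: "finite ?R" "?R \<noteq> {}" using fin b0(1) \<open>?e \<le> fst b0\<close> by (simp, blast)
    obtain b where b: "b \<in> ?R" "\<And>b'. b' \<in> ?R \<Longrightarrow> fst b \<le> fst b'"
      using arg_min_if_finite(1)[OF R, of fst] arg_min_least[OF R, of _ fst] that by blast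
    have bS: "b \<in> S" "?e \<le> fst b" "fst b < ?e + \<alpha> i"
      using b(1) b(2)[of b0] b0 \<open>?e \<le> fst b0\<close> by auto
    have ab: "a \<noteq> b" using bS(2) validD(5)[OF S aS(1)] by auto
    have c: "pred_anchor S b = ?e"
    proof (rule antisym)
      show "?e \<le> pred_anchor S b"
        using aS(1) ab bS(2) by (intro pred_anchor(4)[OF S bS(1)]) (auto simp: anchors_def)
      show "pred_anchor S b \<le> ?e"
      proof (rule ccontr)
        assume "\<not> pred_anchor S b \<le> ?e"
        moreover have "0 \<le> ?e" using validD(2,5)[OF S aS(1)] by auto
        ultimately obtain a' where a': "a' \<in> S" "a' \<noteq> b" "pred_anchor S b = right_end a'"
          "?e < right_end a'"
          using pred_anchor(1)[OF S bS(1)] by (auto simp: anchors_def)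
        then have "?e \<le> fst a'" using right_end_less_sep[OF S aS(1) a'(1)] by simp
        then have "fst b \<le> fst a'" using b(2)[of a'] a'(1) by simp
        then show False
          using pred_anchor(2)[OF S bS(1)] a' validD(5)[OF S a'(1)] by auto
      qed
    qed
    have inL: "fst b < L" "x \<le> fst b" using bS aS eL width_pos[of m] by auto
    show ?thesis
    proof (cases "snd b < i")
      case True
      then show ?thesis using bS inL c by (auto simp: small_inside_def)
    next
      case False
      let ?S' = "S - {b}" and ?S'' = "insert (?e, i) (S - {b})"
      have v': "valid ?S'" using S by (rule valid_diff)
      have "?e \<in> slots L ?S'"
        using slot_opened[OF S bS(1), of L] False c eL width_pos[of m] by auto
      then have sl: "slots L ?S' = {?e}"
        using slots_depart_upper[OF S bS(1), of L] full c by auto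
      have e: "?e \<in> anchors ?S'" "vacant ?S' ?e (?e + \<alpha> i)" using sl by (auto simp: slots_def)
      have "refill m x L ?S'"
      proof (cases "?e + \<alpha> i \<in> slots L ?S''")
        case True
        then show ?thesis using sl aS(2) size_i_pos by (simp add: refill_def)
      next
        case no: False
        let ?w = "{?e + \<alpha> i..<?e + \<alpha> i + width m}"
        let ?W = "{?e..<?e + width (Suc m)}"
        have "slots L ?S'' = {}"
          using slots_place_upper[OF v' type_i e, of L] sl no by auto
        \<comment> \<open>The window of the new item is the old window without its first
          \<open>\<alpha> i\<close>. The start of \<open>b\<close>, which was counted there, is
          gone, and the start of the new item lies in front of the window, so the count drops from
          at most \<open>Suc m\<close> to at most \<open>m\<close>.\<close>
        then have "points L ?S'' \<inter> ?w \<subseteq> points L S \<inter> ?W - {fst b}"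
          using fst_inj[OF S _ bS(1)] size_i_pos by (auto simp: points_def width_Suc)
        then have "card (points L ?S'' \<inter> ?w) \<le> card (points L S \<inter> ?W - {fst b})"
          using finite_points[OF S] by (intro card_mono) auto
        also have "\<dots> = card (points L S \<inter> ?W) - 1"
          using bS width_pos[of m] by (intro card_Diff_singleton) (auto simp: points_def width_Suc)
        also have "\<dots> \<le> m" using aS(4) by simp
        finally have "(?e, i) \<in> loose m x L ?S''"
          using aS(2) eL size_i_pos by (auto simp: loose_def right_end_def[of "(?e, i)"])
        then show ?thesis using sl by (simp add: refill_def)
      qed
      then show ?thesis using bS inL c by auto
    qed
  qed
  define f where "f a = (SOME b. b \<in> ?B \<and> pred_anchor S b = right_end a)" for a
  have f: "f a \<in> ?B \<and> pred_anchor S (f a) = right_end a" if "a \<in> loose (Suc m) x L S" for a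
    unfolding f_def by (rule someI_ex) (use ex[OF that] in blast)
  have finB: "finite ?B" using fin by (auto simp: small_inside_def)
  have "inj_on f (loose (Suc m) x L S)"
  proof (rule inj_onI)
    fix a a' assume a: "a \<in> loose (Suc m) x L S" "a' \<in> loose (Suc m) x L S" "f a = f a'"
    then have "right_end a = right_end a'" using f[of a] f[of a'] by simp
    then show "a = a'" using right_end_inj[OF S] a by (auto simp: loose_def)
  qed
  then have "card (loose (Suc m) x L S) \<le> card ?B"
    by (rule card_inj_on_le[OF _ image_subsetI finB]) (use f in blast)
  also have "\<dots> \<le> card {b \<in> S. fst b < L \<and> refill m x L (S - {b})} + card (small_inside x L S)"
    by (rule card_Un_le)
  finally show ?thesis .
qed

lemma card_loose_le:
  assumes "valid S" "0 \<le> L"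
  shows "real (card (loose m x L S)) \<le> L / \<alpha> 1 + 1"
proof -
  have "loose m x L S \<subseteq> {b \<in> S. fst b < L}"
    using validD(5)[OF assms(1)] width_pos[of m] by (fastforce simp: loose_def)
  then have "card (loose m x L S) \<le> card {b \<in> S. fst b < L}"
    using validD(1)[OF assms(1)] by (intro card_mono) auto
  then show ?thesis using card_inside_le[OF assms] by linarith
qed

end

section \<open>Length of the available space\<close>

lemma fmeasurable_bounded:
  fixes B :: "real set"
  assumes "B \<in> sets borel" "B \<subseteq> {a..b}"
  shows "B \<in> fmeasurable lborel"
  using fmeasurable_cbox[of a b] assms by (auto intro: fmeasurableI2)

lemma card_disjoint_intervals_le:
  fixes f :: "'a::linorder \<Rightarrow> real"
  assumes J: "finite J" and A: "A \<in> fmeasurable lborel" and l: "0 \<le> l"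
    and sub: "\<And>j. j \<in> J \<Longrightarrow> {f j<..<f j + l} \<subseteq> A"
    and sep: "\<And>j k. j \<in> J \<Longrightarrow> k \<in> J \<Longrightarrow> j < k \<Longrightarrow> f j + l \<le> f k"
  shows "real (card J) * l \<le> measure lborel A"
proof -
  let ?F = "\<lambda>j. {f j<..<f j + l}"
  have disj: "pairwise (\<lambda>j k. disjnt (?F j) (?F k)) J"
  proof (rule pairwiseI)
    fix j k assume jk: "j \<in> J" "k \<in> J" "j \<noteq> k"
    then consider "j < k" | "k < j" by fastforce
    then show "disjnt (?F j) (?F k)"
      using sep[OF jk(1,2)] sep[OF jk(2,1)] by cases (auto simp: disjnt_def)
  qed
  have fm: "?F j \<in> fmeasurable lborel" for j
    using fmeasurable_box[of "f j" "f j + l"] by simp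
  have "real (card J) * l = (\<Sum>j\<in>J. measure lborel (?F j))" using l by simp
  also have "\<dots> = measure lborel (\<Union>j\<in>J. ?F j)" by (rule measure_UNION'[symmetric, OF J fm disj])
  also have "\<dots> \<le> measure lborel A"
    using sub J A fm by (intro measure_mono_fmeasurable) (auto simp: fmeasurable_def)
  finally show ?thesis .
qed

text \<open>The sum is the integral of the number of sets \<open>B j\<close> that contain a given
  point.\<close>

lemma sum_measure_overlap_le:
  fixes A :: "real set"
  assumes J: "finite J" and A: "A \<in> fmeasurable lborel" and B: "\<And>j. j \<in> J \<Longrightarrow> B j \<in> sets borel"
    and sub: "\<And>j. j \<in> J \<Longrightarrow> B j \<subseteq> A"
    and overlap: "\<And>z. z \<in> A \<Longrightarrow> real (card {j \<in> J. z \<in> B j}) \<le> C"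
  shows "(\<Sum>j\<in>J. measure lborel (B j)) \<le> C * measure lborel A"
proof -
  have fm: "B j \<in> fmeasurable lborel" if "j \<in> J" for j
    using fmeasurableI2[OF A sub[OF that]] B[OF that] by simp
  have "(\<Sum>j\<in>J. measure lborel (B j)) = (\<Sum>j\<in>J. \<integral>z. indicator (B j) z \<partial>lborel)"
    by (intro sum.cong) auto
  also have "\<dots> = (\<integral>z. (\<Sum>j\<in>J. indicator (B j) z) \<partial>lborel)"
    using fm by (intro Bochner_Integration.integral_sum[symmetric]) (simp add: fmeasurable_def)
  also have "\<dots> \<le> (\<integral>z. C * indicator A z \<partial>lborel)"
  proof (rule integral_mono)
    show "integrable lborel (\<lambda>z. \<Sum>j\<in>J. indicator (B j) z :: real)"
      using fm by (intro Bochner_Integration.integrable_sum) (simp add: fmeasurable_def)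
    show "integrable lborel (\<lambda>z. C * indicator A z)"
      using A by (intro integrable_mult_right) (simp add: fmeasurable_def)
    fix z :: real
    have "(\<Sum>j\<in>J. indicator (B j) z :: real) = real (card {j \<in> J. z \<in> B j})"
      using J by (simp add: indicator_def sum.If_cases Int_def)
    moreover have "{j \<in> J. z \<in> B j} = {}" if "z \<notin> A" using sub that by auto
    ultimately show "(\<Sum>j\<in>J. indicator (B j) z) \<le> C * indicator A z"
      using overlap[of z] by (cases "z \<in> A") auto
  qed
  also have "\<dots> = C * measure lborel A" by simp
  finally show ?thesis .
qed

context first_fit_type
begin

text \<open>Open intervals make this union an open set, hence measurable.\<close>

definition avail :: "real \<Rightarrow> config \<Rightarrow> real set" where
  "avail L S = (\<Union>z\<in>{z. 0 \<le> z \<and> z + \<alpha> i \<le> L \<and> vacant S z (z + \<alpha> i)}. {z<..<z + \<alpha> i})"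

definition avail_length :: "real \<Rightarrow> config \<Rightarrow> real" where
  "avail_length L S = measure lborel (avail L S)"

definition free :: "real \<Rightarrow> config \<Rightarrow> real set" where
  "free L S = {0..L} - (\<Union>a\<in>S. {fst a..<right_end a})"

definition overlap :: "real \<Rightarrow> real \<times> nat \<Rightarrow> real" where
  "overlap L a = measure lborel ({fst a..<right_end a} \<inter> {0..L})"

definition free_near :: "real \<Rightarrow> config \<Rightarrow> real \<times> nat \<Rightarrow> real" where
  "free_near L S a = measure lborel (free L S \<inter> {fst a - \<alpha> i<..<right_end a + \<alpha> i})"

definition opened :: "real \<Rightarrow> config \<Rightarrow> real \<times> nat \<Rightarrow> real" where
  "opened L S b = avail_length L (S - {b}) - avail_length L S"

lemma avail_subset: "avail L S \<subseteq> {0..L}"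
  by (auto simp: avail_def)

lemma avail_sets: "avail L S \<in> sets borel"
  by (intro borel_open) (auto simp: avail_def)

lemma avail_fmeasurable: "avail L S \<in> fmeasurable lborel"
  by (rule fmeasurable_bounded[OF avail_sets avail_subset])

lemma avail_length_nonneg: "0 \<le> avail_length L S"
  by (simp add: avail_length_def)

lemma avail_length_le:
  assumes "0 \<le> L"
  shows "avail_length L S \<le> L"
proof -
  have "avail_length L S \<le> measure lborel {0..L}"
    unfolding avail_length_def using avail_subset avail_sets fmeasurable_cbox[of 0 L]
    by (intro measure_mono_fmeasurable) auto
  then show ?thesis using assms by simp
qed

lemma avail_length_mono:
  assumes "avail L S \<subseteq> avail L S'"
  shows "avail_length L S \<le> avail_length L S'"
  unfolding avail_length_def using assms avail_sets avail_fmeasurable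
  by (intro measure_mono_fmeasurable) auto

lemma card_slots_avail_length:
  assumes S: "valid S"
  shows "real (card (slots L S)) * \<alpha> i \<le> avail_length L S"
  unfolding avail_length_def
proof (rule card_disjoint_intervals_le[where f = "\<lambda>e. e"])
  show "{e<..<e + \<alpha> i} \<subseteq> avail L S" if "e \<in> slots L S" for e
    using that slots_nonneg[OF S that] by (auto simp: avail_def slots_def)
  show "e + \<alpha> i \<le> e'" if "e \<in> slots L S" "e' \<in> slots L S" "e < e'" for e e'
    using that anchor_after_vacant[OF S _ slots_nonneg[OF S that(1)] that(3) _ size_i_pos]
    by (auto simp: slots_def intro: less_imp_le)
qed (use finite_slots[OF S] avail_fmeasurable size_i_pos in auto)

lemma slots_empty_iff:
  assumes S: "valid S"
  shows "slots L S = {} \<longleftrightarrow> avail L S = {}"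
proof
  assume e: "slots L S = {}"
  show "avail L S = {}"
  proof (rule ccontr)
    assume "avail L S \<noteq> {}"
    then obtain z where z: "0 \<le> z" "z + \<alpha> i \<le> L" "vacant S z (z + \<alpha> i)" by (auto simp: avail_def)
    then obtain e where "e \<in> anchors S" "e \<le> z" "vacant S e (z + \<alpha> i)"
      using anchor_below[OF S z(1,3) size_i_pos] by metis
    then have "e \<in> slots L S" using z vacant_subset[of S e "z + \<alpha> i" e "e + \<alpha> i"] by (auto simp: slots_def)
    then show False using e by simp
  qed
next
  assume a: "avail L S = {}"
  show "slots L S = {}"
  proof (rule ccontr)
    assume "slots L S \<noteq> {}"
    then obtain e where e: "e \<in> slots L S" by blast
    then have "e + \<alpha> i / 2 \<in> avail L S"
      using slots_nonneg[OF S e] size_i_pos by (auto simp: avail_def slots_def intro!: bexI[of _ e])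
    then show False using a by simp
  qed
qed

lemma avail_length_full: "valid S \<Longrightarrow> slots L S = {} \<Longrightarrow> avail_length L S = 0"
  using slots_empty_iff by (simp add: avail_length_def)

lemma avail_length_insert: "avail_length L (insert a S) \<le> avail_length L S"
  by (rule avail_length_mono) (auto simp: avail_def vacant_insert)

text \<open>The left-most slot is a part of the available space of length \<open>\<alpha> i\<close>,
  and no available interval meets it once it is occupied.\<close>

lemma avail_length_fill:
  assumes S: "valid S" and ne: "slots L S \<noteq> {}"
  shows "avail_length L (arrive \<alpha> S i) \<le> avail_length L S - \<alpha> i"
proof -
  let ?s = "Min (slots L S)"
  note s = Min_slots[OF S ne]
  have "?s \<in> slots L S" using finite_slots[OF S] ne by (rule Min_in)
  then have s0: "0 \<le> ?s" by (rule slots_nonneg[OF S])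
  let ?S' = "insert (?s, i) S"
  let ?J = "{?s<..<?s + \<alpha> i}"
  have "avail L ?S' \<inter> ?J = {}"
    using size_i_pos by (auto simp: avail_def vacant_insert right_end_def)
  then have "measure lborel (avail L ?S' \<union> ?J) = avail_length L ?S' + measure lborel ?J"
    unfolding avail_length_def using avail_fmeasurable[of L ?S'] fmeasurable_box[of ?s "?s + \<alpha> i"]
    by (simp add: measure_Un3)
  moreover have "measure lborel (avail L ?S' \<union> ?J) \<le> avail_length L S"
    unfolding avail_length_def
  proof (rule measure_mono_fmeasurable)
    show "avail L ?S' \<union> ?J \<subseteq> avail L S"
      using s s0 by (auto simp: avail_def vacant_insert)
  qed (use avail_sets avail_fmeasurable in auto)
  moreover have "arrive \<alpha> S i = ?S'" unfolding arrive_def first_fit_slot[OF S ne] ..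
  ultimately show ?thesis using size_i_pos by simp
qed

lemma avail_length_arrive: "avail_length L (arrive \<alpha> S k) \<le> avail_length L S"
  unfolding arrive_def by (rule avail_length_insert)

lemma opened_nonneg: "0 \<le> opened L S b"
  unfolding opened_def using vacant_diff[of S _ _ "{b}"]
  by (simp, intro avail_length_mono) (auto simp: avail_def)

lemma free_sets: "finite S \<Longrightarrow> free L S \<in> sets borel"
  unfolding free_def by (intro sets.Diff sets.finite_UN) auto

lemma free_fmeasurable: "finite S \<Longrightarrow> free L S \<in> fmeasurable lborel"
  by (rule fmeasurable_bounded[OF free_sets]) (auto simp: free_def)

lemma item_part_fmeasurable: "{fst a..<right_end a} \<inter> {0..L} \<in> fmeasurable lborel"
  by (rule fmeasurable_bounded[where a = 0 and b = L]) auto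

lemma near_fmeasurable:
  "finite S \<Longrightarrow> free L S \<inter> {fst a - \<alpha> i<..<right_end a + \<alpha> i} \<in> fmeasurable lborel"
  by (rule fmeasurable_bounded[where a = 0 and b = L]) (auto simp: free_sets, auto simp: free_def)

lemma overlap_nonneg: "0 \<le> overlap L a"
  and free_near_nonneg: "0 \<le> free_near L S a"
  by (simp_all add: overlap_def free_near_def)

section \<open>Space opened by a single departure\<close>

context
  fixes S :: config and b :: "real \<times> nat" and L :: real
  assumes S: "valid S" and b: "b \<in> S"
begin

private lemma fin: "finite S"
  using validD(1)[OF S] .

private lemma b_ends: "fst b < right_end b" "0 \<le> fst b"
  using validD(2,5)[OF S b] by auto

text \<open>A newly free interval of length \<open>\<alpha> i\<close> must meet the room of
  \<open>b\<close>. So its points lie in that room or in free space at distance less than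
  \<open>\<alpha> i\<close> from it.\<close>

lemma avail_depart:
  "avail L (S - {b}) \<subseteq> avail L S \<union>
     ({fst b..<right_end b} \<inter> {0..L} \<union> free L S \<inter> {fst b - \<alpha> i<..<right_end b + \<alpha> i})"
proof
  fix t assume "t \<in> avail L (S - {b})"
  then obtain z where z: "0 \<le> z" "z + \<alpha> i \<le> L" "vacant (S - {b}) z (z + \<alpha> i)" "z < t" "t < z + \<alpha> i"
    by (auto simp: avail_def)
  show "t \<in> avail L S \<union>
     ({fst b..<right_end b} \<inter> {0..L} \<union> free L S \<inter> {fst b - \<alpha> i<..<right_end b + \<alpha> i})"
  proof (cases "right_end b \<le> z \<or> z + \<alpha> i \<le> fst b")
    case True
    then have "vacant S z (z + \<alpha> i)" using z(3) by (auto simp: vacant_def)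
    then show ?thesis using z by (auto simp: avail_def)
  next
    case False
    show ?thesis
    proof (cases "t \<in> {fst b..<right_end b}")
      case True
      then show ?thesis using z by auto
    next
      case out: False
      have "t \<notin> {fst a..<right_end a}" if "a \<in> S" for a
      proof (cases "a = b")
        case False
        then have "right_end a \<le> z \<or> z + \<alpha> i \<le> fst a" using z(3) that by (auto simp: vacant_def)
        then show ?thesis using z by auto
      qed (use out in simp)
      then have "t \<in> free L S" using z by (auto simp: free_def)
      then show ?thesis using False z by auto
    qed
  qed
qed

lemma opened_le: "opened L S b \<le> overlap L b + free_near L S b"
proof -
  let ?A = "{fst b..<right_end b} \<inter> {0..L}"
  let ?B = "free L S \<inter> {fst b - \<alpha> i<..<right_end b + \<alpha> i}"
  have fm: "?A \<in> fmeasurable lborel" "?B \<in> fmeasurable lborel"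
    using item_part_fmeasurable near_fmeasurable[OF fin] by auto
  have "avail_length L (S - {b}) \<le> measure lborel (avail L S \<union> (?A \<union> ?B))"
    unfolding avail_length_def using avail_depart avail_sets avail_fmeasurable fm
    by (intro measure_mono_fmeasurable) auto
  also have "\<dots> \<le> measure lborel (avail L S) + measure lborel (?A \<union> ?B)"
    using avail_fmeasurable[of L S] fm by (intro measure_Un_le) auto
  also have "measure lborel (?A \<union> ?B) \<le> measure lborel ?A + measure lborel ?B"
    using fm by (intro measure_Un_le) auto
  finally show ?thesis
    by (simp add: opened_def avail_length_def overlap_def free_near_def)
qed

lemma opened_local:
  assumes "L \<le> fst b"
  shows "opened L S b = 0"
proof -
  have "avail L (S - {b}) \<subseteq> avail L S"
    using assms by (fastforce simp: avail_def vacant_def)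
  then have "avail_length L (S - {b}) \<le> avail_length L S" by (rule avail_length_mono)
  then show ?thesis using opened_nonneg[of L S b] by (simp add: opened_def)
qed

lemma overlap_le: "overlap L b \<le> \<alpha> (snd b)" "0 \<le> L \<Longrightarrow> overlap L b \<le> L"
proof -
  have "overlap L b \<le> measure lborel {fst b..right_end b}"
    unfolding overlap_def using fmeasurable_cbox[of "fst b" "right_end b"]
    by (intro measure_mono_fmeasurable) auto
  then show "overlap L b \<le> \<alpha> (snd b)" using b_ends by (simp add: right_end_def)
  assume "0 \<le> L"
  moreover have "overlap L b \<le> measure lborel {0..L}"
    unfolding overlap_def using fmeasurable_cbox[of 0 L]
    by (intro measure_mono_fmeasurable) auto
  ultimately show "overlap L b \<le> L" by simp
qed

lemma overlap_inside:
  assumes "right_end b \<le> L"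
  shows "overlap L b = \<alpha> (snd b)"
proof -
  have "{fst b..<right_end b} \<inter> {0..L} = {fst b..<right_end b}" using b_ends assms by auto
  then show ?thesis using b_ends by (simp add: overlap_def right_end_def)
qed

lemma free_near_le: "free_near L S b \<le> 2 * \<alpha> i"
proof -
  let ?A = "{fst b - \<alpha> i..fst b}" and ?B = "{right_end b..right_end b + \<alpha> i}"
  have fm: "?A \<in> fmeasurable lborel" "?B \<in> fmeasurable lborel"
    using fmeasurable_cbox[of "fst b - \<alpha> i" "fst b"] fmeasurable_cbox[of "right_end b" "right_end b + \<alpha> i"]
    by auto
  have "free L S \<inter> {fst b - \<alpha> i<..<right_end b + \<alpha> i} \<subseteq> ?A \<union> ?B"
    using b by (auto simp: free_def)
  then have "free_near L S b \<le> measure lborel (?A \<union> ?B)"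
    unfolding free_near_def using near_fmeasurable[OF fin, of L b] fm
    by (intro measure_mono_fmeasurable) auto
  also have "\<dots> \<le> measure lborel ?A + measure lborel ?B" using fm by (intro measure_Un_le) auto
  finally show ?thesis using size_i_pos by simp
qed

text \<open>A small item is shorter than a slot, so a slot opened by its departure contains free space of
  length at least \<open>\<alpha> i - \<alpha> (i - 1)\<close> around it.\<close>

lemma opened_small:
  assumes small: "snd b < i"
  shows "opened L S b \<le> (1 + \<alpha> i / (\<alpha> i - \<alpha> (i - 1))) * free_near L S b"
proof -
  let ?d = "\<alpha> i - \<alpha> (i - 1)"
  have i1: "i - 1 \<in> I"
    by (rule type_down[OF type_i]) (use small type_ge_1[OF validD(3)[OF S b]] in auto)
  then have d: "0 < ?d" using small type_i size_less[of "i - 1" i] by auto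
  have sb: "\<alpha> (snd b) \<le> \<alpha> (i - 1)" using small validD(3)[OF S b] i1 by (intro size_le) auto
  show ?thesis
  proof (cases "avail L (S - {b}) \<subseteq> avail L S")
    case True
    then have "opened L S b \<le> 0" using avail_length_mono by (simp add: opened_def)
    also have "0 \<le> (1 + \<alpha> i / ?d) * free_near L S b"
      using free_near_nonneg[of L S b] size_i_pos d by (intro mult_nonneg_nonneg add_nonneg_nonneg) auto
    finally show ?thesis .
  next
    case False
    obtain z where z: "0 \<le> z" "z + \<alpha> i \<le> L" "vacant (S - {b}) z (z + \<alpha> i)"
      "\<not> vacant S z (z + \<alpha> i)"
      using False by (auto simp: avail_def)
    then have "\<not> (right_end b \<le> z \<or> z + \<alpha> i \<le> fst b)" unfolding vacant_def by blast
    then have zb: "z < right_end b" "fst b < z + \<alpha> i" by auto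
    let ?I = "{z<..<z + \<alpha> i}" and ?B = "free L S \<inter> {fst b - \<alpha> i<..<right_end b + \<alpha> i}"
    have "?I \<subseteq> ?B \<union> {fst b..<right_end b}"
    proof
      fix t assume t: "t \<in> ?I"
      have "t \<notin> {fst a..<right_end a}" if "a \<in> S" "a \<noteq> b" for a
      proof -
        have "right_end a \<le> z \<or> z + \<alpha> i \<le> fst a" using z(3) that by (auto simp: vacant_def)
        then show ?thesis using t by auto
      qed
      then show "t \<in> ?B \<union> {fst b..<right_end b}" using t z zb unfolding free_def by auto
    qed
    then have "measure lborel ?I \<le> measure lborel (?B \<union> {fst b..<right_end b})"
      using near_fmeasurable[OF fin, of L b]
        fmeasurable_bounded[where a = "fst b" and b = "right_end b" and B = "{fst b..<right_end b}"]
      by (intro measure_mono_fmeasurable fmeasurable.Un) (auto simp: atLeastLessThan_subseteq_atLeastAtMost_iff)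
    also have "\<dots> \<le> free_near L S b + measure lborel {fst b..<right_end b}"
      unfolding free_near_def using near_fmeasurable[OF fin, of L b] by (intro measure_Un_le) auto
    finally have fr: "?d \<le> free_near L S b" using size_i_pos b_ends sb by (simp add: right_end_def)
    have "\<alpha> i \<le> \<alpha> i / ?d * free_near L S b"
      using mult_left_mono[OF fr, of "\<alpha> i"] d size_i_pos by (simp add: pos_le_divide_eq)
    moreover have "\<alpha> (snd b) \<le> \<alpha> i" using sb d by simp
    ultimately show ?thesis using opened_le overlap_le(1) by (simp add: algebra_simps)
  qed
qed

end

section \<open>Space opened by all departures together\<close>

definition near_bound :: real where
  "near_bound = 2 * (2 * \<alpha> i / \<alpha> 1 + 1)"

definition packed :: "(nat \<Rightarrow> real) \<Rightarrow> config \<Rightarrow> config" where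
  "packed v S = {b \<in> S. snd b \<le> i \<and> right_end b \<le> v (snd b)}"

definition spare :: "real \<Rightarrow> (nat \<Rightarrow> real) \<Rightarrow> config \<Rightarrow> real" where
  "spare L v S = L - (\<Sum>b\<in>packed v S. \<alpha> (snd b))"

text \<open>For \<open>i = 1\<close> the value \<open>\<alpha> 0\<close> is unconstrained; the absolute value keeps the bound positive.\<close>

definition spare_bound :: real where
  "spare_bound = (1 + \<bar>1 + \<alpha> i / (\<alpha> i - \<alpha> (i - 1))\<bar>) * near_bound + 1"

text \<open>Squares of item sizes need not be summable against \<open>p\<close>. Items longer than
  \<open>M\<close> are accounted for separately here, and their expected contribution is governed by
  the tail of the mean size.\<close>

definition big_length :: "real \<Rightarrow> real \<Rightarrow> config \<Rightarrow> real" where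
  "big_length M L S = (\<Sum>b\<in>{b \<in> S. fst b < L \<and> M < \<alpha> (snd b)}. min (\<alpha> (snd b)) L)"

lemma items_disjnt:
  assumes S: "valid S"
  shows "pairwise (\<lambda>a b. disjnt ({fst a..<right_end a} \<inter> A) ({fst b..<right_end b} \<inter> A)) S"
proof (rule pairwiseI)
  fix a b assume "a \<in> S" "b \<in> S" "a \<noteq> b"
  then have "right_end a \<le> fst b \<or> right_end b \<le> fst a" by (rule validD(4)[OF S])
  then show "disjnt ({fst a..<right_end a} \<inter> A) ({fst b..<right_end b} \<inter> A)"
    by (auto simp: disjnt_def)
qed

lemma sum_overlap:
  assumes S: "valid S" and L: "0 \<le> L"
  shows "(\<Sum>b\<in>S. overlap L b) + measure lborel (free L S) = L"
proof -
  let ?F = "\<lambda>a. {fst a..<right_end a} \<inter> {0..L}"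
  have fin: "finite S" using validD(1)[OF S] .
  have fm: "(\<Union>a\<in>S. ?F a) \<in> fmeasurable lborel"
    using fin by (intro fmeasurable_bounded[of _ 0 L]) auto
  have "(\<Sum>b\<in>S. overlap L b) = measure lborel (\<Union>a\<in>S. ?F a)"
    unfolding overlap_def
    by (rule measure_UNION'[symmetric, OF fin item_part_fmeasurable items_disjnt[OF S]])
  moreover have "measure lborel ((\<Union>a\<in>S. ?F a) \<union> free L S)
      = measure lborel (\<Union>a\<in>S. ?F a) + measure lborel (free L S)"
  proof -
    have "(\<Union>a\<in>S. ?F a) \<inter> free L S = {}" by (auto simp: free_def)
    then show ?thesis using measure_Un3[OF fm free_fmeasurable[OF fin]] by simp
  qed
  moreover have "(\<Union>a\<in>S. ?F a) \<union> free L S = {0..L}" by (auto simp: free_def)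
  ultimately show ?thesis using L by simp
qed

text \<open>A free point counts for an item only if it is within \<open>\<alpha> i\<close> of its
  start or of its end. Either condition confines an end point of the item to an interval of length
  \<open>2 * \<alpha> i\<close>, which explains \<open>near_bound\<close>.\<close>

lemma sum_free_near:
  assumes S: "valid S"
  shows "(\<Sum>b\<in>S. free_near L S b) \<le> near_bound * measure lborel (free L S)"
  unfolding free_near_def
proof (rule sum_measure_overlap_le)
  have fin: "finite S" using validD(1)[OF S] .
  show "finite S" "free L S \<in> fmeasurable lborel" using fin free_fmeasurable by auto
  show "free L S \<inter> {fst b - \<alpha> i<..<right_end b + \<alpha> i} \<in> sets borel" for b
    using free_sets[OF fin] by auto
  fix z assume z: "z \<in> free L S"
  let ?A = "{b \<in> S. z - \<alpha> i \<le> fst b \<and> fst b \<le> z - \<alpha> i + 2 * \<alpha> i}"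
  let ?B = "{b \<in> S. z - \<alpha> i \<le> right_end b \<and> right_end b \<le> z - \<alpha> i + 2 * \<alpha> i}"
  have "{b \<in> S. z \<in> free L S \<inter> {fst b - \<alpha> i<..<right_end b + \<alpha> i}} \<subseteq> ?A \<union> ?B"
    using z by (auto simp: free_def not_le not_less)
  then have "card {b \<in> S. z \<in> free L S \<inter> {fst b - \<alpha> i<..<right_end b + \<alpha> i}} \<le> card (?A \<union> ?B)"
    using fin by (intro card_mono) auto
  also have "\<dots> \<le> card ?A + card ?B" by (rule card_Un_le)
  finally show "real (card {b \<in> S. z \<in> free L S \<inter> {fst b - \<alpha> i<..<right_end b + \<alpha> i}}) \<le> near_bound"
    using card_starts_le[OF S, of "2 * \<alpha> i" "z - \<alpha> i"] card_right_ends_le[OF S, of "2 * \<alpha> i" "z - \<alpha> i"]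
      size_i_pos by (simp add: near_bound_def)
qed auto

lemma near_bound_pos: "0 < near_bound"
  using size_i_pos size_1_pos by (simp add: near_bound_def add_pos_pos)

lemma spare_bound_ge: "1 \<le> spare_bound"
  using near_bound_pos by (simp add: spare_bound_def)

lemma spare_eq:
  assumes S: "valid S" and L: "0 \<le> L" and v: "\<And>j. v j \<le> L"
  shows "spare L v S = (\<Sum>b\<in>S - packed v S. overlap L b) + measure lborel (free L S)"
proof -
  have fin: "finite S" "packed v S \<subseteq> S" using validD(1)[OF S] by (auto simp: packed_def)
  have "(\<Sum>b\<in>packed v S. \<alpha> (snd b)) = (\<Sum>b\<in>packed v S. overlap L b)"
    using order_trans[OF _ v] by (intro sum.cong refl overlap_inside[symmetric, OF S]) (auto simp: packed_def)
  then show ?thesis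
    using sum_overlap[OF S L] sum.subset_diff[OF fin(2,1), of "overlap L"] by (simp add: spare_def)
qed

lemma spare_nonneg:
  assumes "valid S" "0 \<le> L" "\<And>j. v j \<le> L"
  shows "0 \<le> spare L v S" "measure lborel (free L S) \<le> spare L v S"
  using spare_eq[of S L v] assms sum_nonneg[of "S - packed v S" "overlap L"] overlap_nonneg
  by auto

text \<open>A packed \<open>i\<close>-item opens at most its own length plus nearby free space, a
  packed smaller item only a multiple of nearby free space, and an unpacked item its part of
  \<open>[0, L]\<close> plus nearby free space. Unpacked parts and free space together make up
  \<open>spare\<close>.\<close>

lemma opened_sum:
  assumes S: "valid S" and L: "0 \<le> L" and v: "\<And>j. v j \<le> L"
  shows "(\<Sum>b\<in>S. opened L S b)
    \<le> \<alpha> i * real (card {b \<in> packed v S. snd b = i}) + spare_bound * spare L v S"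
proof -
  let ?P = "packed v S" and ?Pi = "{b \<in> packed v S. snd b = i}"
  let ?f = "measure lborel (free L S)" and ?c = "\<alpha> i / (\<alpha> i - \<alpha> (i - 1))"
  let ?K = "\<bar>1 + ?c\<bar>"
  have fin: "finite S" "?P \<subseteq> S" "?Pi \<subseteq> S" using validD(1)[OF S] by (auto simp: packed_def)
  have "opened L S b \<le> (if b \<in> ?Pi then \<alpha> i else 0) + (if b \<in> ?P then 0 else overlap L b)
      + (1 + ?K) * free_near L S b" if b: "b \<in> S" for b
  proof -
    have le: "opened L S b \<le> overlap L b + free_near L S b" by (rule opened_le[OF S b])
    have fn: "0 \<le> free_near L S b" by (rule free_near_nonneg)
    then have kn: "free_near L S b \<le> (1 + ?K) * free_near L S b" by (simp add: distrib_right)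
    consider "b \<in> ?Pi" | "b \<notin> ?P" | "b \<in> ?P" "snd b < i"
      unfolding packed_def by fastforce
    then show ?thesis
    proof cases
      case 1
      then show ?thesis using le kn overlap_le(1)[OF S b, of L] by auto
    next
      case 2
      then show ?thesis using le kn by auto
    next
      case 3
      have "(1 + ?c) * free_near L S b \<le> ?K * free_near L S b" using fn by (intro mult_right_mono) auto
      moreover have "?K * free_near L S b \<le> (1 + ?K) * free_near L S b" using fn by (intro mult_right_mono) auto
      ultimately have "opened L S b \<le> (1 + ?K) * free_near L S b" using opened_small[OF S b 3(2), of L] by linarith
      then show ?thesis using 3 by auto
    qed
  qed
  then have "(\<Sum>b\<in>S. opened L S b) \<le> (\<Sum>b\<in>S. (if b \<in> ?Pi then \<alpha> i else 0)
      + (if b \<in> ?P then 0 else overlap L b) + (1 + ?K) * free_near L S b)"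
    by (rule sum_mono)
  also have "\<dots> = \<alpha> i * real (card ?Pi) + (\<Sum>b\<in>S - ?P. overlap L b) + (1 + ?K) * (\<Sum>b\<in>S. free_near L S b)"
  proof -
    have "(\<Sum>b\<in>S. if b \<in> ?Pi then \<alpha> i else 0) = \<alpha> i * real (card ?Pi)"
      using fin(1,3) by (simp add: sum.If_cases Int_absorb1)
    moreover have "(\<Sum>b\<in>S. if b \<in> ?P then 0 else overlap L b) = (\<Sum>b\<in>S - ?P. overlap L b)"
      using fin(1) by (simp add: sum.If_cases Diff_eq)
    ultimately show ?thesis by (simp add: sum.distrib sum_distrib_left)
  qed
  also have "(1 + ?K) * (\<Sum>b\<in>S. free_near L S b) \<le> (1 + ?K) * (near_bound * ?f)"
    by (intro mult_left_mono sum_free_near[OF S]) auto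
  finally have main: "(\<Sum>b\<in>S. opened L S b)
      \<le> \<alpha> i * real (card ?Pi) + (\<Sum>b\<in>S - ?P. overlap L b) + (1 + ?K) * near_bound * ?f"
    by simp
  have "(1 + ?K) * near_bound * ?f \<le> (1 + ?K) * near_bound * spare L v S"
    using spare_nonneg(2)[OF S L v] near_bound_pos by (intro mult_left_mono) auto
  moreover have "(\<Sum>b\<in>S - ?P. overlap L b) \<le> spare L v S"
    using spare_eq[OF S L v] by simp
  ultimately show ?thesis using main by (simp add: spare_bound_def algebra_simps)
qed

lemma opened_le_L: "0 \<le> L \<Longrightarrow> opened L S b \<le> L"
  using avail_length_le[of L "S - {b}"] avail_length_nonneg[of L S] by (simp add: opened_def)

text \<open>An item of size at most \<open>M\<close> opens at most
  \<open>M + 2 * \<alpha> i\<close>, so one factor of the square can be replaced by this constant.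
  For a longer item one factor is at most \<open>L\<close> and the other is estimated by its capped
  size.\<close>

lemma opened_square_sum:
  assumes S: "valid S" and M: "\<alpha> i \<le> M" and L: "\<alpha> i \<le> L"
  shows "(\<Sum>b\<in>S. (opened L S b)\<^sup>2)
    \<le> (M + 2 * \<alpha> i) * (\<Sum>b\<in>S. opened L S b) + 3 * L * big_length M L S"
proof -
  let ?B = "{b \<in> S. fst b < L \<and> M < \<alpha> (snd b)}"
  have fin: "finite S" using validD(1)[OF S] .
  have L0: "0 \<le> L" using L size_i_pos by simp
  have "(opened L S b)\<^sup>2 \<le> (M + 2 * \<alpha> i) * opened L S b + (if b \<in> ?B then 3 * L * min (\<alpha> (snd b)) L else 0)"
    if b: "b \<in> S" for b
  proof -
    have o0: "0 \<le> opened L S b" by (rule opened_nonneg)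
    have ov: "opened L S b \<le> overlap L b + 2 * \<alpha> i"
      using opened_le[OF S b, of L] free_near_le[OF S b, of L] by simp
    have Mo: "0 \<le> (M + 2 * \<alpha> i) * opened L S b" using o0 M size_i_pos by simp
    show ?thesis
    proof (cases "fst b < L")
      case False
      then show ?thesis using opened_local[OF S b] by simp
    next
      case inL: True
      show ?thesis
      proof (cases "M < \<alpha> (snd b)")
        case True
        have "opened L S b \<le> min (\<alpha> (snd b)) L + 2 * \<alpha> i" using ov overlap_le(1)[OF S b, of L] overlap_le(2)[OF S b L0] by simp
        \<comment> \<open>Both entries of the minimum are at least \<open>\<alpha> i\<close>, so
          \<open>2 * \<alpha> i\<close> is at most twice the minimum.\<close>
        also have "\<dots> \<le> 3 * min (\<alpha> (snd b)) L" using True M L by simp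
        finally have "opened L S b * opened L S b \<le> L * (3 * min (\<alpha> (snd b)) L)"
          using opened_le_L[OF L0, of S b] o0 L0 by (intro mult_mono) auto
        then show ?thesis using True inL b Mo by (simp add: power2_eq_square mult.assoc mult.left_commute)
      next
        case False
        then have "opened L S b \<le> M + 2 * \<alpha> i" using ov overlap_le(1)[OF S b, of L] by simp
        then show ?thesis using False o0 by (simp add: power2_eq_square mult_right_mono)
      qed
    qed
  qed
  then have "(\<Sum>b\<in>S. (opened L S b)\<^sup>2) \<le> (\<Sum>b\<in>S. (M + 2 * \<alpha> i) * opened L S b
      + (if b \<in> ?B then 3 * L * min (\<alpha> (snd b)) L else 0))"
    by (rule sum_mono)
  also have "\<dots> = (M + 2 * \<alpha> i) * (\<Sum>b\<in>S. opened L S b) + 3 * L * big_length M L S"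
  proof -
    have "(\<Sum>b\<in>S. if b \<in> ?B then 3 * L * min (\<alpha> (snd b)) L else 0) = 3 * L * big_length M L S"
      using fin unfolding big_length_def sum_distrib_left
      by (subst sum.inter_filter[symmetric]) (auto intro!: sum.cong)
    then show ?thesis by (simp add: sum.distrib sum_distrib_left)
  qed
  finally show ?thesis .
qed

lemma big_length_bound:
  assumes S: "valid S" and L: "0 \<le> L"
  shows "0 \<le> big_length M L S" "big_length M L S \<le> (L / \<alpha> 1 + 1) * L"
proof -
  let ?B = "{b \<in> S. fst b < L \<and> M < \<alpha> (snd b)}"
  have fin: "finite S" using validD(1)[OF S] .
  show "0 \<le> big_length M L S"
    unfolding big_length_def using size_pos[OF validD(3)[OF S]] L by (intro sum_nonneg) (auto intro: less_imp_le)
  have "big_length M L S \<le> (\<Sum>b\<in>?B. L)" unfolding big_length_def by (intro sum_mono) auto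
  also have "\<dots> = real (card ?B) * L" by simp
  also have "\<dots> \<le> (L / \<alpha> 1 + 1) * L"
  proof (intro mult_right_mono L)
    have "card ?B \<le> card {b \<in> S. fst b < L}" using fin by (intro card_mono) auto
    then show "real (card ?B) \<le> L / \<alpha> 1 + 1" using card_inside_le[OF S L] by linarith
  qed
  finally show "big_length M L S \<le> (L / \<alpha> 1 + 1) * L" .
qed

section \<open>Occupied room in terms of the counts \<open>F\<close>\<close>

lemma F_valid:
  assumes S: "valid S"
  shows "F \<alpha> j x S = card {a \<in> S. snd a = j \<and> right_end a \<le> x}"
proof -
  have "item_interval \<alpha> a \<subseteq> {0..<x} \<longleftrightarrow> right_end a \<le> x" if "a \<in> S" for a
    using validD(2,5)[OF S that] by (auto simp: item_interval_def right_end_def)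
  then have "{a \<in> S. snd a = j \<and> item_interval \<alpha> a \<subseteq> {0..<x}} = {a \<in> S. snd a = j \<and> right_end a \<le> x}"
    by auto
  then show ?thesis by (simp add: F_def)
qed

lemma packed_type:
  assumes "valid S" "j \<le> i"
  shows "card {b \<in> packed v S. snd b = j} = F \<alpha> j (v j) S"
  unfolding F_valid[OF assms(1)] using assms(2)
  by (intro arg_cong[where f = card]) (auto simp: packed_def)

lemma spare_F:
  assumes S: "valid S"
  shows "spare L v S = L - (\<Sum>j=1..i. \<alpha> j * real (F \<alpha> j (v j) S))"
proof -
  let ?P = "packed v S"
  have fin: "finite ?P" using validD(1)[OF S] by (simp add: packed_def)
  have "(\<Sum>b\<in>?P. \<alpha> (snd b)) = (\<Sum>j\<in>{1..i}. \<Sum>b\<in>{b \<in> ?P. snd b = j}. \<alpha> (snd b))"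
    using fin type_ge_1[OF validD(3)[OF S]]
    by (intro sum.group[symmetric]) (auto simp: packed_def)
  also have "\<dots> = (\<Sum>j\<in>{1..i}. \<alpha> j * real (F \<alpha> j (v j) S))"
  proof (rule sum.cong[OF refl])
    fix j assume "j \<in> {1..i}"
    then have "real (F \<alpha> j (v j) S) = real (card {b \<in> ?P. snd b = j})" using packed_type[OF S] by simp
    then show "(\<Sum>b\<in>{b \<in> ?P. snd b = j}. \<alpha> (snd b)) = \<alpha> j * real (F \<alpha> j (v j) S)"
      by (simp add: sum.cong[of "{b \<in> ?P. snd b = j}" _ "\<lambda>b. \<alpha> (snd b)" "\<lambda>_. \<alpha> j"])
  qed
  finally show ?thesis by (simp add: spare_def)
qed

section \<open>Counting items in a window\<close>

text \<open>If the window behind the last item end before \<open>x\<close> is well filled, so is the window behind \<open>x\<close>,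
  since at most one start and one slot lie between that end and \<open>x\<close>.\<close>

lemma cell:
  assumes S: "valid S" and x0: "0 \<le> x0" "x0 \<le> x - width m" and xL: "x + width m \<le> L"
  shows "real m - 1 \<le> real (card (points L S \<inter> {x..<x + width m}))
    \<or> (\<exists>a\<in>loose m x0 L S. x - width m < right_end a \<and> right_end a \<le> x)
    \<or> vacant S (x - width m) (x - width m + \<alpha> i)
    \<or> (\<exists>b\<in>S. fst b < x - width m + \<alpha> i \<and> x < right_end b)"
proof (cases "\<exists>a\<in>S. x - width m < right_end a \<and> right_end a \<le> x")
  case False
  show ?thesis
  proof (cases "vacant S (x - width m) (x - width m + \<alpha> i)")
    \<comment> \<open>An item that meets the first \<open>\<alpha> i\<close> of the cell does not
      end inside the cell, so it extends beyond \<open>x\<close>.\<close>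
    case not_vacant: False
    then obtain b where "b \<in> S" "x - width m < right_end b" "fst b < x - width m + \<alpha> i"
      by (auto simp: vacant_def not_le)
    then show ?thesis using False by force
  qed simp
next
  case True
  let ?E = "{a \<in> S. right_end a \<le> x}"
  have fin: "finite S" "finite ?E" "?E \<noteq> {}" using validD(1)[OF S] True by auto
  define u where "u = Max (right_end ` ?E)"
  have "u \<in> right_end ` ?E" unfolding u_def using fin by (intro Max_in) auto
  then obtain a where a: "a \<in> S" "u = right_end a" "u \<le> x" by auto
  have umax: "right_end a' \<le> u" if "a' \<in> S" "right_end a' \<le> x" for a'
    unfolding u_def using fin that by (intro Max_ge) auto
  have ux: "x - width m < u" using True umax by force
  show ?thesis
  proof (cases "a \<in> loose m x0 L S")
    case True
    then show ?thesis using ux a by auto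
  next
    case False
    let ?w = "{u..<u + width m}"
    have fp: "finite (points L S)" using finite_points[OF S] .
    have "m + 1 \<le> card (points L S \<inter> ?w)"
      using False a ux x0 xL by (auto simp: loose_def)
    moreover have "points L S \<inter> ?w \<subseteq> (points L S \<inter> {x..<x + width m}) \<union> (fst ` {b \<in> S. u \<le> fst b \<and> fst b < x} \<union> {u})"
    proof
      fix q assume q: "q \<in> points L S \<inter> ?w"
      show "q \<in> (points L S \<inter> {x..<x + width m}) \<union> (fst ` {b \<in> S. u \<le> fst b \<and> fst b < x} \<union> {u})"
      proof (cases "x \<le> q")
        case True
        then show ?thesis using q a by auto
      next
        case qx: False
        show ?thesis
        proof (cases "q \<in> fst ` S")
          case True
          then show ?thesis using q qx by auto
        next
          case False
          then have "q \<in> anchors S" using q by (auto simp: points_def slots_def)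
          moreover have "0 \<le> u" using a validD(2,5)[OF S a(1)] by auto
          ultimately have "q \<le> u" using umax qx by (auto simp: anchors_def)
          then show ?thesis using q by auto
        qed
      qed
    qed
    moreover have "card {b \<in> S. u \<le> fst b \<and> fst b < x} \<le> 1"
    proof -
      have *: False if "b \<in> S" "b' \<in> S" "u \<le> fst b" "fst b < fst b'" "fst b' < x" for b b'
        using fst_less_sep[OF S that(1,2,4)] validD(5)[OF S that(1)] umax[OF that(1)] that by auto
      have "b = b'" if "b \<in> {b \<in> S. u \<le> fst b \<and> fst b < x}" "b' \<in> {b \<in> S. u \<le> fst b \<and> fst b < x}" for b b'
        using *[of b b'] *[of b' b] fst_inj[OF S, of b b'] that by fastforce
      then have "card {b \<in> S. u \<le> fst b \<and> fst b < x} \<le> Suc 0"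
        using fin by (subst card_le_Suc0_iff_eq) auto
      then show ?thesis by simp
    qed
    then have "card (fst ` {b \<in> S. u \<le> fst b \<and> fst b < x} \<union> {u}) \<le> 2"
      using card_image_le[of "{b \<in> S. u \<le> fst b \<and> fst b < x}" fst] fin
        card_Un_le[of "fst ` {b \<in> S. u \<le> fst b \<and> fst b < x}" "{u}"] by simp
    ultimately have "m + 1 \<le> card (points L S \<inter> {x..<x + width m}) + 2"
      using card_mono[of "(points L S \<inter> {x..<x + width m}) \<union> (fst ` {b \<in> S. u \<le> fst b \<and> fst b < x} \<union> {u})"
          "points L S \<inter> ?w"] fp fin
        card_Un_le[of "points L S \<inter> {x..<x + width m}" "fst ` {b \<in> S. u \<le> fst b \<and> fst b < x} \<union> {u}"]
      by (simp del: Un_insert_right)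
    then show ?thesis by linarith
  qed
qed

text \<open>The region is cut into cells of length \<open>width m\<close>. By \<open>cell\<close>, a
  cell contains at least \<open>m - 1\<close> points unless its predecessor contains the end of a
  loose item, begins with available space, or is crossed by a long item. Exceptional cells are
  charged to the loose items, the available length and the long items.\<close>

lemma card_points_ge:
  assumes S: "valid S" and x0: "0 \<le> x0" and m: "1 \<le> m" and M: "M < real m * \<alpha> i"
    and K: "x0 + (real K + 1) * width m \<le> L"
  shows "(real m - 1) * (real K - real (card (loose m x0 L S)) - avail_length L S / \<alpha> i
      - big_length M L S / (real m * \<alpha> i))
    \<le> real (card (points L S \<inter> {x0..<L}))"
proof -
  let ?h = "width m"
  define c where "c k = x0 + real k * ?h" for k
  define J2 where "J2 = {k \<in> {1..K}. \<exists>a\<in>loose m x0 L S. c k - ?h < right_end a \<and> right_end a \<le> c k}"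
  define J3 where "J3 = {k \<in> {1..K}. vacant S (c k - ?h) (c k - ?h + \<alpha> i)}"
  define J4 where "J4 = {k \<in> {1..K}. \<exists>b\<in>S. fst b < c k - ?h + \<alpha> i \<and> c k < right_end b}"
  define J1 where "J1 = {k \<in> {1..K}. real m - 1 \<le> real (card (points L S \<inter> {c k..<c k + ?h}))}"
  have h: "0 < ?h" by (rule width_pos)
  have hm: "?h = real m * \<alpha> i + \<alpha> i" by (simp add: width_def algebra_simps)
  have mi: "0 < real m * \<alpha> i" using m size_i_pos by simp
  have c_lower: "x0 \<le> c k - ?h" if "1 \<le> k" for k
  proof -
    have "1 * ?h \<le> real k * ?h" using that h by (intro mult_right_mono) auto
    then show ?thesis by (simp add: c_def)
  qed
  have c_upper: "c k + ?h \<le> L" if "k \<le> K" for k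
  proof -
    have "(real k + 1) * ?h \<le> (real K + 1) * ?h" using that h by (intro mult_right_mono) auto
    then show ?thesis using K by (simp add: c_def algebra_simps)
  qed
  have c_step: "c j + ?h \<le> c k" if "j < k" for j k
  proof -
    have "(real j + 1) * ?h \<le> real k * ?h" using that h by (intro mult_right_mono) auto
    then show ?thesis by (simp add: c_def algebra_simps)
  qed
  have fin: "finite J1" "finite J2" "finite J3" "finite J4" "finite S"
    using validD(1)[OF S] by (auto simp: J1_def J2_def J3_def J4_def)
  have "{1..K} \<subseteq> J1 \<union> (J2 \<union> (J3 \<union> J4))"
  proof
    fix k assume k: "k \<in> {1..K}"
    then have "x0 \<le> c k - ?h" "c k + ?h \<le> L" using c_lower c_upper by auto
    from cell[OF S x0 this] k show "k \<in> J1 \<union> (J2 \<union> (J3 \<union> J4))"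
      unfolding J1_def J2_def J3_def J4_def by blast
  qed
  then have "card {1..K} \<le> card (J1 \<union> (J2 \<union> (J3 \<union> J4)))" using fin by (intro card_mono) auto
  also have "\<dots> \<le> card J1 + (card J2 + (card J3 + card J4))"
    by (meson add_left_mono card_Un_le order_trans)
  finally have cover: "real K \<le> real (card J1) + real (card J2) + real (card J3) + real (card J4)" by simp
  have "card J2 \<le> card (loose m x0 L S)"
  proof -
    \<comment> \<open>The ends of the loose items are assigned to cells that are open on the left,
      so rounding up recovers the index and each loose item spoils one cell only.\<close>
    have "J2 \<subseteq> (\<lambda>a. nat \<lceil>(right_end a - x0) / ?h\<rceil>) ` loose m x0 L S"
    proof
      fix k assume "k \<in> J2"
      then obtain a where a: "a \<in> loose m x0 L S" "c k - ?h < right_end a" "right_end a \<le> c k"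
        by (auto simp: J2_def)
      have "real k - 1 < (right_end a - x0) / ?h" "(right_end a - x0) / ?h \<le> real k"
        using a h by (auto simp: c_def field_simps)
      then have "\<lceil>(right_end a - x0) / ?h\<rceil> = int k" by linarith
      then show "k \<in> (\<lambda>a. nat \<lceil>(right_end a - x0) / ?h\<rceil>) ` loose m x0 L S"
        using a(1) by (intro image_eqI[of _ _ a]) auto
    qed
    then show ?thesis using finite_loose[OF S] by (meson card_image_le card_mono finite_imageI order_trans)
  qed
  then have b2: "real (card J2) \<le> real (card (loose m x0 L S))" by simp
  have "real (card J3) * \<alpha> i \<le> measure lborel (avail L S)"
  proof (rule card_disjoint_intervals_le[where f = "\<lambda>k. c k - ?h"])
    show "{c k - ?h<..<c k - ?h + \<alpha> i} \<subseteq> avail L S" if "k \<in> J3" for k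
      using that c_lower[of k] c_upper[of k] x0 width_ge[of m] h unfolding J3_def avail_def
      by (intro subsetI UN_I[of "c k - ?h"]) auto
    show "c j - ?h + \<alpha> i \<le> c k - ?h" if "j < k" for j k
      using c_step[OF that] width_ge[of m] by simp
  qed (use fin avail_fmeasurable size_i_pos in auto)
  then have b3: "real (card J3) \<le> avail_length L S / \<alpha> i"
    using size_i_pos by (simp add: avail_length_def field_simps)
  let ?B = "{b \<in> S. fst b < L \<and> M < \<alpha> (snd b)}"
  let ?U = "\<Union>b\<in>?B. {fst b..<right_end b} \<inter> {0..L}"
  have finB: "finite ?B" using fin by simp
  have J4_iff: "\<exists>b\<in>?B. {c k - ?h + \<alpha> i<..<c k} \<subseteq> {fst b..<right_end b} \<inter> {0..L}" if k: "k \<in> J4" for k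
  proof -
    obtain b where b: "b \<in> S" "fst b < c k - ?h + \<alpha> i" "c k < right_end b"
      using k by (auto simp: J4_def)
    have ck: "x0 \<le> c k - ?h" "c k + ?h \<le> L" using k c_lower c_upper by (auto simp: J4_def)
    \<comment> \<open>The item covers the cell except possibly its first \<open>\<alpha> i\<close>.
      By the choice of \<open>m\<close> it is longer than \<open>M\<close>, and disjoint pieces of
      length \<open>real m * \<alpha> i\<close> can be charged to it.\<close>
    have "real m * \<alpha> i < \<alpha> (snd b)" using b hm by (simp add: right_end_def)
    then have "b \<in> ?B" using b ck M h width_ge[of m] by auto
    moreover have "{c k - ?h + \<alpha> i<..<c k} \<subseteq> {fst b..<right_end b} \<inter> {0..L}"
      using b ck x0 size_i_pos h by auto
    ultimately show ?thesis by blast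
  qed
  have "real (card J4) * (real m * \<alpha> i) \<le> measure lborel ?U"
  proof (rule card_disjoint_intervals_le[where f = "\<lambda>k. c k - ?h + \<alpha> i"])
    show "?U \<in> fmeasurable lborel" using finB by (intro fmeasurable_bounded[of _ 0 L]) auto
    show "{c k - ?h + \<alpha> i<..<c k - ?h + \<alpha> i + real m * \<alpha> i} \<subseteq> ?U" if "k \<in> J4" for k
    proof -
      have "c k - ?h + \<alpha> i + real m * \<alpha> i = c k" using hm by simp
      then show ?thesis using J4_iff[OF that] by (simp only:) blast
    qed
    show "c j - ?h + \<alpha> i + real m * \<alpha> i \<le> c k - ?h + \<alpha> i" if "j < k" for j k
      using c_step[OF that] hm size_i_pos by simp
  qed (use fin mi in auto)
  also have "\<dots> \<le> (\<Sum>b\<in>?B. measure lborel ({fst b..<right_end b} \<inter> {0..L}))"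
    by (rule measure_UNION_le[OF finB]) auto
  also have "\<dots> \<le> big_length M L S"
    unfolding big_length_def
  proof (rule sum_mono)
    fix b assume b: "b \<in> ?B"
    have "0 \<le> L" using validD(2)[OF S, of b] b by auto
    then show "measure lborel ({fst b..<right_end b} \<inter> {0..L}) \<le> min (\<alpha> (snd b)) L"
      using overlap_le[OF S, of b L] b by (auto simp: overlap_def)
  qed
  finally have b4: "real (card J4) \<le> big_length M L S / (real m * \<alpha> i)"
    using mi by (simp add: field_simps)
  let ?C = "\<lambda>k. points L S \<inter> {c k..<c k + ?h}"
  have fp: "finite (points L S)" by (rule finite_points[OF S])
  have "(real m - 1) * real (card J1) = (\<Sum>k\<in>J1. real m - 1)" by simp
  also have "\<dots> \<le> (\<Sum>k\<in>J1. real (card (?C k)))" by (rule sum_mono) (simp add: J1_def)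
  also have "\<dots> = real (card (\<Union>k\<in>J1. ?C k))"
  proof -
    have "?C j \<inter> ?C k = {}" if "j < k" for j k using c_step[OF that] by auto
    then have "?C j \<inter> ?C k = {}" if "j \<noteq> k" for j k using that by (metis inf_commute linorder_neqE_nat)
    then show ?thesis using fin fp by (subst card_UN_disjoint) auto
  qed
  also have "\<dots> \<le> real (card (points L S \<inter> {x0..<L}))"
  proof (intro of_nat_mono card_mono)
    show "(\<Union>k\<in>J1. ?C k) \<subseteq> points L S \<inter> {x0..<L}"
    proof (rule UN_least, rule subsetI)
      fix k q assume "k \<in> J1" "q \<in> ?C k"
      then show "q \<in> points L S \<inter> {x0..<L}"
        using c_lower[of k] c_upper[of k] h by (auto simp: J1_def)
    qed
  qed (use fp in simp)
  finally have "(real m - 1) * real (card J1) \<le> real (card (points L S \<inter> {x0..<L}))" .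
  moreover have "(real m - 1) * (real K - real (card (loose m x0 L S)) - avail_length L S / \<alpha> i
      - big_length M L S / (real m * \<alpha> i)) \<le> (real m - 1) * real (card J1)"
    using m cover b2 b3 b4 by (intro mult_left_mono) auto
  ultimately show ?thesis by linarith
qed

lemma card_points_le:
  assumes S: "valid S"
  shows "real (card (points L S \<inter> {x0..<L}))
    \<le> real (card {b \<in> S. x0 \<le> fst b \<and> fst b < L}) + avail_length L S / \<alpha> i"
proof -
  have fin: "finite S" using validD(1)[OF S] .
  have "points L S \<inter> {x0..<L} \<subseteq> fst ` {b \<in> S. x0 \<le> fst b \<and> fst b < L} \<union> slots L S"
    by (auto simp: points_def)
  then have "card (points L S \<inter> {x0..<L}) \<le> card (fst ` {b \<in> S. x0 \<le> fst b \<and> fst b < L} \<union> slots L S)"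
    using fin finite_slots[OF S] by (intro card_mono) auto
  also have "\<dots> \<le> card (fst ` {b \<in> S. x0 \<le> fst b \<and> fst b < L}) + card (slots L S)" by (rule card_Un_le)
  also have "\<dots> \<le> card {b \<in> S. x0 \<le> fst b \<and> fst b < L} + card (slots L S)"
    using fin by (simp add: card_image_le)
  finally have "real (card (points L S \<inter> {x0..<L}))
      \<le> real (card {b \<in> S. x0 \<le> fst b \<and> fst b < L}) + real (card (slots L S))" by simp
  moreover have "real (card (slots L S)) \<le> avail_length L S / \<alpha> i"
    using card_slots_avail_length[OF S, of L] size_i_pos by (simp add: field_simps)
  ultimately show ?thesis by linarith
qed

text \<open>A comparison of volumes: each item of a type above \<open>i\<close> takes at least
  \<open>d\<close> more room than an \<open>i\<close>-item. If there are nearly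
  \<open>(L - x0) / \<alpha> i\<close> starts, such items must be few, and apart from the
  \<open>n\<close> small ones the rest are \<open>i\<close>-items.\<close>

lemma F_ge:
  assumes S: "valid S" and x0: "0 \<le> x0" "x0 \<le> L"
    and d: "0 < d" "\<And>k. k \<in> I \<Longrightarrow> i < k \<Longrightarrow> \<alpha> i + d \<le> \<alpha> k"
  defines "R \<equiv> real (card {b \<in> S. x0 \<le> fst b \<and> fst b < L})"
    and "n \<equiv> real (card (small_inside x0 L S))"
  shows "real (F \<alpha> i x0 S) + R - 1 - n - (L - x0 + \<alpha> i * n + \<alpha> i - \<alpha> i * R) / d \<le> real (F \<alpha> i L S)"
proof -
  let ?T = "{b \<in> S. x0 \<le> fst b \<and> right_end b \<le> L}"
  let ?Ti = "{b \<in> ?T. snd b = i}" and ?Ts = "{b \<in> ?T. snd b < i}" and ?Tb = "{b \<in> ?T. i < snd b}"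
  have fin: "finite S" using validD(1)[OF S] .
  have T3: "real (card ?T) = real (card ?Ti) + real (card ?Ts) + real (card ?Tb)"
  proof -
    have "?T = ?Ti \<union> (?Ts \<union> ?Tb)" by auto
    then have "card ?T = card (?Ti \<union> (?Ts \<union> ?Tb))" by (rule arg_cong)
    also have "\<dots> = card ?Ti + card (?Ts \<union> ?Tb)" using fin by (intro card_Un_disjoint) auto
    also have "card (?Ts \<union> ?Tb) = card ?Ts + card ?Tb" using fin by (intro card_Un_disjoint) auto
    finally show ?thesis by simp
  qed
  have small: "real (card ?Ts) \<le> n"
  proof -
    have "?Ts \<subseteq> small_inside x0 L S" using validD(5)[OF S] by (fastforce simp: small_inside_def)
    then show ?thesis unfolding n_def using fin by (intro of_nat_mono card_mono) (auto simp: small_inside_def)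
  qed
  \<comment> \<open>At most one item straddles \<open>L\<close>. It causes the \<open>- 1\<close> in
    the bound and the single \<open>\<alpha> i\<close> in the numerator.\<close>
  have R: "R \<le> real (card ?T) + 1"
  proof -
    let ?X = "{b \<in> S. fst b < L \<and> L < right_end b}"
    have "{b \<in> S. x0 \<le> fst b \<and> fst b < L} \<subseteq> ?T \<union> ?X" by auto
    then have "card {b \<in> S. x0 \<le> fst b \<and> fst b < L} \<le> card (?T \<union> ?X)" using fin by (intro card_mono) auto
    also have "\<dots> \<le> card ?T + card ?X" by (rule card_Un_le)
    also have "card ?X \<le> Suc 0"
      using fin validD(4)[OF S] by (subst card_le_Suc0_iff_eq) fastforce+
    finally show ?thesis by (simp add: R_def)
  qed
  have vol: "(\<Sum>b\<in>?T. \<alpha> (snd b)) \<le> L - x0"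
  proof -
    let ?F = "\<lambda>a. {fst a..<right_end a} \<inter> UNIV"
    have fm: "?F a \<in> fmeasurable lborel" for a
      by (rule fmeasurable_bounded[where a = "fst a" and b = "right_end a"]) auto
    have "(\<Sum>b\<in>?T. \<alpha> (snd b)) = (\<Sum>b\<in>?T. measure lborel (?F b))"
      using validD(5)[OF S] by (intro sum.cong) (auto simp: right_end_def less_imp_le)
    also have "\<dots> = measure lborel (\<Union>b\<in>?T. ?F b)"
      using fin pairwise_subset[OF items_disjnt[OF S, of UNIV], of ?T]
      by (intro measure_UNION'[symmetric] fm) auto
    also have "\<dots> \<le> measure lborel {x0..L}"
      using fin fmeasurable_cbox[of x0 L] by (intro measure_mono_fmeasurable) auto
    finally show ?thesis using x0 by simp
  qed
  have "\<alpha> i - (if snd b < i then \<alpha> i else 0) + (if i < snd b then d else 0) \<le> \<alpha> (snd b)" if "b \<in> ?T" for b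
    using d(2)[of "snd b"] size_pos[of "snd b"] validD(3)[OF S, of b] that
    by (cases "snd b < i"; cases "i < snd b") (auto intro: less_imp_le)
  then have "(\<Sum>b\<in>?T. \<alpha> i - (if snd b < i then \<alpha> i else 0) + (if i < snd b then d else 0)) \<le> L - x0"
    by (rule order_trans[OF sum_mono vol])
  moreover have "(\<Sum>b\<in>?T. \<alpha> i - (if snd b < i then \<alpha> i else 0) + (if i < snd b then d else 0))
      = \<alpha> i * real (card ?T) - \<alpha> i * real (card ?Ts) + d * real (card ?Tb)"
    using fin by (simp add: sum.distrib sum_subtractf sum.If_cases Int_def mult.commute conj_assoc)
  moreover have "\<alpha> i * real (card ?Ts) \<le> \<alpha> i * n" using small size_i_pos by simp
  moreover have "\<alpha> i * (R - 1) \<le> \<alpha> i * real (card ?T)" using R size_i_pos by simp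
  ultimately have "d * real (card ?Tb) \<le> L - x0 + \<alpha> i * n + \<alpha> i - \<alpha> i * R"
    by (simp add: algebra_simps)
  then have big: "real (card ?Tb) \<le> (L - x0 + \<alpha> i * n + \<alpha> i - \<alpha> i * R) / d"
    using d(1) by (simp add: field_simps)
  have "F \<alpha> i x0 S + card ?Ti \<le> F \<alpha> i L S"
  proof -
    let ?A = "{a \<in> S. snd a = i \<and> right_end a \<le> x0}"
    have "?A \<inter> ?Ti = {}" using validD(5)[OF S] by fastforce
    then have "card ?A + card ?Ti = card (?A \<union> ?Ti)" using fin by (subst card_Un_disjoint) auto
    also have "\<dots> \<le> card {a \<in> S. snd a = i \<and> right_end a \<le> L}" using fin x0 by (intro card_mono) auto
    finally show ?thesis by (simp add: F_valid[OF S])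
  qed
  then have "real (F \<alpha> i x0 S) + real (card ?Ti) \<le> real (F \<alpha> i L S)" by simp
  then show ?thesis using T3 small R big by linarith
qed

end

section \<open>Stationarity\<close>

text \<open>Turns the balance equations into integrals over counting measures, where nonnegative
  sums can be interchanged freely.\<close>

lemma has_sum_nn_integral:
  fixes f :: "'a \<Rightarrow> real"
  assumes "(f has_sum s) A" "\<And>x. x \<in> A \<Longrightarrow> 0 \<le> f x"
  shows "(\<integral>\<^sup>+x. ennreal (f x) \<partial>count_space A) = ennreal s"
proof -
  have "f summable_on A" using assms(1) by (auto simp: summable_on_def)
  then have "Infinite_Set_Sum.abs_summable_on f A"
    using summable_on_iff_abs_summable_on_real abs_summable_equivalent by blast
  then show ?thesis
    using nn_integral_conv_infsetsum[of f A] infsetsum_infsum[of f A] infsumI[OF assms(1)] assms(2) by simp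
qed

lemma nn_integral_infsum:
  fixes f :: "'a \<Rightarrow> real"
  assumes "(\<integral>\<^sup>+x. ennreal (f x) \<partial>count_space A) = ennreal s" "0 \<le> s" "\<And>x. x \<in> A \<Longrightarrow> 0 \<le> f x"
  shows "infsum f A = s"
proof -
  have "integrable (count_space A) f"
    using assms by (intro integrableI_nonneg) (auto simp: AE_count_space)
  then have "Infinite_Set_Sum.abs_summable_on f A" by (simp add: Infinite_Set_Sum.abs_summable_on_def)
  then show ?thesis
    using infsetsum_infsum[of f A] infsetsum_conv_nn_integral[of A f] assms by simp
qed

context first_fit_model
begin

section \<open>The generator, and stationarity tested against functions\<close>

definition type_pmf :: "nat pmf" where
  "type_pmf = embed_pmf (\<lambda>k. if k \<in> I then p k else 0)"

lemma pmf_type: "pmf type_pmf k = (if k \<in> I then p k else 0)"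
  unfolding type_pmf_def
proof (rule pmf_embed_pmf)
  show "0 \<le> (if k \<in> I then p k else 0)" for k using prob_pos[of k] by (auto intro: less_imp_le)
  have "(\<integral>\<^sup>+k. ennreal (if k \<in> I then p k else 0) \<partial>count_space UNIV) = (\<integral>\<^sup>+k. ennreal (p k) \<partial>count_space I)"
    by (subst nn_integral_count_space_indicator) (auto intro!: nn_integral_cong simp: indicator_def)
  also have "\<dots> = ennreal 1" using prob_pos by (intro has_sum_nn_integral prob_sum) (auto intro: less_imp_le)
  finally show "(\<integral>\<^sup>+k. ennreal (if k \<in> I then p k else 0) \<partial>count_space UNIV) = 1" by simp
qed

lemma set_pmf_type: "set_pmf type_pmf = I"
  using prob_pos by (auto simp: set_pmf_eq pmf_type) force

lemma arrive_neq: "valid S \<Longrightarrow> k \<in> I \<Longrightarrow> arrive \<alpha> S k \<noteq> S"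
  using valid_arrive(2)[of S k] by (auto simp: arrive_def)

lemma arrive_inj:
  assumes "valid S" "k \<in> I" "k' \<in> I" "arrive \<alpha> S k = arrive \<alpha> S k'"
  shows "k = k'"
proof -
  have "(first_fit_position \<alpha> S k, k) \<in> arrive \<alpha> S k'" using assms(4) by (auto simp: arrive_def)
  then show ?thesis using valid_arrive(2)[OF assms(1,2)] by (auto simp: arrive_def)
qed

lemma card_arrive: "valid S \<Longrightarrow> k \<in> I \<Longrightarrow> card (arrive \<alpha> S k) = Suc (card S)"
  using valid_arrive(2)[of S k] validD(1)[of S] by (simp add: arrive_def)

text \<open>The type of an arriving item can be read off from the new configuration, so at most one
  type leads from \<open>S\<close> to \<open>T\<close>. The arrival part is \<open>r\<close> times
  the law of the configuration after an arrival.\<close>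

lemma transition_rate_eq:
  assumes S: "valid S"
  shows "transition_rate I \<alpha> p r S T
    = r * pmf (map_pmf (arrive \<alpha> S) type_pmf) T + (\<Sum>a\<in>S. of_bool (T = S - {a}))"
proof -
  let ?X = "{k \<in> I. T = arrive \<alpha> S k}"
  have fX: "finite ?X"
  proof (cases "?X = {}")
    case False
    then obtain k where "k \<in> ?X" by blast
    then have "?X \<subseteq> {k}" using arrive_inj[OF S] by auto
    then show ?thesis by (rule finite_subset) simp
  qed (metis finite.emptyI)
  have "pmf (map_pmf (arrive \<alpha> S) type_pmf) T = measure type_pmf (arrive \<alpha> S -` {T} \<inter> set_pmf type_pmf)"
    by (simp add: pmf_map measure_Int_set_pmf)
  also have "arrive \<alpha> S -` {T} \<inter> set_pmf type_pmf = ?X" by (auto simp: set_pmf_type)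
  also have "measure type_pmf ?X = (\<Sum>k\<in>?X. p k)"
    unfolding measure_measure_pmf_finite[OF fX] by (intro sum.cong) (auto simp: pmf_type)
  finally show ?thesis
    using fX validD(1)[OF S]
    by (simp add: transition_rate_def sum_distrib_left mult.commute Int_def)
qed

lemma transition_rate_nonneg: "valid S \<Longrightarrow> 0 \<le> r \<Longrightarrow> 0 \<le> transition_rate I \<alpha> p r S T"
  by (simp add: transition_rate_eq sum_nonneg)

text \<open>Transitions stay among the reachable states and always change the state, so sums over
  \<open>reachable I \<alpha> - {S}\<close> may be extended to all configurations.\<close>

lemma transition_rate_0:
  assumes S: "S \<in> reachable I \<alpha>" and T: "T \<notin> reachable I \<alpha> - {S}"
  shows "transition_rate I \<alpha> p r S T = 0"
proof -
  have v: "valid S" using S by (rule reachable_valid)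
  have "T \<notin> set_pmf (map_pmf (arrive \<alpha> S) type_pmf)"
    using T arrive_neq[OF v] reachable.arrival[OF S] by (auto simp: set_pmf_type)
  then have "pmf (map_pmf (arrive \<alpha> S) type_pmf) T = 0" by (rule iffD2[OF pmf_eq_0_set_pmf])
  moreover have "T \<noteq> S - {a}" if "a \<in> S" for a using T reachable.departure[OF S that] that by auto
  ultimately show ?thesis by (simp add: transition_rate_eq[OF v])
qed

lemma transition_rate_integral:
  assumes S: "valid S" and r: "0 \<le> r"
  shows "(\<integral>\<^sup>+T. ennreal (transition_rate I \<alpha> p r S T) * \<phi> T \<partial>count_space UNIV)
    = ennreal r * (\<integral>\<^sup>+k. \<phi> (arrive \<alpha> S k) \<partial>measure_pmf type_pmf) + (\<Sum>a\<in>S. \<phi> (S - {a}))"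
proof -
  let ?\<mu> = "map_pmf (arrive \<alpha> S) type_pmf"
  have fin: "finite S" using validD(1)[OF S] .
  have "ennreal (transition_rate I \<alpha> p r S T) * \<phi> T
      = ennreal r * (ennreal (pmf ?\<mu> T) * \<phi> T) + (\<Sum>a\<in>S. \<phi> (S - {a}) * indicator {S - {a}} T)" for T
  proof -
    have "ennreal (\<Sum>a\<in>S. of_bool (T = S - {a})) * \<phi> T = (\<Sum>a\<in>S. \<phi> (S - {a}) * indicator {S - {a}} T)"
    proof -
      have e: "ennreal (\<Sum>a\<in>S. of_bool (T = S - {a})) = (\<Sum>a\<in>S. ennreal (of_bool (T = S - {a})))"
        by (rule sum_ennreal[symmetric]) simp
      show ?thesis
        unfolding e sum_distrib_right by (intro sum.cong) (auto simp: indicator_def)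
    qed
    then show ?thesis
      using r by (simp add: transition_rate_eq[OF S] ennreal_plus sum_nonneg ennreal_mult distrib_right mult.assoc
          del: sum_of_bool_eq of_nat_sum)
  qed
  then have "(\<integral>\<^sup>+T. ennreal (transition_rate I \<alpha> p r S T) * \<phi> T \<partial>count_space UNIV)
      = (\<integral>\<^sup>+T. ennreal r * (ennreal (pmf ?\<mu> T) * \<phi> T) \<partial>count_space UNIV)
        + (\<integral>\<^sup>+T. (\<Sum>a\<in>S. \<phi> (S - {a}) * indicator {S - {a}} T) \<partial>count_space UNIV)"
    by (simp add: nn_integral_add)
  also have "(\<integral>\<^sup>+T. ennreal r * (ennreal (pmf ?\<mu> T) * \<phi> T) \<partial>count_space UNIV)
      = ennreal r * (\<integral>\<^sup>+T. \<phi> T \<partial>measure_pmf ?\<mu>)"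
    by (simp add: nn_integral_cmult nn_integral_measure_pmf)
  also have "(\<integral>\<^sup>+T. \<phi> T \<partial>measure_pmf ?\<mu>) = (\<integral>\<^sup>+k. \<phi> (arrive \<alpha> S k) \<partial>measure_pmf type_pmf)"
    by simp
  also have "(\<integral>\<^sup>+T. (\<Sum>a\<in>S. \<phi> (S - {a}) * indicator {S - {a}} T) \<partial>count_space UNIV) = (\<Sum>a\<in>S. \<phi> (S - {a}))"
    by (subst nn_integral_sum) (auto simp: nn_integral_cmult_indicator)
  finally show ?thesis .
qed

lemma exit_rate_eq:
  assumes S: "S \<in> reachable I \<alpha>" and r: "0 \<le> r"
  shows "exit_rate I \<alpha> p r S = r + real (card S)"
  unfolding exit_rate_def
proof (rule nn_integral_infsum)
  have v: "valid S" using S by (rule reachable_valid)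
  have "(\<integral>\<^sup>+T. ennreal (transition_rate I \<alpha> p r S T) \<partial>count_space (reachable I \<alpha> - {S}))
      = (\<integral>\<^sup>+T. ennreal (transition_rate I \<alpha> p r S T) * 1 \<partial>count_space UNIV)"
    using transition_rate_0[OF S]
    by (subst nn_integral_count_space_indicator) (auto intro!: nn_integral_cong simp: indicator_def)
  also have "\<dots> = ennreal r + of_nat (card S)"
    unfolding transition_rate_integral[OF v r] by simp
  also have "\<dots> = ennreal (r + real (card S))" using r by (simp add: ennreal_plus ennreal_of_nat_eq_real_of_nat)
  finally show "(\<integral>\<^sup>+T. ennreal (transition_rate I \<alpha> p r S T) \<partial>count_space (reachable I \<alpha> - {S}))
      = ennreal (r + real (card S))" .
qed (use r transition_rate_nonneg[OF reachable_valid[OF S]] in auto)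

text \<open>Multiplying each balance equation by \<open>\<phi> T\<close> and summing over
  \<open>T\<close> gives this identity. With values in \<open>ennreal\<close> the interchange of the
  sums requires no integrability.\<close>

lemma stationary_nn_integral:
  fixes \<phi> :: "config \<Rightarrow> ennreal"
  assumes st: "stationary_distribution I \<alpha> p r \<pi>" and r: "0 < r"
  shows "(\<integral>\<^sup>+S. \<phi> S * ennreal (r + real (card S)) \<partial>measure_pmf \<pi>)
    = (\<integral>\<^sup>+S. ennreal r * (\<integral>\<^sup>+k. \<phi> (arrive \<alpha> S k) \<partial>measure_pmf type_pmf) + (\<Sum>a\<in>S. \<phi> (S - {a})) \<partial>measure_pmf \<pi>)"
proof -
  let ?q = "\<lambda>S T. ennreal (transition_rate I \<alpha> p r S T)"
  have sub: "set_pmf \<pi> \<subseteq> reachable I \<alpha>" using st by (simp add: stationary_distribution_def)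
  then have out: "pmf \<pi> S = 0" if "S \<notin> reachable I \<alpha>" for S using that by (auto simp: set_pmf_iff)
  have bal: "(\<integral>\<^sup>+S. ennreal (pmf \<pi> S) * ?q S T \<partial>count_space UNIV) = ennreal (pmf \<pi> T) * ennreal (r + real (card T))" for T
  proof (cases "T \<in> reachable I \<alpha>")
    case True
    let ?f = "\<lambda>S. pmf \<pi> S * transition_rate I \<alpha> p r S T"
    have "(?f has_sum (pmf \<pi> T * exit_rate I \<alpha> p r T)) (reachable I \<alpha> - {T})"
      using st True by (simp add: stationary_distribution_def)
    then have "(\<integral>\<^sup>+S. ennreal (?f S) \<partial>count_space (reachable I \<alpha> - {T})) = ennreal (pmf \<pi> T * exit_rate I \<alpha> p r T)"
      by (rule has_sum_nn_integral)
        (use r in \<open>auto intro!: mult_nonneg_nonneg transition_rate_nonneg reachable_valid\<close>)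
    moreover have "(\<integral>\<^sup>+S. ennreal (?f S) \<partial>count_space (reachable I \<alpha> - {T}))
        = (\<integral>\<^sup>+S. ennreal (pmf \<pi> S) * ?q S T \<partial>count_space UNIV)"
      using transition_rate_0[OF True, of T] out
      by (subst nn_integral_count_space_indicator) (auto intro!: nn_integral_cong simp: indicator_def ennreal_mult')
    ultimately show ?thesis
      using r by (simp add: exit_rate_eq[OF True] ennreal_mult')
  next
    case False
    have z: "ennreal (pmf \<pi> S) * ?q S T = 0" for S
      using out[of S] transition_rate_0[of S T r] False by (cases "S \<in> reachable I \<alpha>") auto
    show ?thesis unfolding z using out[OF False] by simp
  qed
  have "(\<integral>\<^sup>+S. \<phi> S * ennreal (r + real (card S)) \<partial>measure_pmf \<pi>)
      = (\<integral>\<^sup>+T. \<phi> T * (\<integral>\<^sup>+S. ennreal (pmf \<pi> S) * ?q S T \<partial>count_space UNIV) \<partial>count_space UNIV)"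
    unfolding nn_integral_measure_pmf bal by (intro nn_integral_cong) (simp add: mult_ac)
  also have "\<dots> = (\<integral>\<^sup>+T. \<integral>\<^sup>+S. (\<lambda>(S, T). ennreal (pmf \<pi> S) * (?q S T * \<phi> T)) (S, T) \<partial>count_space UNIV \<partial>count_space UNIV)"
    by (subst nn_integral_cmult[symmetric]) (auto intro!: nn_integral_cong simp: mult_ac)
  also have "\<dots> = (\<integral>\<^sup>+S. \<integral>\<^sup>+T. (\<lambda>(S, T). ennreal (pmf \<pi> S) * (?q S T * \<phi> T)) (S, T) \<partial>count_space UNIV \<partial>count_space UNIV)"
    unfolding nn_integral_snd_count_space nn_integral_fst_count_space ..
  also have "\<dots> = (\<integral>\<^sup>+S. ennreal (pmf \<pi> S) * (\<integral>\<^sup>+T. ?q S T * \<phi> T \<partial>count_space UNIV) \<partial>count_space UNIV)"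
    by (simp add: nn_integral_cmult)
  also have "\<dots> = (\<integral>\<^sup>+S. ennreal (pmf \<pi> S) * (ennreal r * (\<integral>\<^sup>+k. \<phi> (arrive \<alpha> S k) \<partial>measure_pmf type_pmf)
      + (\<Sum>a\<in>S. \<phi> (S - {a}))) \<partial>count_space UNIV)"
  proof (rule nn_integral_cong)
    fix S :: config
    show "ennreal (pmf \<pi> S) * (\<integral>\<^sup>+T. ?q S T * \<phi> T \<partial>count_space UNIV) = ennreal (pmf \<pi> S) *
        (ennreal r * (\<integral>\<^sup>+k. \<phi> (arrive \<alpha> S k) \<partial>measure_pmf type_pmf) + (\<Sum>a\<in>S. \<phi> (S - {a})))"
      using transition_rate_integral[OF reachable_valid, of S r \<phi>] r out[of S]
      by (cases "S \<in> reachable I \<alpha>") auto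
  qed
  finally show ?thesis unfolding nn_integral_measure_pmf .
qed

lemma AE_reachable:
  assumes "stationary_distribution I \<alpha> p r \<pi>" "\<And>S. S \<in> reachable I \<alpha> \<Longrightarrow> P S"
  shows "AE S in measure_pmf \<pi>. P S"
  using assms by (auto simp: AE_measure_pmf_iff stationary_distribution_def)

text \<open>The number of items present changes by one in each step, so the stationarity equations for
  the sets \<open>{card \<le> m}\<close> give the cut equations \<open>r P(card = m) = (m + 1) P(card = m + 1)\<close>.\<close>

lemma card_expectation_le:
  assumes st: "stationary_distribution I \<alpha> p r \<pi>" and r: "0 < r"
  shows "(\<integral>\<^sup>+S. ennreal (real (card S)) \<partial>measure_pmf \<pi>) \<le> ennreal r"
proof -
  define a where "a m = (\<integral>\<^sup>+S. (if card S \<le> m then ennreal (real (card S)) else 0) \<partial>measure_pmf \<pi>)" for m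
  define P where "P m = (\<integral>\<^sup>+S. (if card S < m then 1 else 0) \<partial>measure_pmf \<pi>)" for m
  have P_le: "P m \<le> 1" for m
  proof -
    have "P m \<le> (\<integral>\<^sup>+S. 1 \<partial>measure_pmf \<pi>)" unfolding P_def by (intro nn_integral_mono) auto
    then show ?thesis by simp
  qed
  have step: "ennreal r * P (Suc m) + a m = ennreal r * P m + a (Suc m)" for m
  proof -
    let ?\<phi> = "\<lambda>S::config. if card S \<le> m then 1 else (0::ennreal)"
    have "(\<integral>\<^sup>+S. ?\<phi> S * ennreal (r + real (card S)) \<partial>measure_pmf \<pi>)
      = (\<integral>\<^sup>+S. ennreal r * (if card S < Suc m then 1 else 0)
          + (if card S \<le> m then ennreal (real (card S)) else 0) \<partial>measure_pmf \<pi>)"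
      using r by (intro nn_integral_cong) (auto simp: ennreal_plus)
    also have "\<dots> = ennreal r * P (Suc m) + a m"
      by (simp add: nn_integral_add nn_integral_cmult a_def P_def)
    finally have "(\<integral>\<^sup>+S. ?\<phi> S * ennreal (r + real (card S)) \<partial>measure_pmf \<pi>)
      = ennreal r * P (Suc m) + a m" .
    moreover have "(\<integral>\<^sup>+S. ennreal r * (\<integral>\<^sup>+k. ?\<phi> (arrive \<alpha> S k) \<partial>measure_pmf type_pmf) + (\<Sum>b\<in>S. ?\<phi> (S - {b})) \<partial>measure_pmf \<pi>)
      = (\<integral>\<^sup>+S. ennreal r * (if card S < m then 1 else 0)
          + (if card S \<le> Suc m then ennreal (real (card S)) else 0) \<partial>measure_pmf \<pi>)"
    proof (intro nn_integral_cong_AE AE_reachable[OF st])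
      fix S assume "S \<in> reachable I \<alpha>"
      then have v: "valid S" by (rule reachable_valid)
      have "(\<integral>\<^sup>+k. ?\<phi> (arrive \<alpha> S k) \<partial>measure_pmf type_pmf) = (\<integral>\<^sup>+k. (if card S < m then 1 else 0) \<partial>measure_pmf type_pmf)"
        by (intro nn_integral_cong_AE) (auto simp: AE_measure_pmf_iff set_pmf_type card_arrive[OF v])
      moreover have "(\<Sum>b\<in>S. ?\<phi> (S - {b})) = (\<Sum>b\<in>S. if card S \<le> Suc m then 1 else 0)"
        using validD(1)[OF v] by (intro sum.cong) auto
      ultimately show "ennreal r * (\<integral>\<^sup>+k. ?\<phi> (arrive \<alpha> S k) \<partial>measure_pmf type_pmf) + (\<Sum>b\<in>S. ?\<phi> (S - {b}))
        = ennreal r * (if card S < m then 1 else 0) + (if card S \<le> Suc m then ennreal (real (card S)) else 0)"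
        by (simp add: ennreal_of_nat_eq_real_of_nat)
    qed
    moreover have "\<dots> = ennreal r * P m + a (Suc m)"
      by (simp add: nn_integral_add nn_integral_cmult a_def P_def)
    ultimately show ?thesis using stationary_nn_integral[OF st r, of ?\<phi>] by simp
  qed
  have a_eq: "a m = ennreal r * P m" for m
  proof (induction m)
    case 0
    have "a 0 = (\<integral>\<^sup>+S. 0 \<partial>measure_pmf \<pi>)" unfolding a_def by (intro nn_integral_cong) auto
    then show ?case by (simp add: P_def)
  next
    case (Suc m)
    have "ennreal r * P m \<noteq> \<top>"
      using P_le[of m] by (auto simp: ennreal_mult_eq_top_iff top_unique)
    moreover have "ennreal r * P m + ennreal r * P (Suc m) = ennreal r * P m + a (Suc m)"
      using step[of m] Suc by (simp add: add.commute)
    ultimately show ?case by (simp add: ennreal_add_left_cancel)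
  qed
  have "(\<integral>\<^sup>+S. ennreal (real (card S)) \<partial>measure_pmf \<pi>)
    = (\<integral>\<^sup>+S. (SUP m. if card S \<le> m then ennreal (real (card S)) else 0) \<partial>measure_pmf \<pi>)"
  proof (intro nn_integral_cong antisym)
    fix S :: config
    show "ennreal (real (card S)) \<le> (SUP m. if card S \<le> m then ennreal (real (card S)) else 0)"
      by (rule SUP_upper2[of "card S"]) auto
    show "(SUP m. if card S \<le> m then ennreal (real (card S)) else 0) \<le> ennreal (real (card S))"
      by (rule SUP_least) auto
  qed
  also have "\<dots> = (SUP m. a m)"
    unfolding a_def by (intro nn_integral_monotone_convergence_SUP) (auto simp: incseq_def le_fun_def)
  also have "\<dots> \<le> ennreal r"
  proof (rule SUP_least)
    show "a m \<le> ennreal r" for m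
      unfolding a_eq using mult_left_mono[OF P_le[of m], of "ennreal r"] by simp
  qed
  finally show ?thesis .
qed

text \<open>Restricted to the reachable states, since the counts have no uniform bound on
  configurations with overlapping items.\<close>

definition bdd :: "(config \<Rightarrow> real) \<Rightarrow> bool" where
  "bdd f \<longleftrightarrow> (\<exists>c. \<forall>S\<in>reachable I \<alpha>. \<bar>f S\<bar> \<le> c)"

lemma bddI: "(\<And>S. S \<in> reachable I \<alpha> \<Longrightarrow> \<bar>f S\<bar> \<le> c) \<Longrightarrow> bdd f"
  by (auto simp: bdd_def)

lemma bdd_const: "bdd (\<lambda>_. c)"
  by (rule bddI[of _ "\<bar>c\<bar>"]) simp

lemma bdd_add: "bdd f \<Longrightarrow> bdd g \<Longrightarrow> bdd (\<lambda>S. f S + g S)"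
proof -
  assume "bdd f" "bdd g"
  then obtain c d where cd: "\<And>S. S \<in> reachable I \<alpha> \<Longrightarrow> \<bar>f S\<bar> \<le> c" "\<And>S. S \<in> reachable I \<alpha> \<Longrightarrow> \<bar>g S\<bar> \<le> d"
    by (auto simp: bdd_def)
  show ?thesis by (rule bddI[of _ "c + d"]) (use cd in \<open>force intro: order_trans[OF abs_triangle_ineq]\<close>)
qed

lemma bdd_mult: "bdd f \<Longrightarrow> bdd g \<Longrightarrow> bdd (\<lambda>S. f S * g S)"
proof -
  assume "bdd f" "bdd g"
  then obtain c d where cd: "\<And>S. S \<in> reachable I \<alpha> \<Longrightarrow> \<bar>f S\<bar> \<le> c" "\<And>S. S \<in> reachable I \<alpha> \<Longrightarrow> \<bar>g S\<bar> \<le> d"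
    by (auto simp: bdd_def)
  show ?thesis
  proof (rule bddI[of _ "c * d"])
    fix S assume S: "S \<in> reachable I \<alpha>"
    have "0 \<le> c" using cd(1)[OF S] by linarith
    then show "\<bar>f S * g S\<bar> \<le> c * d" unfolding abs_mult using cd[OF S] by (intro mult_mono) auto
  qed
qed

lemma bdd_minus: "bdd f \<Longrightarrow> bdd (\<lambda>S. - f S)"
  using bdd_mult[OF bdd_const[of "-1"]] by simp

lemma bdd_diff: "bdd f \<Longrightarrow> bdd g \<Longrightarrow> bdd (\<lambda>S. f S - g S)"
  using bdd_add[OF _ bdd_minus] by simp

lemma bdd_divide: "bdd f \<Longrightarrow> bdd (\<lambda>S. f S / c)"
  using bdd_mult[OF bdd_const[of "1 / c"]] by simp

lemma bdd_power2: "bdd f \<Longrightarrow> bdd (\<lambda>S. (f S)\<^sup>2)"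
  unfolding power2_eq_square by (rule bdd_mult)

lemma bdd_of_bool: "bdd (\<lambda>S. of_bool (P S))"
  by (rule bddI[of _ 1]) simp

lemma bdd_sum: "(\<And>j. j \<in> J \<Longrightarrow> bdd (f j)) \<Longrightarrow> bdd (\<lambda>S. \<Sum>j\<in>J. f j S)"
  by (induction J rule: infinite_finite_induct) (auto intro: bdd_const bdd_add)

lemmas bdd_intros = bdd_const bdd_add bdd_mult bdd_minus bdd_diff bdd_divide bdd_power2 bdd_of_bool bdd_sum

lemma integrable_bdd:
  assumes "stationary_distribution I \<alpha> p r \<pi>" "bdd f"
  shows "integrable (measure_pmf \<pi>) f"
proof -
  obtain c where "\<And>S. S \<in> reachable I \<alpha> \<Longrightarrow> \<bar>f S\<bar> \<le> c" using assms(2) by (auto simp: bdd_def)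
  then show ?thesis
    by (intro measure_pmf.integrable_const_bound[where B = c] AE_reachable[OF assms(1)]) auto
qed

lemma expectation_mono:
  assumes "stationary_distribution I \<alpha> p r \<pi>" "bdd f" "bdd g"
    "\<And>S. S \<in> reachable I \<alpha> \<Longrightarrow> f S \<le> g S"
  shows "measure_pmf.expectation \<pi> f \<le> measure_pmf.expectation \<pi> g"
  using assms by (intro integral_mono_AE integrable_bdd AE_reachable) auto

text \<open>A generator inequality, integrated against the stationary distribution.\<close>

lemma drift:
  fixes \<phi> A B G :: "config \<Rightarrow> real" and g :: "nat \<Rightarrow> real"
  assumes st: "stationary_distribution I \<alpha> p r \<pi>" and r: "0 < r" and i: "i \<in> I"
    and bdd: "bdd \<phi>" "bdd A" "bdd B" "bdd G" and g: "integrable (measure_pmf type_pmf) g"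
    and arr: "\<And>S k. S \<in> reachable I \<alpha> \<Longrightarrow> k \<in> I \<Longrightarrow>
      \<phi> S + (if k = i then A S else 0) - G S - g k \<le> \<phi> (arrive \<alpha> S k)"
    and dep: "\<And>S. S \<in> reachable I \<alpha> \<Longrightarrow> (\<Sum>b\<in>S. \<phi> S - \<phi> (S - {b})) \<le> B S"
  shows "r * p i * measure_pmf.expectation \<pi> A
    \<le> measure_pmf.expectation \<pi> B + r * measure_pmf.expectation \<pi> G + r * measure_pmf.expectation type_pmf g"
proof -
  let ?E = "measure_pmf.expectation \<pi>" and ?T = "measure_pmf.expectation type_pmf"
  obtain c where c: "\<And>S. S \<in> reachable I \<alpha> \<Longrightarrow> \<bar>\<phi> S\<bar> \<le> c" using bdd(1) by (auto simp: bdd_def)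
  have c0: "0 \<le> c" using c[OF reachable.empty] by linarith
  \<comment> \<open>A version of \<open>\<phi>\<close> shifted by \<open>c\<close> on the reachable
    states and clipped elsewhere. It is nonnegative and bounded on all configurations, as the
    identity in \<open>ennreal\<close> and the integrability arguments demand.\<close>
  define \<psi> where "\<psi> S = max 0 (min (2 * c) (\<phi> S + c))" for S
  have \<psi>: "\<psi> S = \<phi> S + c" if "S \<in> reachable I \<alpha>" for S
    using c[OF that] by (auto simp: \<psi>_def)
  have \<psi>0: "0 \<le> \<psi> S" "\<psi> S \<le> 2 * c" for S using c0 by (auto simp: \<psi>_def)
  have int_card: "integrable (measure_pmf \<pi>) (\<lambda>S. real (card S))"
    using card_expectation_le[OF st r] by (intro integrableI_nonneg) (auto simp: top_unique less_top[symmetric])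
  have int_\<psi>: "integrable (measure_pmf type_pmf) (\<lambda>k. \<psi> (arrive \<alpha> S k))" for S
    using \<psi>0 by (intro measure_pmf.integrable_const_bound[where B = "2 * c"]) auto
  define L where "L S = \<psi> S * (r + real (card S))" for S
  define R where "R S = r * ?T (\<lambda>k. \<psi> (arrive \<alpha> S k)) + (\<Sum>b\<in>S. \<psi> (S - {b}))" for S
  have T_le: "0 \<le> ?T (\<lambda>k. \<psi> (arrive \<alpha> S k))" "?T (\<lambda>k. \<psi> (arrive \<alpha> S k)) \<le> 2 * c" for S
  proof -
    show "0 \<le> ?T (\<lambda>k. \<psi> (arrive \<alpha> S k))" using \<psi>0 by simp
    have "?T (\<lambda>k. \<psi> (arrive \<alpha> S k)) \<le> ?T (\<lambda>k. 2 * c)"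
      using \<psi>0 int_\<psi> by (intro integral_mono) auto
    then show "?T (\<lambda>k. \<psi> (arrive \<alpha> S k)) \<le> 2 * c" by simp
  qed
  have sum_le: "0 \<le> (\<Sum>b\<in>S. \<psi> (S - {b}))" "(\<Sum>b\<in>S. \<psi> (S - {b})) \<le> 2 * c * real (card S)" for S
    using \<psi>0 sum_mono[of S "\<lambda>b. \<psi> (S - {b})" "\<lambda>_. 2 * c"] by (auto intro: sum_nonneg simp: mult.commute)
  have int_dom: "integrable (measure_pmf \<pi>) (\<lambda>S. 2 * c * (r + real (card S)))"
    using int_card by simp
  have L_bound: "0 \<le> L S" "L S \<le> 2 * c * (r + real (card S))" for S
    unfolding L_def using \<psi>0 r by (auto intro!: mult_right_mono)
  have R_bound: "0 \<le> R S" "R S \<le> 2 * c * (r + real (card S))" for S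
  proof -
    show "0 \<le> R S" unfolding R_def using T_le(1)[of S] sum_le(1)[of S] r by simp
    have "r * ?T (\<lambda>k. \<psi> (arrive \<alpha> S k)) \<le> r * (2 * c)" using T_le(2)[of S] r by (intro mult_left_mono) auto
    then show "R S \<le> 2 * c * (r + real (card S))"
      unfolding R_def using sum_le(2)[of S] by (simp add: algebra_simps)
  qed
  have int_L: "integrable (measure_pmf \<pi>) L" and int_R: "integrable (measure_pmf \<pi>) R"
    using L_bound R_bound by (auto intro!: Bochner_Integration.integrable_bound[OF int_dom] AE_I2 order_trans[OF _ abs_ge_self])
  have "(\<integral>\<^sup>+S. ennreal (L S) \<partial>measure_pmf \<pi>) = (\<integral>\<^sup>+S. ennreal (R S) \<partial>measure_pmf \<pi>)"
  proof -
    have "ennreal (L S) = ennreal (\<psi> S) * ennreal (r + real (card S))" for S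
      unfolding L_def using \<psi>0(1) r by (simp add: ennreal_mult)
    moreover have "ennreal (R S) = ennreal r * (\<integral>\<^sup>+k. ennreal (\<psi> (arrive \<alpha> S k)) \<partial>measure_pmf type_pmf)
        + (\<Sum>b\<in>S. ennreal (\<psi> (S - {b})))" for S
      unfolding R_def using \<psi>0(1) r T_le(1)[of S] sum_le(1)[of S] int_\<psi>[of S]
      by (simp add: ennreal_plus ennreal_mult nn_integral_eq_integral sum_ennreal)
    ultimately show ?thesis using stationary_nn_integral[OF st r, of "\<lambda>S. ennreal (\<psi> S)"] by simp
  qed
  then have LR: "?E L = ?E R"
    using L_bound(1) R_bound(1) by (simp add: integral_eq_nn_integral)
  \<comment> \<open>The difference \<open>R S - L S\<close> is the generator applied to
    \<open>\<psi>\<close>. Its stationary mean vanishes by \<open>LR\<close>.\<close>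
  have pt: "r * p i * A S - B S - r * G S - r * ?T g \<le> R S - L S" if S: "S \<in> reachable I \<alpha>" for S
  proof -
    have v: "valid S" using S by (rule reachable_valid)
    have ii: "integrable (measure_pmf type_pmf) (\<lambda>k. A S * indicator {i} k)"
      by (rule measure_pmf.integrable_const_bound[where B = "\<bar>A S\<bar>"]) (auto simp: indicator_def)
    have "?T (\<lambda>k. \<psi> S + A S * indicator {i} k - G S - g k) \<le> ?T (\<lambda>k. \<psi> (arrive \<alpha> S k))"
    proof (intro integral_mono_AE)
      show "AE k in measure_pmf type_pmf. \<psi> S + A S * indicator {i} k - G S - g k \<le> \<psi> (arrive \<alpha> S k)"
        unfolding AE_measure_pmf_iff set_pmf_type
      proof
        fix k assume k: "k \<in> I"
        have "arrive \<alpha> S k \<in> reachable I \<alpha>" using S k by (rule reachable.arrival)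
        then show "\<psi> S + A S * indicator {i} k - G S - g k \<le> \<psi> (arrive \<alpha> S k)"
          using arr[OF S k] S by (auto simp: \<psi> indicator_def split: if_splits)
      qed
    qed (use g int_\<psi> ii in auto)
    also have "?T (\<lambda>k. \<psi> S + A S * indicator {i} k - G S - g k) = \<psi> S + A S * p i - G S - ?T g"
    proof -
      have "?T (\<lambda>k. A S * indicator {i} k) = A S * p i"
        using i by (simp add: measure_pmf_single pmf_type)
      then show ?thesis using g ii by simp
    qed
    finally have "r * (\<psi> S + A S * p i - G S - ?T g) \<le> r * ?T (\<lambda>k. \<psi> (arrive \<alpha> S k))"
      using r by (intro mult_left_mono) auto
    moreover have "(\<Sum>b\<in>S. \<psi> S - \<psi> (S - {b})) \<le> B S"
    proof -
      have "(\<Sum>b\<in>S. \<psi> S - \<psi> (S - {b})) = (\<Sum>b\<in>S. \<phi> S - \<phi> (S - {b}))"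
        using S reachable.departure[OF S] by (intro sum.cong) (auto simp: \<psi>)
      then show ?thesis using dep[OF S] by simp
    qed
    ultimately show ?thesis
      by (simp add: R_def L_def sum_subtractf algebra_simps)
  qed
  have "?E (\<lambda>S. r * p i * A S - B S - r * G S - r * ?T g) \<le> ?E (\<lambda>S. R S - L S)"
  proof (intro integral_mono_AE AE_reachable[OF st] pt)
    show "integrable (measure_pmf \<pi>) (\<lambda>S. r * p i * A S - B S - r * G S - r * ?T g)"
      using bdd by (intro integrable_bdd[OF st] bdd_intros)
    show "integrable (measure_pmf \<pi>) (\<lambda>S. R S - L S)"
      by (rule Bochner_Integration.integrable_diff[OF int_R int_L])
  qed
  moreover have "?E (\<lambda>S. r * p i * A S - B S - r * G S - r * ?T g)
      = r * p i * ?E A - ?E B - r * ?E G - r * ?T g"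
    using bdd(2-4)[THEN integrable_bdd[OF st]] by simp
  ultimately show ?thesis using LR int_L int_R by simp
qed

section \<open>The tail of the mean size, and expected totals over items present\<close>

definition sizes_above :: "real \<Rightarrow> real" where
  "sizes_above M = measure_pmf.expectation type_pmf (\<lambda>k. if k \<in> I \<and> M < \<alpha> k then \<alpha> k else 0)"

lemma integrable_sizes: "integrable (measure_pmf type_pmf) (\<lambda>k. if k \<in> I then \<alpha> k else 0)"
proof -
  have "(\<integral>\<^sup>+k. ennreal (if k \<in> I then \<alpha> k else 0) \<partial>measure_pmf type_pmf)
      = (\<integral>\<^sup>+k. ennreal (\<alpha> k * p k) \<partial>count_space I)"
    unfolding nn_integral_measure_pmf using size_pos prob_pos
    by (subst nn_integral_count_space_indicator)
      (auto intro!: nn_integral_cong simp: pmf_type indicator_def ennreal_mult[symmetric] less_imp_le mult.commute)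
  also have "\<dots> = ennreal (\<Sum>\<^sub>\<infinity>k\<in>I. \<alpha> k * p k)"
    using size_pos prob_pos mean_size_finite
    by (intro has_sum_nn_integral has_sum_infsum) (auto intro!: mult_nonneg_nonneg less_imp_le)
  finally show ?thesis
    using size_pos by (intro integrableI_nonneg) (auto simp: less_imp_le)
qed

lemma integrable_sizes_above: "integrable (measure_pmf type_pmf) (\<lambda>k. if k \<in> I \<and> M < \<alpha> k then \<alpha> k else 0)"
  by (rule Bochner_Integration.integrable_bound[OF integrable_sizes]) (auto simp: size_pos less_imp_le)

lemma sizes_above_tendsto: "(sizes_above \<longlongrightarrow> 0) at_top"
proof -
  have "((\<lambda>M. sizes_above M) \<longlongrightarrow> measure_pmf.expectation type_pmf (\<lambda>k. 0)) at_top"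
    unfolding sizes_above_def
  proof (rule integral_dominated_convergence_at_top[OF _ _ integrable_sizes])
    show "\<forall>\<^sub>F M in at_top. AE k in measure_pmf type_pmf.
        norm (if k \<in> I \<and> M < \<alpha> k then \<alpha> k else 0) \<le> (if k \<in> I then \<alpha> k else 0)"
      by (intro always_eventually allI AE_I2) (auto simp: size_pos less_imp_le)
    show "AE k in measure_pmf type_pmf. ((\<lambda>M. if k \<in> I \<and> M < \<alpha> k then \<alpha> k else 0) \<longlongrightarrow> 0) at_top"
    proof (rule AE_I2)
      fix k
      have "\<forall>\<^sub>F M in at_top. (if k \<in> I \<and> M < \<alpha> k then \<alpha> k else 0) = 0"
        using eventually_ge_at_top[of "\<alpha> k"] by eventually_elim auto
      then show "((\<lambda>M. if k \<in> I \<and> M < \<alpha> k then \<alpha> k else 0) \<longlongrightarrow> 0) at_top"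
        by (rule tendsto_eventually)
    qed
  qed auto
  then show ?thesis by simp
qed

lemma sum_filter_remove:
  fixes f :: "'a \<Rightarrow> real"
  assumes "finite S"
  shows "(\<Sum>b\<in>S. (\<Sum>a\<in>{a \<in> S. P a}. f a) - (\<Sum>a\<in>{a \<in> S - {b}. P a}. f a)) = (\<Sum>a\<in>{a \<in> S. P a}. f a)"
proof -
  have "(\<Sum>a\<in>{a \<in> S. P a}. f a) - (\<Sum>a\<in>{a \<in> S - {b}. P a}. f a) = (if P b then f b else 0)" if "b \<in> S" for b
  proof (cases "P b")
    case True
    then have "{a \<in> S. P a} = insert b {a \<in> S - {b}. P a}" using that by auto
    moreover have "sum f (insert b {a \<in> S - {b}. P a}) = f b + sum f {a \<in> S - {b}. P a}"
      using assms by (intro sum.insert) auto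
    ultimately show ?thesis using True by simp
  next
    case False
    then have "{a \<in> S. P a} = {a \<in> S - {b}. P a}" by auto
    then show ?thesis using False by simp
  qed
  then have "(\<Sum>b\<in>S. (\<Sum>a\<in>{a \<in> S. P a}. f a) - (\<Sum>a\<in>{a \<in> S - {b}. P a}. f a)) = (\<Sum>b\<in>S. if P b then f b else 0)"
    by (intro sum.cong) auto
  then show ?thesis using assms by (simp add: sum.inter_filter)
qed

text \<open>Little's law as an inequality: an arrival of type \<open>k\<close> adds at most
  \<open>g k\<close> to the total weight, while departures at unit rate remove weight at a rate
  equal to the total.\<close>

lemma sum_inside_expectation_le:
  assumes st: "stationary_distribution I \<alpha> p r \<pi>" and r: "0 < r" and L: "0 \<le> L"
    and w: "\<And>k. k \<in> I \<Longrightarrow> 0 \<le> w k \<and> w k \<le> W" "\<And>k. k \<in> I \<Longrightarrow> w k \<le> g k"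
    and g: "integrable (measure_pmf type_pmf) g"
  shows "measure_pmf.expectation \<pi> (\<lambda>S. \<Sum>b\<in>{b \<in> S. fst b < L}. w (snd b))
    \<le> r * measure_pmf.expectation type_pmf g"
    and "bdd (\<lambda>S. \<Sum>b\<in>{b \<in> S. fst b < L}. w (snd b))"
proof -
  let ?V = "\<lambda>S. \<Sum>b\<in>{b \<in> S. fst b < L}. w (snd b)"
  have W: "0 \<le> W" using w(1)[OF one_type] by linarith
  show b: "bdd ?V"
  proof (rule bddI)
    fix S assume "S \<in> reachable I \<alpha>"
    then have S: "valid S" by (rule reachable_valid)
    have w': "0 \<le> w (snd b) \<and> w (snd b) \<le> W" if "b \<in> S" for b using w(1)[OF validD(3)[OF S that]] .
    then have "0 \<le> ?V S" by (intro sum_nonneg) auto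
    moreover have "?V S \<le> real (card {b \<in> S. fst b < L}) * W"
      using sum_mono[of "{b \<in> S. fst b < L}" "\<lambda>b. w (snd b)" "\<lambda>_. W"] w' by simp
    moreover have "real (card {b \<in> S. fst b < L}) * W \<le> (L / \<alpha> 1 + 1) * W"
      using card_inside_le[OF S L] W by (rule mult_right_mono)
    ultimately show "\<bar>?V S\<bar> \<le> (L / \<alpha> 1 + 1) * W" by linarith
  qed
  have "r * p 1 * measure_pmf.expectation \<pi> (\<lambda>_. 0) \<le> measure_pmf.expectation \<pi> (\<lambda>S. - ?V S)
      + r * measure_pmf.expectation \<pi> (\<lambda>_. 0) + r * measure_pmf.expectation type_pmf g"
  proof (rule drift[OF st r one_type, where \<phi> = "\<lambda>S. - ?V S"])
    fix S assume R: "S \<in> reachable I \<alpha>"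
    then have S: "valid S" by (rule reachable_valid)
    show "(\<Sum>b\<in>S. - ?V S - - ?V (S - {b})) \<le> - ?V S"
      using sum_filter_remove[OF validD(1)[OF S], where P = "\<lambda>b. fst b < L" and f = "\<lambda>b. w (snd b)"]
      by (simp add: sum_subtractf)
    fix k assume k: "k \<in> I"
    let ?s = "first_fit_position \<alpha> S k"
    have "{b \<in> arrive \<alpha> S k. fst b < L} \<subseteq> insert (?s, k) {b \<in> S. fst b < L}" by (auto simp: arrive_def)
    then have "?V (arrive \<alpha> S k) \<le> (\<Sum>b\<in>insert (?s, k) {b \<in> S. fst b < L}. w (snd b))"
      using validD(1,3)[OF S] w(1) k by (intro sum_mono2) auto
    also have "\<dots> = w k + ?V S"
      using validD(1)[OF S] valid_arrive(2)[OF S k] by (subst sum.insert) auto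
    finally show "- ?V S + (if k = 1 then 0 else 0) - 0 - g k \<le> - ?V (arrive \<alpha> S k)"
      using w(2)[OF k] by simp
  qed (use b g in \<open>auto intro!: bdd_intros\<close>)
  then show "measure_pmf.expectation \<pi> ?V \<le> r * measure_pmf.expectation type_pmf g" by simp
qed

end

context first_fit_type
begin

lemma bdd_loose: "0 \<le> L \<Longrightarrow> bdd (\<lambda>S. real (card (loose m x L S)))"
  using card_loose_le[OF reachable_valid] by (intro bddI[of _ "L / \<alpha> 1 + 1"]) simp

lemma bdd_avail: "0 \<le> L \<Longrightarrow> bdd (avail_length L)"
  using avail_length_le avail_length_nonneg by (intro bddI[of _ L]) simp

lemma bdd_card_inside:
  assumes "0 \<le> L" "\<And>S. Y S \<subseteq> {b \<in> S. fst b < L}"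
  shows "bdd (\<lambda>S. real (card (Y S)))"
proof (rule bddI[of _ "L / \<alpha> 1 + 1"])
  fix S assume "S \<in> reachable I \<alpha>"
  then have S: "valid S" by (rule reachable_valid)
  have "card (Y S) \<le> card {b \<in> S. fst b < L}"
    using assms(2) validD(1)[OF S] by (intro card_mono) auto
  then show "\<bar>real (card (Y S))\<bar> \<le> L / \<alpha> 1 + 1" using card_inside_le[OF S assms(1)] by simp
qed

lemma bdd_small_inside: "0 \<le> L \<Longrightarrow> bdd (\<lambda>S. real (card (small_inside x L S)))"
  by (intro bdd_card_inside) (auto simp: small_inside_def)

lemma bdd_potential:
  assumes L: "0 \<le> L"
  shows "bdd (potential m x L)"
proof -
  have "bdd (\<lambda>S. real (card (points L S \<inter> {x..<L})))"
  proof (rule bddI[of _ "L / \<alpha> 1 + 1 + L / \<alpha> i"])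
    fix S assume "S \<in> reachable I \<alpha>"
    then have S: "valid S" by (rule reachable_valid)
    have "card {b \<in> S. x \<le> fst b \<and> fst b < L} \<le> card {b \<in> S. fst b < L}"
      using validD(1)[OF S] by (intro card_mono) auto
    moreover have "avail_length L S / \<alpha> i \<le> L / \<alpha> i"
      using avail_length_le[OF L] size_i_pos by (intro divide_right_mono) auto
    ultimately show "\<bar>real (card (points L S \<inter> {x..<L}))\<bar> \<le> L / \<alpha> 1 + 1 + L / \<alpha> i"
      using card_points_le[OF S, of L x] card_inside_le[OF S L] by simp
  qed
  then show ?thesis unfolding potential_def using L by (intro bdd_intros bdd_loose)
qed

section \<open>Expectation bounds at a fixed scale, with drift gap \<open>\<kappa>\<close> and error
  \<open>D\<close>\<close>

context
  fixes r :: real and \<pi> :: "config pmf" and x L \<kappa> :: real and D :: "config \<Rightarrow> real"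
  assumes st: "stationary_distribution I \<alpha> p r \<pi>" and r: "0 < r"
    and x: "0 \<le> x" and L: "\<alpha> i \<le> L" and \<kappa>: "0 < \<kappa>"
    and D: "bdd D" "\<And>S. 0 \<le> D S"
    and opened: "\<And>S. S \<in> reachable I \<alpha> \<Longrightarrow> (\<Sum>b\<in>S. opened L S b) \<le> r * (\<alpha> i * p i - \<kappa> + D S)"
begin

private abbreviation "E \<equiv> measure_pmf.expectation \<pi>"
private abbreviation "Q \<equiv> avail_length L"
private abbreviation "X m S \<equiv> real (card (loose m x L S))"
private abbreviation "N0 \<equiv> L / \<alpha> 1 + 1"

private lemma L0: "0 \<le> L"
  using L size_i_pos by simp

private lemma N0: "0 \<le> N0"
  using L0 size_1_pos by simp

private lemmas int = integrable_bdd[OF st]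

private lemma bdds: "bdd Q" "bdd (X m)" "bdd D" "bdd (\<lambda>S. real (card (small_inside x L S)))"
  "bdd (potential m x L)" "bdd (big_length M L)"
proof -
  show "bdd (big_length M L)"
    using big_length_bound[OF reachable_valid L0] by (intro bddI[of _ "(L / \<alpha> 1 + 1) * L"]) simp
qed (use L0 D bdd_avail bdd_loose bdd_small_inside bdd_potential in auto)

lemma big_length_expectation: "E (big_length M L) \<le> r * sizes_above M"
proof -
  have "big_length M L S = (\<Sum>b\<in>{b \<in> S. fst b < L}. if M < \<alpha> (snd b) then min (\<alpha> (snd b)) L else 0)"
    if "S \<in> reachable I \<alpha>" for S
    unfolding big_length_def using validD(1)[OF reachable_valid[OF that]]
    by (subst sum.inter_filter[symmetric]) (auto intro!: sum.cong)
  then have "E (big_length M L) = E (\<lambda>S. \<Sum>b\<in>{b \<in> S. fst b < L}. if M < \<alpha> (snd b) then min (\<alpha> (snd b)) L else 0)"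
    by (intro integral_cong_AE AE_reachable[OF st]) auto
  also have "\<dots> \<le> r * sizes_above M"
    unfolding sizes_above_def
    by (rule sum_inside_expectation_le(1)[OF st r L0, where W = L and w = "\<lambda>k. if M < \<alpha> k then min (\<alpha> k) L else 0",
          OF _ _ integrable_sizes_above])
      (use L0 size_pos in \<open>auto intro: less_imp_le simp: min_le_iff_disj\<close>)
  finally show ?thesis .
qed

text \<open>Quadratic Lyapunov function: \<open>i\<close>-arrivals lower \<open>Q\<close> by at
  least \<open>\<alpha> i\<close> at rate \<open>p i * r\<close> while \<open>Q\<close> is positive,
  and departures raise it at a rate smaller by \<open>\<kappa> * r\<close>, up to the error. So the
  square of \<open>Q\<close> has drift about \<open>- 2 * \<kappa> * r * Q\<close>, plus the second
  moments of the jumps.\<close>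

lemma avail_expectation:
  assumes M: "\<alpha> i \<le> M"
  shows "2 * \<kappa> * E Q \<le> p i * (\<alpha> i)\<^sup>2 + 2 * L * E D + (M + 2 * \<alpha> i) * (\<alpha> i * p i + E D) + 3 * L * sizes_above M"
proof -
  have pi: "0 < p i" using prob_pos type_i .
  have M0: "0 \<le> M + 2 * \<alpha> i" using M size_i_pos by simp
  let ?A = "\<lambda>S. 2 * \<alpha> i * Q S - (\<alpha> i)\<^sup>2"
  let ?B = "\<lambda>S. 2 * r * (\<alpha> i * p i - \<kappa>) * Q S + 2 * L * r * D S + (M + 2 * \<alpha> i) * r * (\<alpha> i * p i + D S)
      + 3 * L * big_length M L S"
  have main: "r * p i * E ?A \<le> E ?B + r * E (\<lambda>_. 0) + r * measure_pmf.expectation type_pmf (\<lambda>_. 0)"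
  proof (rule drift[OF st r type_i, where \<phi> = "\<lambda>S. - (Q S)\<^sup>2"])
    fix S assume R: "S \<in> reachable I \<alpha>"
    then have S: "valid S" by (rule reachable_valid)
    have Q0: "0 \<le> Q S" "Q S \<le> L" using avail_length_nonneg avail_length_le[OF L0] by auto
    have "(\<Sum>b\<in>S. - (Q S)\<^sup>2 - - (Q (S - {b}))\<^sup>2) = 2 * Q S * (\<Sum>b\<in>S. opened L S b) + (\<Sum>b\<in>S. (opened L S b)\<^sup>2)"
      unfolding sum_distrib_left sum.distrib[symmetric]
      by (intro sum.cong) (auto simp: opened_def power2_eq_square algebra_simps)
    also have "\<dots> \<le> (2 * Q S + (M + 2 * \<alpha> i)) * (\<Sum>b\<in>S. opened L S b) + 3 * L * big_length M L S"
      using opened_square_sum[OF S M L] by (simp add: algebra_simps)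
    also have "\<dots> \<le> 2 * Q S * (r * (\<alpha> i * p i - \<kappa> + D S)) + (M + 2 * \<alpha> i) * (r * (\<alpha> i * p i + D S))
        + 3 * L * big_length M L S"
    proof -
      have "2 * Q S * (\<Sum>b\<in>S. opened L S b) \<le> 2 * Q S * (r * (\<alpha> i * p i - \<kappa> + D S))"
        using opened[OF R] Q0 by (intro mult_left_mono) auto
      moreover have "r * (\<alpha> i * p i - \<kappa> + D S) \<le> r * (\<alpha> i * p i + D S)" using r \<kappa> by (intro mult_left_mono) auto
      then have "(M + 2 * \<alpha> i) * (\<Sum>b\<in>S. opened L S b) \<le> (M + 2 * \<alpha> i) * (r * (\<alpha> i * p i + D S))"
        using opened[OF R] M0 by (intro mult_left_mono) auto
      ultimately show ?thesis by (simp add: distrib_right)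
    qed
    \<comment> \<open>The product of \<open>Q\<close> and the error is replaced by \<open>L\<close>
      times the error. Although \<open>L\<close> grows like \<open>r\<close>, the result is of
      smaller order than \<open>r\<close> once the mean error tends to zero.\<close>
    also have "\<dots> \<le> ?B S"
    proof -
      have "Q S * (r * D S) \<le> L * (r * D S)" using Q0 D(2) r by (intro mult_right_mono) auto
      then show ?thesis by (simp add: algebra_simps)
    qed
    finally show "(\<Sum>b\<in>S. - (Q S)\<^sup>2 - - (Q (S - {b}))\<^sup>2) \<le> ?B S" .
    fix k assume k: "k \<in> I"
    have le: "Q (arrive \<alpha> S k) \<le> Q S" and ge: "0 \<le> Q (arrive \<alpha> S k)"
      using avail_length_arrive avail_length_nonneg by auto
    show "- (Q S)\<^sup>2 + (if k = i then ?A S else 0) - 0 - 0 \<le> - (Q (arrive \<alpha> S k))\<^sup>2"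
    proof (cases "k = i \<and> slots L S \<noteq> {}")
      case True
      then have "Q (arrive \<alpha> S k) \<le> Q S - \<alpha> i" using avail_length_fill[OF S] by auto
      then have "(Q (arrive \<alpha> S k))\<^sup>2 \<le> (Q S - \<alpha> i)\<^sup>2" using ge by (rule power_mono)
      then show ?thesis using True by (simp add: power2_diff algebra_simps)
    next
      \<comment> \<open>Without slots \<open>Q\<close> is zero and \<open>?A\<close> is negative, so
        the bound needs no decrease of \<open>Q\<close>.\<close>
      case False
      have "(Q (arrive \<alpha> S k))\<^sup>2 \<le> (Q S)\<^sup>2" using le ge by (rule power_mono)
      then show ?thesis using False avail_length_full[OF S, of L] by auto
    qed
  qed (use bdds(1,3,6) in \<open>auto intro!: bdd_intros\<close>)
  have EA: "E ?A = 2 * \<alpha> i * E Q - (\<alpha> i)\<^sup>2" using int bdds by simp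
  have EB: "E ?B = 2 * r * (\<alpha> i * p i - \<kappa>) * E Q + 2 * L * r * E D + (M + 2 * \<alpha> i) * r * (\<alpha> i * p i + E D)
      + 3 * L * E (big_length M L)"
    using int bdds by simp
  have "3 * L * E (big_length M L) \<le> 3 * L * (r * sizes_above M)"
    using big_length_expectation L0 by (intro mult_left_mono) auto
  then have "r * p i * (2 * \<alpha> i * E Q - (\<alpha> i)\<^sup>2) \<le> 2 * r * (\<alpha> i * p i - \<kappa>) * E Q + 2 * L * r * E D
      + (M + 2 * \<alpha> i) * r * (\<alpha> i * p i + E D) + 3 * L * (r * sizes_above M)"
    using main unfolding EA EB by simp
  then have "r * (2 * \<kappa> * E Q) \<le> r * (p i * (\<alpha> i)\<^sup>2 + 2 * L * E D + (M + 2 * \<alpha> i) * (\<alpha> i * p i + E D) + 3 * L * sizes_above M)"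
    by (simp add: algebra_simps)
  then show ?thesis using r by simp
qed

text \<open>The length of the queue of \<open>i\<close>-slots has negative drift whenever it is nonempty, so weighting by
  it shows that a slowly varying count cannot be concentrated on the states with slots.\<close>

lemma loose_expectation:
  "\<kappa> * E (X m) \<le> \<alpha> i * p i * E (\<lambda>S. X m S * of_bool (slots L S = {})) + N0 * E D
    + 2 * window_bound m * (N0 / r * E Q + \<alpha> i * p i + E D) + E Q"
proof -
  let ?w = "window_bound m"
  have w0: "0 \<le> ?w" using window_bound_ge[of m] by simp
  let ?A = "\<lambda>S. \<alpha> i * X m S - \<alpha> i * (X m S * of_bool (slots L S = {}))"
  let ?B = "\<lambda>S. r * (\<alpha> i * p i - \<kappa>) * X m S + r * N0 * D S + 2 * ?w * (N0 * Q S + r * (\<alpha> i * p i + D S))"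
  \<comment> \<open>In the product the drift of \<open>Q\<close> is weighted by \<open>X m\<close>,
    which leaves \<open>\<kappa> * X m\<close> except on slot-free states. A change of the factor
    \<open>X m\<close> itself costs only multiples of \<open>Q\<close> and of the opened length,
    which will be of lower order.\<close>
  have main: "r * p i * E ?A \<le> E ?B + r * E Q + r * measure_pmf.expectation type_pmf (\<lambda>_. 0)"
  proof (rule drift[OF st r type_i, where \<phi> = "\<lambda>S. - (X m S * Q S)"])
    fix S assume R: "S \<in> reachable I \<alpha>"
    then have S: "valid S" by (rule reachable_valid)
    have fin: "finite S" using validD(1)[OF S] .
    have Q0: "0 \<le> Q S" using avail_length_nonneg .
    have X0: "X m S \<le> N0" using card_loose_le[OF S L0] .
    let ?In = "{b \<in> S. fst b < L}"
    have one: "- (X m S * Q S) - - (X m (S - {b}) * Q (S - {b}))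
        \<le> (X m S + 2 * ?w) * opened L S b + (if fst b < L then 2 * ?w * Q S else 0)" if b: "b \<in> S" for b
    proof (cases "fst b < L")
      case True
      have "X m (S - {b}) * Q (S - {b}) \<le> (X m S + 2 * ?w) * Q (S - {b})"
        using loose_depart_upper[OF S b] avail_length_nonneg by (intro mult_right_mono) auto
      then show ?thesis using True by (simp add: opened_def algebra_simps)
    next
      case False
      then have "Q (S - {b}) = Q S" using opened_local[OF S b, of L] by (simp add: opened_def)
      then show ?thesis
        using False depart_local(3)[OF S b, of L] by (simp add: opened_def)
    qed
    have "(\<Sum>b\<in>S. - (X m S * Q S) - - (X m (S - {b}) * Q (S - {b})))
        \<le> (\<Sum>b\<in>S. (X m S + 2 * ?w) * opened L S b + (if fst b < L then 2 * ?w * Q S else 0))"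
      by (rule sum_mono) (rule one)
    also have "\<dots> = (X m S + 2 * ?w) * (\<Sum>b\<in>S. opened L S b) + 2 * ?w * (real (card ?In) * Q S)"
      using fin by (simp add: sum.distrib sum_distrib_left flip: sum.inter_filter)
    also have "\<dots> \<le> X m S * (r * (\<alpha> i * p i - \<kappa> + D S)) + 2 * ?w * (r * (\<alpha> i * p i + D S)) + 2 * ?w * (N0 * Q S)"
    proof -
      have "X m S * (\<Sum>b\<in>S. opened L S b) \<le> X m S * (r * (\<alpha> i * p i - \<kappa> + D S))"
        using opened[OF R] by (intro mult_left_mono) auto
      moreover have "r * (\<alpha> i * p i - \<kappa> + D S) \<le> r * (\<alpha> i * p i + D S)" using r \<kappa> by (intro mult_left_mono) auto
      then have "2 * ?w * (\<Sum>b\<in>S. opened L S b) \<le> 2 * ?w * (r * (\<alpha> i * p i + D S))"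
        using opened[OF R] w0 by (intro mult_left_mono) auto
      moreover have "2 * ?w * (real (card ?In) * Q S) \<le> 2 * ?w * (N0 * Q S)"
        using card_inside_le[OF S L0] w0 Q0 by (intro mult_left_mono mult_right_mono) auto
      ultimately show ?thesis by (simp add: distrib_right)
    qed
    also have "\<dots> \<le> ?B S"
    proof -
      have "X m S * (r * D S) \<le> N0 * (r * D S)" using X0 D(2) r by (intro mult_right_mono) auto
      then show ?thesis by (simp add: algebra_simps)
    qed
    finally show "(\<Sum>b\<in>S. - (X m S * Q S) - - (X m (S - {b}) * Q (S - {b}))) \<le> ?B S" .
    fix k assume k: "k \<in> I"
    let ?S' = "arrive \<alpha> S k"
    have le: "Q ?S' \<le> Q S" and ge: "0 \<le> Q ?S'"
      using avail_length_arrive avail_length_nonneg by auto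
    have "card (loose m x L ?S') \<le> card (insert (first_fit_position \<alpha> S k, k) (loose m x L S))"
      unfolding arrive_def using finite_loose[OF S] first_fit[OF S k] loose_place_upper[OF S k]
      by (intro card_mono) auto
    also have "\<dots> \<le> Suc (card (loose m x L S))" using finite_loose[OF S] by (simp add: card_insert_if)
    finally have "X m ?S' \<le> X m S + 1" by simp
    then have "X m ?S' * Q ?S' \<le> (X m S + 1) * Q ?S'" using ge by (intro mult_right_mono) auto
    then have *: "X m ?S' * Q ?S' \<le> X m S * Q ?S' + Q S" using le by (simp add: distrib_right)
    show "- (X m S * Q S) + (if k = i then ?A S else 0) - Q S - 0 \<le> - (X m ?S' * Q ?S')"
    proof (cases "k = i \<and> slots L S \<noteq> {}")
      case True
      then have "Q ?S' \<le> Q S - \<alpha> i" using avail_length_fill[OF S] by auto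
      then have "X m S * Q ?S' \<le> X m S * (Q S - \<alpha> i)" by (intro mult_left_mono) auto
      then show ?thesis using True * by (simp add: algebra_simps)
    next
      case False
      have "X m S * Q ?S' \<le> X m S * Q S" using le by (intro mult_left_mono) auto
      then show ?thesis using False * by auto
    qed
  qed (use bdds in \<open>auto intro!: bdd_intros\<close>)
  have EA: "E ?A = \<alpha> i * E (X m) - \<alpha> i * E (\<lambda>S. X m S * of_bool (slots L S = {}))"
    using int[OF bdds(2)[of m]] int[OF bdd_mult[OF bdds(2)[of m] bdd_of_bool, of "\<lambda>S. slots L S = {}"]] by simp
  have EB: "E ?B = r * (\<alpha> i * p i - \<kappa>) * E (X m) + r * N0 * E D + 2 * ?w * (N0 * E Q + r * (\<alpha> i * p i + E D))"
    using int bdds by simp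
  have "r * p i * (\<alpha> i * E (X m) - \<alpha> i * E (\<lambda>S. X m S * of_bool (slots L S = {})))
      \<le> r * (\<alpha> i * p i - \<kappa>) * E (X m) + r * N0 * E D + 2 * ?w * (N0 * E Q + r * (\<alpha> i * p i + E D)) + r * E Q"
    using main unfolding EA EB by simp
  then have "r * (\<kappa> * E (X m)) \<le> r * (\<alpha> i * p i * E (\<lambda>S. X m S * of_bool (slots L S = {}))
      + N0 * E D + 2 * ?w * (\<alpha> i * p i + E D) + E Q) + 2 * ?w * N0 * E Q"
    by (simp add: algebra_simps)
  also have "\<dots> = r * (\<alpha> i * p i * E (\<lambda>S. X m S * of_bool (slots L S = {})) + N0 * E D
    + 2 * ?w * (N0 / r * E Q + \<alpha> i * p i + E D) + E Q)"
  proof -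
    define q where "q = N0 / r"
    have "2 * ?w * N0 * E Q = r * (2 * ?w * (q * E Q))" using r by (simp add: q_def)
    then show ?thesis unfolding q_def[symmetric] by (simp add: distrib_left)
  qed
  finally show ?thesis using r by simp
qed

text \<open>In stationarity the gains of the potential, at rate at least \<open>p i * r\<close> in
  refill states, are balanced by its losses through departures. These are small if there are few
  loose items, few slots and few small items.\<close>

lemma refill_expectation:
  "r * p i * E (\<lambda>S. of_bool (refill m x L S)) \<le> 2 * E (X m) + (window_bound m + 1) *
    (2 / \<alpha> i * E Q + E (\<lambda>S. real (card (small_inside x L S))) + 2 + \<alpha> i / \<alpha> 1)"
proof -
  let ?n = "\<lambda>S. real (card (small_inside x L S))"
  let ?B = "\<lambda>S. 2 * X m S + (window_bound m + 1) * (2 / \<alpha> i * Q S + ?n S + 2 + \<alpha> i / \<alpha> 1)"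
  have "r * p i * E (\<lambda>S. of_bool (refill m x L S)) \<le> E ?B + r * E (\<lambda>_. 0)
      + r * measure_pmf.expectation type_pmf (\<lambda>_. 0)"
  proof (rule drift[OF st r type_i, where \<phi> = "potential m x L"])
    fix S assume R: "S \<in> reachable I \<alpha>"
    then have S: "valid S" by (rule reachable_valid)
    have "2 * real (card (slots L S)) \<le> 2 / \<alpha> i * Q S"
      using card_slots_avail_length[OF S, of L] size_i_pos by (simp add: field_simps)
    then have "(window_bound m + 1) * (2 * real (card (slots L S)) + ?n S + 2 + \<alpha> i / \<alpha> 1)
        \<le> (window_bound m + 1) * (2 / \<alpha> i * Q S + ?n S + 2 + \<alpha> i / \<alpha> 1)"
      using window_bound_ge[of m] by (intro mult_left_mono) auto
    then show "(\<Sum>b\<in>S. potential m x L S - potential m x L (S - {b})) \<le> ?B S"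
      using potential_depart_sum[OF S, of m x L] by linarith
    fix k assume k: "k \<in> I"
    show "potential m x L S + (if k = i then of_bool (refill m x L S) else 0) - 0 - 0 \<le> potential m x L (arrive \<alpha> S k)"
      using potential_place(1)[OF S k first_fit(1,2)[OF S k], of m x L] refill_gain[OF S, of m x L]
      by (auto simp: arrive_def)
  qed (use bdds in \<open>auto intro!: bdd_intros\<close>)
  moreover have "E ?B = 2 * E (X m) + (window_bound m + 1) * (2 / \<alpha> i * E Q + E ?n + 2 + \<alpha> i / \<alpha> 1)"
    using int bdds by simp
  ultimately show ?thesis by simp
qed

text \<open>Flow balance for the set of refill states: it is left at rate at most
  \<open>N0 + r\<close>, by arrivals and by departures inside \<open>[0, L)\<close>. By
  \<open>loose_Suc_refill\<close>, on slot-free states the departures leading into refill states are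
  at least as numerous as the loose items of the next level minus the small items.\<close>

lemma loose_full_expectation:
  "E (\<lambda>S. X (Suc m) S * of_bool (slots L S = {}))
    \<le> (N0 + r) * E (\<lambda>S. of_bool (refill m x L S)) + E (\<lambda>S. real (card (small_inside x L S)))"
proof -
  let ?\<phi> = "\<lambda>S. of_bool (refill m x L S) :: real"
  let ?n = "\<lambda>S. real (card (small_inside x L S))"
  let ?c = "\<lambda>S. real (card {b \<in> S. fst b < L \<and> refill m x L (S - {b})})"
  have bc: "bdd ?c" using L0 by (intro bdd_card_inside) auto
  have "r * p i * E (\<lambda>_. 0) \<le> E (\<lambda>S. N0 * ?\<phi> S - ?c S) + r * E ?\<phi>
      + r * measure_pmf.expectation type_pmf (\<lambda>_. 0)"
  proof (rule drift[OF st r type_i, where \<phi> = ?\<phi>])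
    fix S assume R: "S \<in> reachable I \<alpha>"
    then have S: "valid S" by (rule reachable_valid)
    have fin: "finite S" using validD(1)[OF S] .
    let ?In = "{b \<in> S. fst b < L}"
    have "(\<Sum>b\<in>S. ?\<phi> S - ?\<phi> (S - {b})) = (\<Sum>b\<in>S. if fst b < L then ?\<phi> S - ?\<phi> (S - {b}) else 0)"
      using refill_local[OF S] by (intro sum.cong) auto
    also have "\<dots> = (\<Sum>b\<in>?In. ?\<phi> S - ?\<phi> (S - {b}))" using fin by (simp add: sum.inter_filter)
    also have "\<dots> = real (card ?In) * ?\<phi> S - ?c S"
    proof -
      have "?In \<inter> {b. refill m x L (S - {b})} = {b \<in> S. fst b < L \<and> refill m x L (S - {b})}" by auto
      then show ?thesis using fin by (simp add: sum_subtractf)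
    qed
    also have "\<dots> \<le> N0 * ?\<phi> S - ?c S" using card_inside_le[OF S L0] by (auto simp: of_bool_def)
    finally show "(\<Sum>b\<in>S. ?\<phi> S - ?\<phi> (S - {b})) \<le> N0 * ?\<phi> S - ?c S" .
  qed (use bc in \<open>auto intro!: bdd_intros\<close>)
  then have "E ?c \<le> (N0 + r) * E ?\<phi>"
    using int[OF bc] int[OF bdd_of_bool, of "refill m x L"] by (simp add: algebra_simps)
  moreover have "E (\<lambda>S. X (Suc m) S * of_bool (slots L S = {})) \<le> E (\<lambda>S. ?c S + ?n S)"
  proof (rule expectation_mono[OF st])
    fix S assume "S \<in> reachable I \<alpha>"
    then have S: "valid S" by (rule reachable_valid)
    show "X (Suc m) S * of_bool (slots L S = {}) \<le> ?c S + ?n S"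
      using loose_Suc_refill[OF S, of L m x] by (auto simp flip: of_nat_add)
  qed (use bc bdds in \<open>auto intro!: bdd_intros\<close>)
  moreover have "E (\<lambda>S. ?c S + ?n S) = E ?c + E ?n" using int bc bdds by simp
  ultimately show ?thesis by linarith
qed

end

end

section \<open>The limit\<close>

lemma tendsto_0_squeeze:
  fixes f g :: "real \<Rightarrow> real"
  assumes "\<forall>\<^sub>F r in at_top. 0 \<le> f r" "\<forall>\<^sub>F r in at_top. f r \<le> g r" "(g \<longlongrightarrow> 0) at_top"
  shows "(f \<longlongrightarrow> 0) at_top"
  using tendsto_sandwich[OF assms(1,2) tendsto_const assms(3)] .

lemma const_over_tendsto_0: "((\<lambda>r::real. c / r) \<longlongrightarrow> 0) at_top" for c :: real
  by (rule tendsto_divide_0[OF tendsto_const filterlim_at_top_imp_at_infinity[OF filterlim_ident]])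

text \<open>Bounded convergence. The drift inequalities deal with expectations, so the hypotheses
  are first turned into convergence in mean.\<close>

lemma converges_in_prob_expectation:
  assumes conv: "converges_in_prob \<pi> X c"
    and bound: "\<forall>\<^sub>F r in at_top. \<forall>S\<in>set_pmf (\<pi> r). \<bar>X r S - c\<bar> \<le> B"
  shows "((\<lambda>r. measure_pmf.expectation (\<pi> r) (\<lambda>S. \<bar>X r S - c\<bar>)) \<longlongrightarrow> 0) at_top"
proof (rule tendstoI)
  fix e :: real assume e: "0 < e"
  define B' where "B' = max B 1"
  have "((\<lambda>r. measure_pmf.prob (\<pi> r) {S. \<bar>X r S - c\<bar> > e / 2}) \<longlongrightarrow> 0) at_top"
    using conv half_gt_zero[OF e] unfolding converges_in_prob_def by blast
  then have "\<forall>\<^sub>F r in at_top. measure_pmf.prob (\<pi> r) {S. \<bar>X r S - c\<bar> > e / 2} < e / (2 * B')"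
    using e by (intro order_tendstoD(2)) (auto simp: B'_def)
  with bound show "\<forall>\<^sub>F r in at_top. dist (measure_pmf.expectation (\<pi> r) (\<lambda>S. \<bar>X r S - c\<bar>)) 0 < e"
  proof eventually_elim
    case (elim r)
    let ?A = "{S. \<bar>X r S - c\<bar> > e / 2}"
    have "measure_pmf.expectation (\<pi> r) (\<lambda>S. \<bar>X r S - c\<bar>)
        \<le> measure_pmf.expectation (\<pi> r) (\<lambda>S. e / 2 + B' * indicator ?A S)"
    proof (rule integral_mono_AE)
      show "integrable (measure_pmf (\<pi> r)) (\<lambda>S. \<bar>X r S - c\<bar>)"
        using elim(1) by (intro measure_pmf.integrable_const_bound[where B = B]) (auto simp: AE_measure_pmf_iff)
      show "AE S in measure_pmf (\<pi> r). \<bar>X r S - c\<bar> \<le> e / 2 + B' * indicator ?A S"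
        using elim(1) e unfolding AE_measure_pmf_iff B'_def by (fastforce simp: indicator_def)
      show "integrable (measure_pmf (\<pi> r)) (\<lambda>S. e / 2 + B' * indicator ?A S)"
        by (rule measure_pmf.integrable_const_bound[where B = "e / 2 + B'"]) (use e in \<open>auto simp: B'_def indicator_def\<close>)
    qed
    also have "\<dots> = e / 2 + B' * measure_pmf.prob (\<pi> r) ?A" by (simp add: measure_pmf.emeasure_eq_measure)
    also have "B' * measure_pmf.prob (\<pi> r) ?A < B' * (e / (2 * B'))"
      using elim(2) by (intro mult_strict_left_mono) (auto simp: B'_def)
    also have "B' * (e / (2 * B')) = e / 2" by (simp add: B'_def)
    finally show ?case by simp
  qed
qed

lemma expectation_converges_in_prob:
  assumes lim: "((\<lambda>r. measure_pmf.expectation (\<pi> r) (\<lambda>S. \<bar>X r S - c\<bar>)) \<longlongrightarrow> 0) at_top"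
    and int: "\<forall>\<^sub>F r in at_top. integrable (measure_pmf (\<pi> r)) (\<lambda>S. \<bar>X r S - c\<bar>)"
  shows "converges_in_prob \<pi> X c"
  unfolding converges_in_prob_def
proof (intro allI impI)
  fix \<delta> :: real assume \<delta>: "0 < \<delta>"
  show "((\<lambda>r. measure_pmf.prob (\<pi> r) {S. \<bar>X r S - c\<bar> > \<delta>}) \<longlongrightarrow> 0) at_top"
  proof (rule tendsto_0_squeeze)
    show "\<forall>\<^sub>F r in at_top. 0 \<le> measure_pmf.prob (\<pi> r) {S. \<bar>X r S - c\<bar> > \<delta>}" by simp
    show "\<forall>\<^sub>F r in at_top. measure_pmf.prob (\<pi> r) {S. \<bar>X r S - c\<bar> > \<delta>}
        \<le> measure_pmf.expectation (\<pi> r) (\<lambda>S. \<bar>X r S - c\<bar>) / \<delta>"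
      using int
    proof eventually_elim
      case (elim r)
      have "measure_pmf.prob (\<pi> r) {S. \<bar>X r S - c\<bar> > \<delta>} \<le> measure_pmf.prob (\<pi> r) {S \<in> space (measure_pmf (\<pi> r)). \<bar>X r S - c\<bar> \<ge> \<delta>}"
        by (intro measure_pmf.finite_measure_mono) auto
      also have "\<dots> \<le> measure_pmf.expectation (\<pi> r) (\<lambda>S. \<bar>X r S - c\<bar>) / \<delta>"
        using elim \<delta> by (intro integral_Markov_inequality_measure[where A = "{}"]) auto
      finally show ?case .
    qed
    show "((\<lambda>r. measure_pmf.expectation (\<pi> r) (\<lambda>S. \<bar>X r S - c\<bar>) / \<delta>) \<longlongrightarrow> 0) at_top"
      using tendsto_divide[OF lim tendsto_const, of \<delta>] \<delta> by simp
  qed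
qed

section \<open>The hypotheses at scale \<open>r\<close>\<close>

locale first_fit_limit = first_fit_type +
  fixes \<pi> :: "real \<Rightarrow> config pmf" and y :: real
  assumes stationary: "0 < r \<Longrightarrow> stationary_distribution I \<alpha> p r (\<pi> r)"
    and smaller: "j \<in> I \<Longrightarrow> j < i \<Longrightarrow>
      converges_in_prob \<pi> (\<lambda>r S. 1 / r * real (F \<alpha> j (r * \<beta> \<alpha> p j) S)) (p j)"
    and y_range: "y \<in> {\<beta> \<alpha> p (i - 1)..<\<beta> \<alpha> p i}"
    and up_to_y: "converges_in_prob \<pi> (\<lambda>r S. 1 / r * real (F \<alpha> i (r * y) S)) ((y - \<beta> \<alpha> p (i - 1)) / \<alpha> i)"
begin

text \<open>Puts the hypotheses on the types below \<open>i\<close> and the one on type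
  \<open>i\<close> into one form: about \<open>r * density j\<close> items of type \<open>j\<close>
  lie below \<open>r * level j\<close>.\<close>

definition level :: "nat \<Rightarrow> real" where
  "level j = (if j < i then \<beta> \<alpha> p j else y)"

definition density :: "nat \<Rightarrow> real" where
  "density j = (if j < i then p j else (y - \<beta> \<alpha> p (i - 1)) / \<alpha> i)"

definition deviation :: "real \<Rightarrow> config \<Rightarrow> real" where
  "deviation r S = (\<Sum>j=1..i. \<alpha> j * \<bar>1 / r * real (F \<alpha> j (r * level j) S) - density j\<bar>)"

text \<open>With \<open>step\<close> as the \<open>\<epsilon>\<close> of the theorem, the departures beyond \<open>r y\<close> consume half of the
  excess of \<open>i\<close>-arrivals over the departures of \<open>i\<close>-items below \<open>r y\<close>.\<close>

definition drift_gap :: real where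
  "drift_gap = (\<alpha> i * p i - (y - \<beta> \<alpha> p (i - 1))) / 2"

definition step :: real where
  "step = drift_gap / spare_bound"

definition horizon :: "real \<Rightarrow> real" where
  "horizon r = r * (y + step)"

abbreviation "mean r \<equiv> measure_pmf.expectation (\<pi> r)"

lemma i_ge_1: "1 \<le> i"
  using type_i type_ge_1 by simp

lemma types_below: "j \<in> {1..i} \<Longrightarrow> j \<in> I"
  using type_down[OF type_i] by simp

lemma \<beta>_i: "\<beta> \<alpha> p i = \<beta> \<alpha> p (i - 1) + \<alpha> i * p i"
proof -
  obtain n where "i = Suc n" using i_ge_1 by (cases i) auto
  then show ?thesis by (simp add: \<beta>_def)
qed

lemma \<beta>_nonneg: "j \<le> i \<Longrightarrow> 0 \<le> \<beta> \<alpha> p j"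
  unfolding \<beta>_def using size_pos[OF types_below] prob_pos[OF types_below]
  by (intro sum_nonneg mult_nonneg_nonneg) (auto intro: less_imp_le)

lemma \<beta>_mono: "j \<le> k \<Longrightarrow> k \<le> i \<Longrightarrow> \<beta> \<alpha> p j \<le> \<beta> \<alpha> p k"
  unfolding \<beta>_def using size_pos[OF types_below] prob_pos[OF types_below]
  by (intro sum_mono2 mult_nonneg_nonneg) (auto intro: less_imp_le)

lemma y_nonneg: "0 \<le> y"
  using y_range \<beta>_nonneg[of "i - 1"] by simp

lemma level: "0 \<le> level j" "level j \<le> y"
proof -
  have "\<beta> \<alpha> p j \<le> y" if "j < i" proof -
    have "j \<le> i - 1" using that by linarith
    then have "\<beta> \<alpha> p j \<le> \<beta> \<alpha> p (i - 1)" by (rule \<beta>_mono) simp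
    then show ?thesis using y_range by simp
  qed
  then show "0 \<le> level j" "level j \<le> y" using y_nonneg \<beta>_nonneg[of j] by (auto simp: level_def)
qed

lemma drift_gap_pos: "0 < drift_gap"
  using y_range \<beta>_i by (simp add: drift_gap_def)

lemma step_pos: "0 < step"
  using drift_gap_pos spare_bound_ge by (simp add: step_def)

text \<open>The items described by the hypotheses all lie below \<open>r * y\<close> and have total
  length about \<open>r * y\<close>, so they leave almost no room there.\<close>

lemma sum_density: "(\<Sum>j=1..i. \<alpha> j * density j) = y"
proof -
  have "{1..i} = insert i {1..i - 1}" using i_ge_1 by auto
  then have "(\<Sum>j=1..i. \<alpha> j * density j) = \<alpha> i * density i + (\<Sum>j=1..i - 1. \<alpha> j * density j)"
    using i_ge_1 by simp
  also have "(\<Sum>j=1..i - 1. \<alpha> j * density j) = \<beta> \<alpha> p (i - 1)"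
    unfolding \<beta>_def by (intro sum.cong) (auto simp: density_def)
  finally show ?thesis using size_i_pos by (simp add: density_def)
qed

lemma F_le:
  assumes "S \<in> reachable I \<alpha>" "0 \<le> z"
  shows "real (F \<alpha> j z S) \<le> z / \<alpha> 1 + 1"
proof -
  have S: "valid S" using assms(1) by (rule reachable_valid)
  have "card {a \<in> S. snd a = j \<and> right_end a \<le> z} \<le> card {a \<in> S. fst a < z}"
    using validD(1,5)[OF S] by (intro card_mono) (auto intro: less_le_trans)
  then show ?thesis using card_inside_le[OF S assms(2)] by (simp add: F_valid[OF S])
qed

lemma bdd_F: "0 \<le> z \<Longrightarrow> bdd (\<lambda>S. real (F \<alpha> j z S))"
  using F_le by (intro bddI[of _ "z / \<alpha> 1 + 1"]) simp

lemma bdd_abs: "bdd f \<Longrightarrow> bdd (\<lambda>S. \<bar>f S\<bar>)"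
  by (simp add: bdd_def)

lemma deviation_nonneg: "0 \<le> deviation r S"
  unfolding deviation_def using size_pos[OF types_below]
  by (intro sum_nonneg mult_nonneg_nonneg) (auto intro: less_imp_le)

lemma bdd_deviation: "0 < r \<Longrightarrow> bdd (deviation r)"
  unfolding deviation_def using level(1) by (intro bdd_intros bdd_abs bdd_F) auto

lemma count_tendsto:
  assumes j: "j \<in> {1..i}"
  shows "((\<lambda>r. mean r (\<lambda>S. \<bar>1 / r * real (F \<alpha> j (r * level j) S) - density j\<bar>)) \<longlongrightarrow> 0) at_top"
proof (rule converges_in_prob_expectation)
  show "converges_in_prob \<pi> (\<lambda>r S. 1 / r * real (F \<alpha> j (r * level j) S)) (density j)"
    using smaller[OF types_below[OF j]] up_to_y j by (cases "j < i") (auto simp: level_def density_def)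
  show "\<forall>\<^sub>F r in at_top. \<forall>S\<in>set_pmf (\<pi> r). \<bar>1 / r * real (F \<alpha> j (r * level j) S) - density j\<bar>
      \<le> level j / \<alpha> 1 + 1 + \<bar>density j\<bar>"
    using eventually_ge_at_top[of 1]
  proof eventually_elim
    case (elim r)
    show ?case
    proof
      fix S assume "S \<in> set_pmf (\<pi> r)"
      then have S: "S \<in> reachable I \<alpha>"
        using stationary[of r] elim by (auto simp: stationary_distribution_def)
      have "real (F \<alpha> j (r * level j) S) \<le> r * level j / \<alpha> 1 + 1"
        using elim level(1) by (intro F_le[OF S]) auto
      also have "\<dots> \<le> r * (level j / \<alpha> 1 + 1)" using elim by (simp add: distrib_left)
      finally have "1 / r * real (F \<alpha> j (r * level j) S) \<le> level j / \<alpha> 1 + 1"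
        using elim by (simp add: pos_divide_le_eq mult.commute)
      moreover have "0 \<le> 1 / r * real (F \<alpha> j (r * level j) S)" using elim by simp
      ultimately show "\<bar>1 / r * real (F \<alpha> j (r * level j) S) - density j\<bar> \<le> level j / \<alpha> 1 + 1 + \<bar>density j\<bar>"
        by linarith
    qed
  qed
qed

lemma bdd_count: "0 < r \<Longrightarrow> bdd (\<lambda>S. \<bar>1 / r * real (F \<alpha> j (r * level j) S) - density j\<bar>)"
  using level(1) by (intro bdd_intros bdd_abs bdd_F) auto

lemma deviation_tendsto: "((\<lambda>r. mean r (deviation r)) \<longlongrightarrow> 0) at_top"
proof -
  have "((\<lambda>r. \<Sum>j=1..i. \<alpha> j * mean r (\<lambda>S. \<bar>1 / r * real (F \<alpha> j (r * level j) S) - density j\<bar>))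
      \<longlongrightarrow> (\<Sum>j=1..i. \<alpha> j * 0)) at_top"
    by (intro tendsto_intros count_tendsto)
  moreover have "\<forall>\<^sub>F r in at_top. (\<Sum>j=1..i. \<alpha> j * mean r (\<lambda>S. \<bar>1 / r * real (F \<alpha> j (r * level j) S) - density j\<bar>))
      = mean r (deviation r)"
    using eventually_gt_at_top[of 0]
  proof eventually_elim
    case (elim r)
    have "integrable (measure_pmf (\<pi> r)) (\<lambda>S. \<alpha> j * \<bar>1 / r * real (F \<alpha> j (r * level j) S) - density j\<bar>)" for j
      by (rule integrable_bdd[OF stationary[OF elim] bdd_mult[OF bdd_const bdd_count[OF elim]]])
    then show ?case unfolding deviation_def by (simp add: Bochner_Integration.integral_sum)
  qed
  ultimately show ?thesis by (simp add: filterlim_cong)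
qed

lemma sum_count_ge: "(\<Sum>j=1..i. \<alpha> j * real (F \<alpha> j (r * level j) S)) \<ge> r * (y - deviation r S)" if "0 < r"
proof -
  have "\<alpha> j * real (F \<alpha> j (r * level j) S) \<ge> r * (\<alpha> j * density j - \<alpha> j * \<bar>1 / r * real (F \<alpha> j (r * level j) S) - density j\<bar>)"
    if j: "j \<in> {1..i}" for j
  proof -
    let ?q = "1 / r * real (F \<alpha> j (r * level j) S)"
    have "\<alpha> j * density j - \<alpha> j * \<bar>?q - density j\<bar> \<le> \<alpha> j * ?q"
      using size_pos[OF types_below[OF j]] mult_left_mono[of "density j - \<bar>?q - density j\<bar>" ?q "\<alpha> j"]
      by (simp add: right_diff_distrib)
    then have "r * (\<alpha> j * density j - \<alpha> j * \<bar>?q - density j\<bar>) \<le> r * (\<alpha> j * ?q)"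
      using \<open>0 < r\<close> by (intro mult_left_mono) auto
    then show ?thesis using \<open>0 < r\<close> by simp
  qed
  then have "(\<Sum>j=1..i. r * (\<alpha> j * density j - \<alpha> j * \<bar>1 / r * real (F \<alpha> j (r * level j) S) - density j\<bar>))
      \<le> (\<Sum>j=1..i. \<alpha> j * real (F \<alpha> j (r * level j) S))"
    by (rule sum_mono)
  moreover have "(\<Sum>j=1..i. r * (\<alpha> j * density j - \<alpha> j * \<bar>1 / r * real (F \<alpha> j (r * level j) S) - density j\<bar>))
      = r * (y - deviation r S)"
    unfolding sum_distrib_left[symmetric] sum_subtractf sum_density deviation_def ..
  ultimately show ?thesis by simp
qed

lemma horizon: "0 < r \<Longrightarrow> 0 \<le> r * y" "0 < r \<Longrightarrow> r * y \<le> horizon r" "0 < r \<Longrightarrow> 0 < horizon r"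
  "0 < r \<Longrightarrow> r * level j \<le> horizon r"
proof -
  show "0 < r \<Longrightarrow> 0 \<le> r * y" using y_nonneg by simp
  show "0 < r \<Longrightarrow> r * y \<le> horizon r" using step_pos by (simp add: horizon_def)
  show "0 < r \<Longrightarrow> 0 < horizon r" using step_pos y_nonneg by (simp add: horizon_def)
  show "0 < r \<Longrightarrow> r * level j \<le> horizon r"
    using step_pos level(2)[of j] unfolding horizon_def by (intro mult_left_mono) auto
qed

lemma deviation_i: "\<alpha> i * \<bar>1 / r * real (F \<alpha> i (r * y) S) - density i\<bar> \<le> deviation r S"
  unfolding deviation_def
  using member_le_sum[of i "{1..i}" "\<lambda>j. \<alpha> j * \<bar>1 / r * real (F \<alpha> j (r * level j) S) - density j\<bar>"]
    i_ge_1 size_pos[OF types_below] by (auto simp: level_def less_imp_le)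

lemma F_y_le:
  assumes r: "0 < r"
  shows "\<alpha> i * real (F \<alpha> i (r * y) S) \<le> r * (\<alpha> i * density i + deviation r S)"
proof -
  let ?q = "1 / r * real (F \<alpha> i (r * y) S)"
  have "\<alpha> i * ?q \<le> \<alpha> i * density i + \<alpha> i * \<bar>?q - density i\<bar>"
    using mult_left_mono[of ?q "density i + \<bar>?q - density i\<bar>" "\<alpha> i"] size_i_pos by (simp add: distrib_left)
  then have "r * (\<alpha> i * ?q) \<le> r * (\<alpha> i * density i + deviation r S)"
    using deviation_i[of r S] r by (intro mult_left_mono) auto
  then show ?thesis using r by simp
qed

lemma opened_sum_limit:
  assumes r: "0 < r" and R: "S \<in> reachable I \<alpha>"
  shows "(\<Sum>b\<in>S. opened (horizon r) S b)
    \<le> r * (\<alpha> i * p i - drift_gap + (1 + spare_bound) * deviation r S)"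
proof -
  have S: "valid S" using R by (rule reachable_valid)
  let ?v = "\<lambda>j. r * level j"
  have L: "0 \<le> horizon r" using horizon(3)[OF r] by simp
  have "spare (horizon r) ?v S \<le> horizon r - r * (y - deviation r S)"
    using sum_count_ge[OF r, of S] by (simp add: spare_F[OF S])
  also have "\<dots> = r * (step + deviation r S)" by (simp add: horizon_def algebra_simps)
  finally have "spare_bound * spare (horizon r) ?v S \<le> spare_bound * (r * (step + deviation r S))"
    using spare_bound_ge by (intro mult_left_mono) auto
  moreover have "\<alpha> i * real (card {b \<in> packed ?v S. snd b = i}) \<le> r * (y - \<beta> \<alpha> p (i - 1) + deviation r S)"
  proof -
    have "\<alpha> i * density i = y - \<beta> \<alpha> p (i - 1)" using size_i_pos by (simp add: density_def)
    then show ?thesis using F_y_le[OF r, of S] packed_type[OF S order_refl, of ?v] by (simp add: level_def)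
  qed
  \<comment> \<open>The choice of \<open>step\<close> enters here: \<open>spare_bound * step\<close>
    is \<open>drift_gap\<close>, half of the excess
    \<open>\<alpha> i * p i - (y - \<beta> \<alpha> p (i - 1))\<close>.\<close>
  moreover have "y - \<beta> \<alpha> p (i - 1) + spare_bound * step = \<alpha> i * p i - drift_gap"
    using spare_bound_ge by (simp add: step_def drift_gap_def field_simps)
  then have "r * (y - \<beta> \<alpha> p (i - 1) + deviation r S) + spare_bound * (r * (step + deviation r S))
      = r * (\<alpha> i * p i - drift_gap + (1 + spare_bound) * deviation r S)"
    unfolding \<open>_ = \<alpha> i * p i - drift_gap\<close>[symmetric] by (simp add: algebra_simps)
  ultimately show ?thesis
    using opened_sum[OF S L, of ?v, OF horizon(4)[OF r]] by linarith
qed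

definition error :: "real \<Rightarrow> config \<Rightarrow> real" where
  "error r S = (1 + spare_bound) * deviation r S"

abbreviation "small_count r S \<equiv> real (card (small_inside (r * y) (horizon r) S))"
abbreviation "loose_count m r S \<equiv> real (card (loose m (r * y) (horizon r) S))"

lemma eventually_large: "\<forall>\<^sub>F r in at_top. 1 \<le> r \<and> \<alpha> i \<le> horizon r"
  using eventually_ge_at_top[of 1] eventually_ge_at_top[of "\<alpha> i / (y + step)"]
proof eventually_elim
  case (elim r)
  have "0 < y + step" using y_nonneg step_pos by simp
  then have "\<alpha> i \<le> r * (y + step)" using elim(2) by (simp add: pos_divide_le_eq)
  then show ?case using elim(1) by (simp add: horizon_def)
qed

lemma error_tendsto: "((\<lambda>r. mean r (error r)) \<longlongrightarrow> 0) at_top"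
  using tendsto_mult[OF tendsto_const deviation_tendsto, of "1 + spare_bound"] by (simp add: error_def[abs_def])

lemma error: "0 < r \<Longrightarrow> bdd (error r)" "0 \<le> error r S"
  using bdd_deviation deviation_nonneg[of r S] spare_bound_ge
  by (auto simp: error_def[abs_def] intro!: bdd_intros)

lemma mean_nonneg:
  fixes f :: "config \<Rightarrow> real"
  assumes "\<And>S. 0 \<le> f S"
  shows "0 \<le> mean r f"
  using assms by (intro integral_nonneg_AE AE_I2)

text \<open>By Little's law the mean number of items of type \<open>j\<close> before the horizon is
  at most \<open>r * p j\<close>. Nearly as many are found below
  \<open>r * \<beta> \<alpha> p j\<close>, which is at most \<open>r * y\<close>, so few can start
  beyond \<open>r * y\<close>.\<close>

lemma small_tendsto: "((\<lambda>r. mean r (small_count r) / r) \<longlongrightarrow> 0) at_top"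
proof (rule tendsto_0_squeeze)
  show "\<forall>\<^sub>F r in at_top. 0 \<le> mean r (small_count r) / r"
    using eventually_gt_at_top[of 0] by eventually_elim (simp add: mean_nonneg)
  let ?c = "\<lambda>r j S. \<bar>1 / r * real (F \<alpha> j (r * level j) S) - density j\<bar>"
  have "((\<lambda>r. \<Sum>j=1..i - 1. mean r (?c r j)) \<longlongrightarrow> (\<Sum>j=1..i - 1. 0)) at_top"
    by (intro tendsto_sum count_tendsto) auto
  then show "((\<lambda>r. \<Sum>j=1..i - 1. mean r (?c r j)) \<longlongrightarrow> 0) at_top" by simp
  show "\<forall>\<^sub>F r in at_top. mean r (small_count r) / r \<le> (\<Sum>j=1..i - 1. mean r (?c r j))"
    using eventually_gt_at_top[of 0]
  proof eventually_elim
    case (elim r)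
    let ?L = "horizon r" and ?x = "r * y"
    let ?N = "\<lambda>j S. \<Sum>b\<in>{b \<in> S. fst b < ?L}. of_bool (snd b = j) :: real"
    note st = stationary[OF elim]
    have L: "0 \<le> ?L" using horizon(3)[OF elim] by simp
    have int_type: "integrable (measure_pmf type_pmf) (\<lambda>k. of_bool (k = j) :: real)" for j
      by (rule measure_pmf.integrable_const_bound[where B = 1]) auto
    have N: "mean r (?N j) \<le> r * p j" "bdd (?N j)" if "j \<in> {1..i - 1}" for j
    proof -
      have j: "j \<in> I" using types_below that by auto
      have "(\<lambda>k. of_bool (k = j) :: real) = indicator {j}" by (auto simp: indicator_def)
      then have "measure_pmf.expectation type_pmf (\<lambda>k. of_bool (k = j)) = p j"
        using j measure_pmf_single[of type_pmf j] by (simp add: pmf_type)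
      then show "mean r (?N j) \<le> r * p j" "bdd (?N j)"
        using sum_inside_expectation_le[OF st elim L, of "\<lambda>k. of_bool (k = j)" 1, OF _ _ int_type[of j]]
        by auto
    qed
    have pt: "small_count r S \<le> (\<Sum>j=1..i - 1. ?N j S - real (F \<alpha> j (r * level j) S))"
      if R: "S \<in> reachable I \<alpha>" for S
    proof -
      have S: "valid S" using R by (rule reachable_valid)
      have fin: "finite S" using validD(1)[OF S] .
      let ?M = "\<lambda>j. {b \<in> S. snd b = j \<and> ?x \<le> fst b \<and> fst b < ?L}"
      have "small_inside ?x ?L S \<subseteq> (\<Union>j\<in>{1..i - 1}. ?M j)"
        using type_ge_1[OF validD(3)[OF S]] by (fastforce simp: small_inside_def)
      then have "card (small_inside ?x ?L S) \<le> card (\<Union>j\<in>{1..i - 1}. ?M j)"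
        using fin by (intro card_mono) auto
      also have "\<dots> \<le> (\<Sum>j=1..i - 1. card (?M j))" by (rule card_UN_le) simp
      finally have "small_count r S \<le> (\<Sum>j=1..i - 1. real (card (?M j)))" by (simp flip: of_nat_sum)
      also have "\<dots> \<le> (\<Sum>j=1..i - 1. ?N j S - real (F \<alpha> j (r * level j) S))"
      proof (rule sum_mono)
        fix j assume "j \<in> {1..i - 1}"
        let ?G = "{a \<in> S. snd a = j \<and> right_end a \<le> r * level j}"
        have lx: "r * level j \<le> ?x" using level(2)[of j] elim by (intro mult_left_mono) auto
        have less: "fst a < ?x" if "a \<in> ?G" for a
          using that validD(5)[OF S, of a] lx by auto
        then have "?M j \<inter> ?G = {}" by force
        then have "card (?M j) + card ?G = card (?M j \<union> ?G)" using fin by (subst card_Un_disjoint) auto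
        also have "\<dots> \<le> card ({b \<in> S. fst b < ?L} \<inter> {b. snd b = j})"
          using fin less horizon(2)[OF elim] by (intro card_mono) (auto intro: less_le_trans)
        finally have "real (card (?M j)) + real (card ?G) \<le> ?N j S" using fin by simp
        then show "real (card (?M j)) \<le> ?N j S - real (F \<alpha> j (r * level j) S)" by (simp add: F_valid[OF S])
      qed
      finally show ?thesis .
    qed
    have bF: "bdd (\<lambda>S. real (F \<alpha> j (r * level j) S))" for j using elim level(1) by (intro bdd_F) auto
    have "mean r (small_count r) \<le> mean r (\<lambda>S. \<Sum>j=1..i - 1. ?N j S - real (F \<alpha> j (r * level j) S))"
      using pt L N(2) bF by (intro expectation_mono[OF st] bdd_sum bdd_diff bdd_small_inside) auto
    also have "\<dots> = (\<Sum>j=1..i - 1. mean r (?N j) - mean r (\<lambda>S. real (F \<alpha> j (r * level j) S)))"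
      using integrable_bdd[OF st N(2)] integrable_bdd[OF st bF]
      by (subst Bochner_Integration.integral_sum) (auto intro!: sum.cong Bochner_Integration.integral_diff)
    also have "\<dots> \<le> (\<Sum>j=1..i - 1. r * mean r (?c r j))"
    proof (rule sum_mono)
      fix j assume j: "j \<in> {1..i - 1}"
      have d: "density j = p j" using j by (auto simp: density_def)
      have "mean r (\<lambda>S. r * p j - real (F \<alpha> j (r * level j) S)) \<le> mean r (\<lambda>S. r * ?c r j S)"
      proof (rule expectation_mono[OF st])
        show "r * p j - real (F \<alpha> j (r * level j) S) \<le> r * ?c r j S" for S
        proof -
          let ?f = "real (F \<alpha> j (r * level j) S)"
          have "p j - 1 / r * ?f \<le> ?c r j S" unfolding d by linarith
          then have "r * (p j - 1 / r * ?f) \<le> r * ?c r j S" using elim by (intro mult_left_mono) auto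
          then show ?thesis using elim by (simp add: right_diff_distrib)
        qed
      qed (use bF elim bdd_count in \<open>auto intro!: bdd_intros\<close>)
      then show "mean r (?N j) - mean r (\<lambda>S. real (F \<alpha> j (r * level j) S)) \<le> r * mean r (?c r j)"
        using N(1)[OF j] integrable_bdd[OF st bF[of j]] by simp
    qed
    also have "\<dots> = r * (\<Sum>j=1..i - 1. mean r (?c r j))" by (simp add: sum_distrib_left)
    finally show ?case using elim by (simp add: pos_divide_le_eq mult.commute)
  qed
qed

text \<open>Supplies, in their order, the hypotheses of the bounds at a fixed scale, for the region
  from \<open>r * y\<close> to \<open>horizon r\<close>.\<close>

lemma single_scale:
  assumes "1 \<le> r \<and> \<alpha> i \<le> horizon r"
  shows "stationary_distribution I \<alpha> p r (\<pi> r)" "0 < r" "0 \<le> r * y" "\<alpha> i \<le> horizon r" "0 < drift_gap"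
    "bdd (error r)" "\<And>S. 0 \<le> error r S"
    "\<And>S. S \<in> reachable I \<alpha> \<Longrightarrow>
      (\<Sum>b\<in>S. opened (horizon r) S b) \<le> r * (\<alpha> i * p i - drift_gap + error r S)"
proof -
  show r: "0 < r" using assms by simp
  show "stationary_distribution I \<alpha> p r (\<pi> r)" using r by (rule stationary)
  show "(\<Sum>b\<in>S. opened (horizon r) S b) \<le> r * (\<alpha> i * p i - drift_gap + error r S)"
    if "S \<in> reachable I \<alpha>" for S
    using opened_sum_limit[OF r that] by (simp add: error_def)
qed (use assms horizon(1)[of r] drift_gap_pos error in auto)

text \<open>The contribution of long items is a multiple of \<open>sizes_above M\<close> that does
  not vanish with \<open>r\<close>. So \<open>M\<close> is chosen first, and for this fixed
  \<open>M\<close> all other terms vanish after division by \<open>r\<close>.\<close>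

lemma avail_tendsto: "((\<lambda>r. mean r (avail_length (horizon r)) / r) \<longlongrightarrow> 0) at_top"
proof (rule tendstoI)
  fix e :: real assume e: "0 < e"
  define \<kappa> where "\<kappa> = drift_gap"
  have \<kappa>: "0 < \<kappa>" using drift_gap_pos by (simp add: \<kappa>_def)
  let ?Y = "y + step"
  have Y: "0 < ?Y" using y_nonneg step_pos by simp
  have "((\<lambda>M. 3 * ?Y * sizes_above M / (2 * \<kappa>)) \<longlongrightarrow> 3 * ?Y * 0 / (2 * \<kappa>)) at_top"
    using \<kappa> by (intro tendsto_intros sizes_above_tendsto) auto
  then have "\<forall>\<^sub>F M in at_top. 3 * ?Y * sizes_above M / (2 * \<kappa>) < e / 2"
    using e by (intro order_tendstoD(2)) auto
  then obtain M where M: "3 * ?Y * sizes_above M / (2 * \<kappa>) < e / 2" "\<alpha> i \<le> M"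
    using eventually_happens[OF eventually_conj[OF _ eventually_ge_at_top[of "\<alpha> i"]]] by auto
  let ?h = "\<lambda>r. (p i * (\<alpha> i)\<^sup>2 / r + 2 * ?Y * mean r (error r)
      + (M + 2 * \<alpha> i) * (\<alpha> i * p i / r + mean r (error r) * (1 / r))) / (2 * \<kappa>)"
  have "(?h \<longlongrightarrow> (0 + 2 * ?Y * 0 + (M + 2 * \<alpha> i) * (0 + 0 * 0)) / (2 * \<kappa>)) at_top"
    using \<kappa> by (intro tendsto_intros error_tendsto const_over_tendsto_0) auto
  then have "\<forall>\<^sub>F r in at_top. ?h r < e / 2" using e by (intro order_tendstoD(2)) auto
  with eventually_large show "\<forall>\<^sub>F r in at_top. dist (mean r (avail_length (horizon r)) / r) 0 < e"
  proof eventually_elim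
    case (elim r)
    note sc = single_scale[OF elim(1)]
    have r: "0 < r" using sc(2) .
    let ?Q = "mean r (avail_length (horizon r))" and ?D = "mean r (error r)"
    have "2 * \<kappa> * ?Q \<le> p i * (\<alpha> i)\<^sup>2 + 2 * horizon r * ?D + (M + 2 * \<alpha> i) * (\<alpha> i * p i + ?D) + 3 * horizon r * sizes_above M"
      unfolding \<kappa>_def by (rule avail_expectation[OF sc M(2)])
    then have "?Q / r \<le> (p i * (\<alpha> i)\<^sup>2 + 2 * horizon r * ?D + (M + 2 * \<alpha> i) * (\<alpha> i * p i + ?D)
        + 3 * horizon r * sizes_above M) / (2 * \<kappa>) / r"
      using \<kappa> r by (intro divide_right_mono) (auto simp: pos_le_divide_eq mult.commute)
    also have "\<dots> = ?h r + 3 * ?Y * sizes_above M / (2 * \<kappa>)"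
      using r \<kappa> by (simp add: horizon_def field_simps)
    also have "\<dots> < e / 2 + e / 2" by (rule add_strict_mono[OF elim(2) M(1)])
    finally show ?case using r by (simp add: mean_nonneg avail_length_nonneg)
  qed
qed

lemma refill_tendsto:
  assumes "((\<lambda>r. mean r (loose_count m r) / r) \<longlongrightarrow> 0) at_top"
  shows "((\<lambda>r. mean r (\<lambda>S. of_bool (refill m (r * y) (horizon r) S) :: real)) \<longlongrightarrow> 0) at_top"
proof (rule tendsto_0_squeeze)
  let ?w = "window_bound m" and ?k = "2 + \<alpha> i / \<alpha> 1"
  let ?P = "\<lambda>r. mean r (\<lambda>S. of_bool (refill m (r * y) (horizon r) S) :: real)"
  let ?X = "\<lambda>r. mean r (loose_count m r)" and ?Q = "\<lambda>r. mean r (avail_length (horizon r))"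
    and ?n = "\<lambda>r. mean r (small_count r)"
  let ?h = "\<lambda>r. (2 * (?X r / r) + (?w + 1) * (2 / \<alpha> i * (?Q r / r) + ?n r / r + ?k / r)) / p i"
  show "\<forall>\<^sub>F r in at_top. 0 \<le> ?P r" by simp
  have pi: "0 < p i" using prob_pos type_i .
  have "(?h \<longlongrightarrow> (2 * 0 + (?w + 1) * (2 / \<alpha> i * 0 + 0 + 0)) / p i) at_top"
    using pi by (intro tendsto_intros assms avail_tendsto small_tendsto const_over_tendsto_0) auto
  then show "(?h \<longlongrightarrow> 0) at_top" by simp
  show "\<forall>\<^sub>F r in at_top. ?P r \<le> ?h r"
    using eventually_large
  proof eventually_elim
    case (elim r)
    note sc = single_scale[OF elim]
    have r: "0 < r" using sc(2) .
    have "r * p i * ?P r \<le> 2 * ?X r + (?w + 1) * (2 / \<alpha> i * ?Q r + ?n r + 2 + \<alpha> i / \<alpha> 1)"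
      by (rule refill_expectation[OF sc])
    also have "\<dots> = r * p i * ?h r" using r pi by (simp add: divide_simps) (simp add: algebra_simps)
    finally show ?case by (simp only: mult_le_cancel_left_pos[OF mult_pos_pos[OF r pi]])
  qed
qed

text \<open>If level \<open>m\<close> is negligible, refill states become rare, which bounds level
  \<open>Suc m\<close> on slot-free states; \<open>loose_expectation\<close> extends this to all
  states. The factors of order \<open>r\<close> are compensated because the refill probability tends
  to zero.\<close>

lemma loose_tendsto: "((\<lambda>r. mean r (loose_count m r) / r) \<longlongrightarrow> 0) at_top"
proof (induction m)
  case 0
  have "\<forall>\<^sub>F r in at_top. mean r (loose_count 0 r) / r = 0"
    using eventually_gt_at_top[of 0]
  proof eventually_elim
    case (elim r)
    have "mean r (loose_count 0 r) = mean r (\<lambda>_. 0)"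
      using loose_0_empty[OF reachable_valid]
      by (intro integral_cong_AE AE_reachable[OF stationary[OF elim]]) auto
    then show ?case by simp
  qed
  then show ?case by (rule tendsto_eventually)
next
  case (Suc m)
  let ?w = "window_bound (Suc m)" and ?Y = "(y + step) / \<alpha> 1"
  define \<kappa> where "\<kappa> = drift_gap"
  have \<kappa>: "0 < \<kappa>" using drift_gap_pos by (simp add: \<kappa>_def)
  let ?P = "\<lambda>r. mean r (\<lambda>S. of_bool (refill m (r * y) (horizon r) S) :: real)"
  let ?X = "\<lambda>r. mean r (loose_count (Suc m) r)" and ?Q = "\<lambda>r. mean r (avail_length (horizon r))"
    and ?n = "\<lambda>r. mean r (small_count r)" and ?D = "\<lambda>r. mean r (error r)"
  let ?h = "\<lambda>r. (\<alpha> i * p i * ((?Y + 1 / r + 1) * ?P r + ?n r / r) + (?Y + 1 / r) * ?D r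
      + 2 * ?w * ((?Y + 1 / r) * (?Q r / r) + \<alpha> i * p i / r + ?D r * (1 / r)) + ?Q r / r) / \<kappa>"
  show ?case
  proof (rule tendsto_0_squeeze)
    show "\<forall>\<^sub>F r in at_top. 0 \<le> ?X r / r"
      using eventually_gt_at_top[of 0] by eventually_elim (simp add: mean_nonneg)
    have "(?h \<longlongrightarrow> (\<alpha> i * p i * ((?Y + 0 + 1) * 0 + 0) + (?Y + 0) * 0
      + 2 * ?w * ((?Y + 0) * 0 + 0 + 0 * 0) + 0) / \<kappa>) at_top"
      using \<kappa> size_1_pos
      by (intro tendsto_intros refill_tendsto Suc avail_tendsto small_tendsto error_tendsto const_over_tendsto_0) auto
    then show "(?h \<longlongrightarrow> 0) at_top" by simp
    show "\<forall>\<^sub>F r in at_top. ?X r / r \<le> ?h r"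
      using eventually_large
    proof eventually_elim
      case (elim r)
      note sc = single_scale[OF elim]
      have r: "0 < r" using sc(2) .
      let ?N = "horizon r / \<alpha> 1 + 1"
      have N: "?N = r * (?Y + 1 / r)" using r by (simp add: horizon_def distrib_left)
      let ?f = "mean r (\<lambda>S. loose_count (Suc m) r S * of_bool (slots (horizon r) S = {}))"
      have api: "0 \<le> \<alpha> i * p i" using size_i_pos prob_pos[OF type_i] by simp
      have "\<kappa> * ?X r \<le> \<alpha> i * p i * ?f + ?N * ?D r + 2 * ?w * (?N / r * ?Q r + \<alpha> i * p i + ?D r) + ?Q r"
        unfolding \<kappa>_def by (rule loose_expectation[OF sc])
      also have "\<alpha> i * p i * ?f \<le> \<alpha> i * p i * ((?N + r) * ?P r + ?n r)"
        using loose_full_expectation[OF sc] api by (rule mult_left_mono)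
      also have "\<alpha> i * p i * ((?N + r) * ?P r + ?n r) + ?N * ?D r
          + 2 * ?w * (?N / r * ?Q r + \<alpha> i * p i + ?D r) + ?Q r = \<kappa> * (r * ?h r)"
        unfolding N using r \<kappa> size_1_pos by (simp add: divide_simps)
      finally have "?X r \<le> r * ?h r" by (simp only: mult_le_cancel_left_pos[OF \<kappa>])
      then show ?case using r by (simp add: pos_divide_le_eq mult.commute)
    qed
  qed
qed

section \<open>Number of items that start between \<open>r y\<close> and the horizon\<close>

abbreviation "start_count r S \<equiv> real (card {b \<in> S. r * y \<le> fst b \<and> fst b < horizon r})"

text \<open>Cells of length \<open>(m + 1) * \<alpha> i\<close> with \<open>m - 1\<close> points
  each have density \<open>1 / \<alpha> i - 2 / ((m + 1) * \<alpha> i)\<close>. Of the allowed loss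
  \<open>\<delta>\<close>, one third goes to this defect, one to long items and one to the terms
  that vanish with \<open>r\<close>.\<close>

lemma start_count_lower:
  assumes \<delta>: "0 < \<delta>"
  shows "\<forall>\<^sub>F r in at_top. step / \<alpha> i - \<delta> \<le> mean r (start_count r) / r"
proof -
  have "((\<lambda>M. sizes_above M / \<alpha> i) \<longlongrightarrow> 0 / \<alpha> i) at_top"
    using size_i_pos by (intro tendsto_intros sizes_above_tendsto) auto
  then have "\<forall>\<^sub>F M in at_top. sizes_above M / \<alpha> i < \<delta> / 3"
    using \<delta> by (intro order_tendstoD(2)) auto
  then obtain M where M: "sizes_above M / \<alpha> i < \<delta> / 3" by (auto dest: eventually_happens)
  \<comment> \<open>The first bound makes an item that crosses a cell longer than \<open>M\<close>,
    the second makes the defect of the density small.\<close>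
  obtain n where n: "max (M / \<alpha> i) (6 * step / (\<alpha> i * \<delta>)) < real n" using reals_Archimedean2 by blast
  define m where "m = n + 1"
  have m: "1 \<le> m" "M < real m * \<alpha> i" "2 * step / ((real m + 1) * \<alpha> i) < \<delta> / 3"
  proof -
    show "1 \<le> m" by (simp add: m_def)
    have "M < real n * \<alpha> i" using n size_i_pos by (simp add: pos_divide_less_eq)
    then show "M < real m * \<alpha> i" using size_i_pos by (simp add: m_def distrib_right)
    have "6 * step < real n * (\<alpha> i * \<delta>)" using n size_i_pos \<delta> by (simp add: pos_divide_less_eq)
    also have "\<dots> \<le> (real m + 1) * (\<alpha> i * \<delta>)" using size_i_pos \<delta> by (intro mult_right_mono) (auto simp: m_def)
    finally have "6 * step < (real m + 1) * (\<alpha> i * \<delta>)" .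
    then show "2 * step / ((real m + 1) * \<alpha> i) < \<delta> / 3"
      using size_i_pos by (simp add: pos_divide_less_eq mult_ac)
  qed
  let ?Q = "\<lambda>r. mean r (avail_length (horizon r))" and ?X = "\<lambda>r. mean r (loose_count m r)"
  let ?h = "\<lambda>r. (real m - 1) * (2 / r + ?X r / r + ?Q r / r / \<alpha> i) + ?Q r / r / \<alpha> i"
  have "(?h \<longlongrightarrow> (real m - 1) * (0 + 0 + 0 / \<alpha> i) + 0 / \<alpha> i) at_top"
    using size_i_pos by (intro tendsto_intros avail_tendsto loose_tendsto const_over_tendsto_0) auto
  then have "\<forall>\<^sub>F r in at_top. ?h r < \<delta> / 3" using \<delta> by (intro order_tendstoD(2)) auto
  with eventually_large show ?thesis
    using eventually_ge_at_top[of "width m / step"]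
  proof eventually_elim
    case (elim r)
    note sc = single_scale[OF elim(1)]
    have r: "0 < r" using sc(2) .
    have L: "0 \<le> horizon r" using horizon(3)[OF r] by simp
    \<comment> \<open>The region has the length of \<open>q\<close> cells. Since
      \<open>card_points_ge\<close> needs room for \<open>K + 1\<close> cells, \<open>K\<close> is
      one less than \<open>q\<close> rounded down, and at most two cells are lost.\<close>
    define q where "q = step * r / width m"
    define K where "K = nat (\<lfloor>q\<rfloor> - 1)"
    have q1: "1 \<le> q" using elim(3) step_pos width_pos[of m] by (simp add: q_def pos_divide_le_eq pos_le_divide_eq mult.commute)
    then have K: "q - 2 \<le> real K" "real K + 1 \<le> q" unfolding K_def by linarith+
    have "(real K + 1) * width m \<le> q * width m" using K(2) width_pos[of m] by (intro mult_right_mono) auto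
    then have KL: "r * y + (real K + 1) * width m \<le> horizon r"
      using width_pos[of m] by (simp add: q_def horizon_def distrib_left mult.commute)
    have mi: "0 < real m * \<alpha> i" using m(1) size_i_pos by simp
    let ?V = "big_length M (horizon r)"
    have bV: "bdd ?V" using big_length_bound[OF reachable_valid L] by (intro bddI[of _ "(horizon r / \<alpha> 1 + 1) * horizon r"]) simp
    have bR: "bdd (start_count r)" using L by (intro bdd_card_inside) auto
    note bX = bdd_loose[OF L, of m "r * y"] and bQ = bdd_avail[OF L]
    let ?lhs = "\<lambda>S. (real m - 1) * (q - 2 - loose_count m r S - avail_length (horizon r) S / \<alpha> i - ?V S / (real m * \<alpha> i))
        - avail_length (horizon r) S / \<alpha> i"
    have "mean r ?lhs \<le> mean r (start_count r)"
    proof (rule expectation_mono[OF sc(1)])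
      fix S assume R: "S \<in> reachable I \<alpha>"
      then have S: "valid S" by (rule reachable_valid)
      have "(real m - 1) * (q - 2 - loose_count m r S - avail_length (horizon r) S / \<alpha> i - ?V S / (real m * \<alpha> i))
        \<le> (real m - 1) * (real K - loose_count m r S - avail_length (horizon r) S / \<alpha> i - ?V S / (real m * \<alpha> i))"
        using m(1) K(1) by (intro mult_left_mono) auto
      then show "?lhs S \<le> start_count r S"
        using card_points_ge[OF S sc(3) m(1,2) KL] card_points_le[OF S, of "horizon r" "r * y"] by linarith
    qed (use bV bR bX bQ in \<open>auto intro!: bdd_intros\<close>)
    moreover have "mean r ?lhs = (real m - 1) * (q - 2 - ?X r - ?Q r / \<alpha> i - mean r ?V / (real m * \<alpha> i)) - ?Q r / \<alpha> i"
      using integrable_bdd[OF sc(1)] bV bX bQ by simp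
    \<comment> \<open>A cell spoiled by a long item costs \<open>m - 1\<close> points but accounts
      for a length \<open>real m * \<alpha> i\<close> of that item. So the total cost is bounded
      independently of \<open>m\<close>.\<close>
    moreover have "(real m - 1) * (mean r ?V / (real m * \<alpha> i)) \<le> r * (sizes_above M / \<alpha> i)"
    proof -
      have V0: "0 \<le> mean r ?V"
        using big_length_bound(1)[OF reachable_valid L]
        by (intro integral_nonneg_AE AE_reachable[OF sc(1)]) auto
      have "(real m - 1) * (mean r ?V / (real m * \<alpha> i)) \<le> real m * (mean r ?V / (real m * \<alpha> i))"
        using V0 mi by (intro mult_right_mono) auto
      also have "\<dots> = mean r ?V / \<alpha> i" using m(1) by simp
      also have "\<dots> \<le> r * sizes_above M / \<alpha> i"
        using big_length_expectation[OF sc] size_i_pos by (intro divide_right_mono) auto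
      finally show ?thesis by simp
    qed
    ultimately have main: "(real m - 1) * q - r * (sizes_above M / \<alpha> i) - (real m - 1) * (2 + ?X r + ?Q r / \<alpha> i) - ?Q r / \<alpha> i
        \<le> mean r (start_count r)"
      by (simp add: algebra_simps)
    have "(real m - 1) * q = r * (step / \<alpha> i - 2 * step / ((real m + 1) * \<alpha> i))"
      using size_i_pos by (simp add: q_def width_def divide_simps) (simp add: algebra_simps)
    moreover have "(real m - 1) * (2 + ?X r + ?Q r / \<alpha> i) + ?Q r / \<alpha> i = r * ?h r"
      using r size_i_pos by (simp add: field_simps)
    ultimately have "r * (step / \<alpha> i - 2 * step / ((real m + 1) * \<alpha> i) - sizes_above M / \<alpha> i - ?h r) \<le> mean r (start_count r)"
      using main unfolding right_diff_distrib by linarith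
    moreover have "step / \<alpha> i - \<delta> \<le> step / \<alpha> i - 2 * step / ((real m + 1) * \<alpha> i) - sizes_above M / \<alpha> i - ?h r"
      using m(3) M elim(2) by linarith
    then have "r * (step / \<alpha> i - \<delta>) \<le> r * (step / \<alpha> i - 2 * step / ((real m + 1) * \<alpha> i) - sizes_above M / \<alpha> i - ?h r)"
      using r by (intro mult_left_mono) auto
    ultimately have "r * (step / \<alpha> i - \<delta>) \<le> mean r (start_count r)" by linarith
    then show ?case using r by (simp add: pos_le_divide_eq mult.commute)
  qed
qed

lemma size_gap: "\<exists>d>0. \<forall>k\<in>I. i < k \<longrightarrow> \<alpha> i + d \<le> \<alpha> k"
proof (cases "Suc i \<in> I")
  case True
  have "\<alpha> (Suc i) \<le> \<alpha> k" if "k \<in> I" "i < k" for k using size_le[OF True that(1)] that by simp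
  then show ?thesis using size_less[OF type_i True] by (intro exI[of _ "\<alpha> (Suc i) - \<alpha> i"]) auto
next
  case False
  then have "\<not> i < k" if "k \<in> I" for k using type_down[OF that, of "Suc i"] by auto
  then show ?thesis by (intro exI[of _ 1]) auto
qed

section \<open>The number of \<open>i\<close>-items before the horizon\<close>

abbreviation "fraction r S \<equiv> 1 / r * real (F \<alpha> i (horizon r) S)"

definition target :: real where
  "target = (y + step - \<beta> \<alpha> p (i - 1)) / \<alpha> i"

lemma target_eq: "target = density i + step / \<alpha> i"
  by (simp add: target_def density_def add_divide_distrib diff_divide_distrib)

text \<open>Volume: smaller types counted up to their own levels and type \<open>i\<close> counted
  up to the horizon are disjoint items inside \<open>[0, horizon r)\<close>. The room that the
  smaller types take is known up to the deviation.\<close>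

lemma fraction_upper:
  assumes r: "0 < r" and R: "S \<in> reachable I \<alpha>"
  shows "fraction r S \<le> target + 2 / \<alpha> i * deviation r S"
proof -
  have S: "valid S" using R by (rule reachable_valid)
  define v where "v j = (if j < i then r * level j else horizon r)" for j
  have v: "v j \<le> horizon r" for j using horizon(4)[OF r] by (simp add: v_def)
  have split: "{1..i} = insert i {1..i - 1}" using i_ge_1 by auto
  have "0 \<le> spare (horizon r) v S" using horizon(3)[OF r] v by (intro spare_nonneg(1)[OF S]) auto
  then have "(\<Sum>j=1..i. \<alpha> j * real (F \<alpha> j (v j) S)) \<le> horizon r" by (simp add: spare_F[OF S])
  moreover have "(\<Sum>j=1..i. \<alpha> j * real (F \<alpha> j (v j) S))
      = \<alpha> i * real (F \<alpha> i (horizon r) S) + (\<Sum>j=1..i - 1. \<alpha> j * real (F \<alpha> j (v j) S))"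
    unfolding split using i_ge_1 by (simp add: v_def)
  moreover have "(\<Sum>j=1..i. \<alpha> j * real (F \<alpha> j (r * level j) S))
      = \<alpha> i * real (F \<alpha> i (r * y) S) + (\<Sum>j=1..i - 1. \<alpha> j * real (F \<alpha> j (r * level j) S))"
    unfolding split using i_ge_1 by (simp add: level_def)
  moreover have "(\<Sum>j=1..i - 1. \<alpha> j * real (F \<alpha> j (v j) S)) = (\<Sum>j=1..i - 1. \<alpha> j * real (F \<alpha> j (r * level j) S))"
    using i_ge_1 by (intro sum.cong) (auto simp: v_def)
  ultimately have "\<alpha> i * real (F \<alpha> i (horizon r) S) \<le> horizon r - r * (y - deviation r S) + \<alpha> i * real (F \<alpha> i (r * y) S)"
    using sum_count_ge[OF r, of S] by linarith
  also have "\<alpha> i * real (F \<alpha> i (r * y) S) \<le> r * (\<alpha> i * density i + deviation r S)"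
    using r by (rule F_y_le)
  finally have "\<alpha> i * real (F \<alpha> i (horizon r) S) \<le> r * (\<alpha> i * target + 2 * deviation r S)"
    using size_i_pos by (simp add: horizon_def target_eq algebra_simps)
  then have "real (F \<alpha> i (horizon r) S) \<le> r * (\<alpha> i * target + 2 * deviation r S) / \<alpha> i"
    using size_i_pos by (simp add: pos_le_divide_eq mult.commute)
  also have "\<dots> = r * (target + 2 / \<alpha> i * deviation r S)" using size_i_pos by (simp add: field_simps)
  finally show ?thesis using r by (simp add: pos_divide_le_eq mult.commute)
qed

text \<open>This is \<open>F_ge\<close> divided by \<open>r\<close> and averaged. If the start count
  is about \<open>r * step / \<alpha> i\<close>, the part \<open>\<alpha> i / d\<close> of its
  coefficient cancels \<open>step / d\<close>, and \<open>step / \<alpha> i\<close> remains.\<close>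

lemma fraction_lower:
  assumes r: "0 < r" and d: "0 < d" "\<forall>k\<in>I. i < k \<longrightarrow> \<alpha> i + d \<le> \<alpha> k"
  shows "density i - mean r (deviation r) / \<alpha> i + (1 + \<alpha> i / d) * (mean r (start_count r) / r) - step / d
    - (1 + \<alpha> i / d) * (mean r (small_count r) / r + 1 / r) \<le> mean r (fraction r)"
proof -
  note st = stationary[OF r]
  have L: "0 \<le> horizon r" using horizon(3)[OF r] by simp
  have bR: "bdd (start_count r)" using L by (intro bdd_card_inside) auto
  have bF: "bdd (\<lambda>S. real (F \<alpha> i (horizon r) S))" using L by (rule bdd_F)
  note bn = bdd_small_inside[OF L, of "r * y"] and bD = bdd_deviation[OF r]
  let ?c = "1 + \<alpha> i / d"
  let ?f = "\<lambda>S. density i - deviation r S / \<alpha> i + ?c * (start_count r S / r) - step / d - ?c * (small_count r S / r + 1 / r)"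
  have "mean r ?f \<le> mean r (fraction r)"
  proof (rule expectation_mono[OF st])
    fix S assume R: "S \<in> reachable I \<alpha>"
    then have S: "valid S" by (rule reachable_valid)
    let ?q = "1 / r * real (F \<alpha> i (r * y) S)"
    have "real (F \<alpha> i (r * y) S) + start_count r S - 1 - small_count r S
        - (horizon r - r * y + \<alpha> i * small_count r S + \<alpha> i - \<alpha> i * start_count r S) / d \<le> real (F \<alpha> i (horizon r) S)"
      using F_ge[OF S horizon(1,2)[OF r] d(1)] d(2) by blast
    then have "(real (F \<alpha> i (r * y) S) + start_count r S - 1 - small_count r S
        - (horizon r - r * y + \<alpha> i * small_count r S + \<alpha> i - \<alpha> i * start_count r S) / d) / r \<le> real (F \<alpha> i (horizon r) S) / r"
      using r by (intro divide_right_mono) auto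
    also have "(real (F \<alpha> i (r * y) S) + start_count r S - 1 - small_count r S
        - (horizon r - r * y + \<alpha> i * small_count r S + \<alpha> i - \<alpha> i * start_count r S) / d) / r
        = ?q + ?c * (start_count r S / r) - step / d - ?c * (small_count r S / r + 1 / r)"
      using r d(1) by (simp add: horizon_def divide_simps) (simp add: algebra_simps)
    finally have "?q + ?c * (start_count r S / r) - step / d - ?c * (small_count r S / r + 1 / r) \<le> fraction r S" by simp
    moreover have "density i - deviation r S / \<alpha> i \<le> ?q"
    proof -
      have "\<bar>?q - density i\<bar> \<le> deviation r S / \<alpha> i"
        using deviation_i[of r S] size_i_pos by (simp add: pos_le_divide_eq mult.commute)
      then show ?thesis by linarith
    qed
    ultimately show "?f S \<le> fraction r S" by linarith
  qed (use bR bF bn bD in \<open>auto intro!: bdd_intros\<close>)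
  moreover have "mean r ?f = density i - mean r (deviation r) / \<alpha> i + ?c * (mean r (start_count r) / r) - step / d
      - ?c * (mean r (small_count r) / r + 1 / r)"
    using integrable_bdd[OF st] bR bn bD by simp
  ultimately show ?thesis by simp
qed

text \<open>The upper bound holds in every reachable state up to the deviation, so the absolute
  value may be replaced by \<open>target - fraction r S\<close> plus a multiple of the deviation.
  Then the lower bound for the mean suffices.\<close>

lemma fraction_tendsto: "((\<lambda>r. mean r (\<lambda>S. \<bar>fraction r S - target\<bar>)) \<longlongrightarrow> 0) at_top"
proof (rule tendstoI)
  fix e :: real assume e: "0 < e"
  obtain d where d: "0 < d" "\<forall>k\<in>I. i < k \<longrightarrow> \<alpha> i + d \<le> \<alpha> k" using size_gap by blast
  let ?c = "1 + \<alpha> i / d"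
  have c: "1 \<le> ?c" using d(1) size_i_pos by simp
  define \<delta> where "\<delta> = e / (2 * ?c)"
  have \<delta>: "0 < \<delta>" using e c by (simp add: \<delta>_def)
  have "z * (e / (2 * z)) = e / 2" if "1 \<le> z" for z :: real using that by simp
  then have c\<delta>: "?c * \<delta> = e / 2" unfolding \<delta>_def using c .
  let ?D = "\<lambda>r. mean r (deviation r)"
  let ?h = "\<lambda>r. 5 / \<alpha> i * ?D r + ?c * (mean r (small_count r) / r + 1 / r)"
  have "(?h \<longlongrightarrow> 5 / \<alpha> i * 0 + ?c * (0 + 0)) at_top"
    by (intro tendsto_intros deviation_tendsto small_tendsto const_over_tendsto_0)
  then have "\<forall>\<^sub>F r in at_top. ?h r < e / 2" using e by (intro order_tendstoD(2)) auto
  with start_count_lower[OF \<delta>] show "\<forall>\<^sub>F r in at_top. dist (mean r (\<lambda>S. \<bar>fraction r S - target\<bar>)) 0 < e"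
    using eventually_gt_at_top[of 0]
  proof eventually_elim
    case (elim r)
    have r: "0 < r" using elim(3) .
    note st = stationary[OF r]
    have bF: "bdd (fraction r)" using horizon(3)[OF r] by (intro bdd_intros bdd_F) auto
    note bD = bdd_deviation[OF r]
    have "mean r (\<lambda>S. \<bar>fraction r S - target\<bar>) \<le> mean r (\<lambda>S. target - fraction r S + 4 / \<alpha> i * deviation r S)"
    proof (rule expectation_mono[OF st])
      fix S assume R: "S \<in> reachable I \<alpha>"
      have "0 \<le> 2 / \<alpha> i * deviation r S" using deviation_nonneg size_i_pos by simp
      moreover have "4 / \<alpha> i * deviation r S = 2 / \<alpha> i * deviation r S + 2 / \<alpha> i * deviation r S" by simp
      ultimately show "\<bar>fraction r S - target\<bar> \<le> target - fraction r S + 4 / \<alpha> i * deviation r S"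
        using fraction_upper[OF r R] by linarith
    qed (use bF bD in \<open>auto intro!: bdd_intros bdd_abs\<close>)
    also have "\<dots> = target - mean r (fraction r) + 4 / \<alpha> i * ?D r"
      using integrable_bdd[OF st bF] integrable_bdd[OF st bD] by simp
    also have "\<dots> \<le> ?c * \<delta> + ?h r"
    proof -
      have "?c * (step / \<alpha> i - \<delta>) \<le> ?c * (mean r (start_count r) / r)"
        using elim(1) c by (intro mult_left_mono) auto
      moreover have "?c * (step / \<alpha> i - \<delta>) = step / \<alpha> i + step / d - ?c * \<delta>"
        using size_i_pos d(1) by (simp add: field_simps)
      moreover have "5 / \<alpha> i * ?D r = ?D r / \<alpha> i + 4 / \<alpha> i * ?D r" by simp
      ultimately show ?thesis
        using fraction_lower[OF r d] target_eq by linarith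
    qed
    also have "\<dots> < e / 2 + e / 2" unfolding c\<delta> using elim(2) by (rule add_strict_left_mono)
    also have "e / 2 + e / 2 = e" by simp
    finally show ?case by (simp add: mean_nonneg)
  qed
qed

end

theorem theorem4p3:
  fixes I :: "nat set" and \<alpha> p :: "nat \<Rightarrow> real" and \<pi> :: "real \<Rightarrow> config pmf"
    and i :: nat and y :: real
  assumes "first_fit_model I \<alpha> p"
    and "\<And>r. 0 < r \<Longrightarrow> stationary_distribution I \<alpha> p r (\<pi> r)"
    and "i \<in> I"
    and "\<And>j. j \<in> I \<Longrightarrow> j < i \<Longrightarrow>
           converges_in_prob \<pi> (\<lambda>r S. 1 / r * real (F \<alpha> j (r * \<beta> \<alpha> p j) S)) (p j)"
    and "y \<in> {\<beta> \<alpha> p (i - 1)..<\<beta> \<alpha> p i}"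
    and "converges_in_prob \<pi> (\<lambda>r S. 1 / r * real (F \<alpha> i (r * y) S))
           ((y - \<beta> \<alpha> p (i - 1)) / \<alpha> i)"
  shows "\<exists>\<epsilon>>0. converges_in_prob \<pi> (\<lambda>r S. 1 / r * real (F \<alpha> i (r * (y + \<epsilon>)) S))
           ((y + \<epsilon> - \<beta> \<alpha> p (i - 1)) / \<alpha> i)"
proof -
  interpret first_fit_model I \<alpha> p by (rule assms(1))
  interpret first_fit_limit I \<alpha> p i \<pi> y
    by unfold_locales (use assms in auto)
  have "converges_in_prob \<pi> (\<lambda>r S. 1 / r * real (F \<alpha> i (horizon r) S)) target"
  proof (rule expectation_converges_in_prob[OF fraction_tendsto])
    show "\<forall>\<^sub>F r in at_top. integrable (measure_pmf (\<pi> r)) (\<lambda>S. \<bar>1 / r * real (F \<alpha> i (horizon r) S) - target\<bar>)"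
      using eventually_gt_at_top[of 0]
    proof eventually_elim
      case (elim r)
      then show ?case
        using horizon(3)[OF elim] by (intro integrable_bdd[OF stationary] bdd_abs bdd_intros bdd_F) auto
    qed
  qed
  then show ?thesis
    using step_pos by (intro exI[of _ step]) (simp add: horizon_def target_def)
qed

end
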